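(* Let $L$ be a lattice with finite width $w$. Then there are at most countably many non-isomorphic profinite groups $G$ with $\mathcal{L}_c(G)\simeq L$, and likewise at most countably many non-isomorphic profinite groups $G$ with $\mathcal{L}_o(G)\simeq L$. If, moreover, $L$ has no non-trivial chain as a direct factor, then there are at most finitely many non-isomorphic profinite groups $G$ with $\mathcal{L}_c(G)\simeq L$, and likewise at most finitely many non-isomorphic profinite groups $G$ with $\mathcal{L}_o(G)\simeq L$.
   Context: For a profinite group $G$: $\mathcal{L}_c(G)$ is the lattice of all closed subgroups of $G$, with meet the intersection and join $\overline{\langle X,Y\rangle}$; $\mathcal{L}_o(G)$ is the lattice of all open subgroups of $G$, with meet the intersection and join $\langle X,Y\rangle$. A lattice has finite width $w$ if all its antichains (sets of pairwise incomparable elements) are finite and $w$ is the maximum cardinality of an antichain. A lattice $L$ has a non-trivial chain as a direct factor if $L\simeq C\times L'$ for some lattice $L'$ and some totally ordered lattice $C$ with at least two elements. Isomorphisms of profinite groups are isomorphisms of topological groups. *)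

theory Defs
  imports "HOL-Algebra.Algebra" "HOL-Analysis.Analysis"
begin

section \<open>Lattices\<close>

text \<open>Lattices are the carrier-based ones of \<open>HOL-Algebra\<close>, in which meet and join are the
  infimum and supremum of the order.\<close>

definition lattice_isomorphic :: "'a gorder \<Rightarrow> 'b gorder \<Rightarrow> bool" where
  "lattice_isomorphic L M \<longleftrightarrow>
     (\<exists>f. bij_betw f (carrier L) (carrier M) \<and> join_pres L M f \<and> meet_pres L M f)"

definition antichain :: "'a gorder \<Rightarrow> 'a set \<Rightarrow> bool" where
  "antichain L A \<longleftrightarrow> A \<subseteq> carrier L \<and> (\<forall>x\<in>A. \<forall>y\<in>A. x \<noteq> y \<longrightarrow> \<not> x \<sqsubseteq>\<^bsub>L\<^esub> y)"

definition has_width :: "'a gorder \<Rightarrow> nat \<Rightarrow> bool" where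
  "has_width L w \<longleftrightarrow>
     (\<forall>A. antichain L A \<longrightarrow> finite A \<and> card A \<le> w) \<and> (\<exists>A. antichain L A \<and> card A = w)"

definition prod_gorder :: "'a gorder \<Rightarrow> 'b gorder \<Rightarrow> ('a \<times> 'b) gorder" where
  "prod_gorder L M =
     \<lparr>carrier = carrier L \<times> carrier M, eq = (=),
      le = (\<lambda>x y. fst x \<sqsubseteq>\<^bsub>L\<^esub> fst y \<and> snd x \<sqsubseteq>\<^bsub>M\<^esub> snd y)\<rparr>"

text \<open>HOL cannot quantify over types inside a formula, so both factors are taken over the type of
  \<open>L\<close>.  This loses nothing for non-empty \<open>L\<close>, see
  \<open>has_nontrivial_chain_factorI\<close>: both factors embed into \<open>L\<close>.\<close>

definition has_nontrivial_chain_factor :: "'a gorder \<Rightarrow> bool" where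
  "has_nontrivial_chain_factor L \<longleftrightarrow>
     (\<exists>(C :: 'a gorder) (L' :: 'a gorder).
        total_order C \<and> (\<exists>x\<in>carrier C. \<exists>y\<in>carrier C. x \<noteq> y) \<and>
        lattice L' \<and> lattice_isomorphic L (prod_gorder C L'))"


section \<open>Profinite groups\<close>

record 'a topgroup = "'a monoid" +
  grp_topology :: "'a topology"

locale profinite_group = group G for G :: "'a topgroup" (structure) +
  assumes topspace_eq: "topspace (grp_topology G) = carrier G"
    and continuous_mult: "continuous_map (prod_topology (grp_topology G) (grp_topology G))
          (grp_topology G) (\<lambda>(x, y). x \<otimes> y)"
    and continuous_inv: "continuous_map (grp_topology G) (grp_topology G) (\<lambda>x. inv x)"
    and compact: "compact_space (grp_topology G)"
    and Hausdorff: "Hausdorff_space (grp_topology G)"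
    and totally_disconnected:
      "\<And>x. x \<in> carrier G \<Longrightarrow> connected_component_of_set (grp_topology G) x = {x}"

text \<open>An equivalence relation on the profinite groups over the type \<open>'a\<close>
  (\<open>equiv_profinite_iso\<close>).  The elements of \<open>K // profinite_iso\<close> are therefore the isomorphism
  classes of the groups in \<open>K\<close>.\<close>

definition profinite_iso :: "('a topgroup \<times> 'a topgroup) set" where
  "profinite_iso = {(G, H). profinite_group G \<and> profinite_group H \<and>
     (\<exists>f \<in> iso G H. homeomorphic_map (grp_topology G) (grp_topology H) f)}"

text \<open>The join in each of these orders is the expected one, \<open>grp_topology G closure_of generate G (A \<union> B)\<close>
  for closed subgroups and \<open>generate G (A \<union> B)\<close> for open ones; see the lemmas
  \<open>closed_subgroup_lattice\<close> and \<open>open_subgroup_lattice\<close> below.\<close>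

definition closed_subgroup_lattice :: "'a topgroup \<Rightarrow> 'a set gorder" where
  "closed_subgroup_lattice G =
     \<lparr>carrier = {H. subgroup H G \<and> closedin (grp_topology G) H}, eq = (=), le = (\<subseteq>)\<rparr>"

definition open_subgroup_lattice :: "'a topgroup \<Rightarrow> 'a set gorder" where
  "open_subgroup_lattice G =
     \<lparr>carrier = {H. subgroup H G \<and> openin (grp_topology G) H}, eq = (=), le = (\<subseteq>)\<rparr>"


section \<open>Order isomorphisms and transport of chain factors\<close>

lemma (in partial_order) join_eqI:
  assumes "least L s (Upper L {x, y})"
  shows "x \<squnion> y = s"
  unfolding join_def sup_def using assms by (metis someI least_unique)

lemma (in partial_order) meet_eqI:
  assumes "greatest L s (Lower L {x, y})"
  shows "x \<sqinter> y = s"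
  unfolding meet_def inf_def using assms by (metis someI greatest_unique)

lemma order_iso_imp_lattice:
  assumes "lattice L" "partial_order M" and f: "bij_betw f (carrier L) (carrier M)"
    and le: "\<And>x y. x \<in> carrier L \<Longrightarrow> y \<in> carrier L \<Longrightarrow> f x \<sqsubseteq>\<^bsub>M\<^esub> f y \<longleftrightarrow> x \<sqsubseteq>\<^bsub>L\<^esub> y"
  shows "lattice M" and "lattice_isomorphic L M"
proof -
  interpret L: lattice L by fact
  interpret M: partial_order M by fact
  have im: "carrier M = f ` carrier L" using f by (auto simp: bij_betw_def)
  have J: "least M (f (x \<squnion>\<^bsub>L\<^esub> y)) (Upper M {f x, f y})" if "x \<in> carrier L" "y \<in> carrier L" for x y
    using that L.join_left L.join_right L.join_le
    by (auto simp: least_def Upper_def im le)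
  have K: "greatest M (f (x \<sqinter>\<^bsub>L\<^esub> y)) (Lower M {f x, f y})" if "x \<in> carrier L" "y \<in> carrier L" for x y
    using that L.meet_left L.meet_right L.meet_le
    by (auto simp: greatest_def Lower_def im le)
  show M: "lattice M"
  proof unfold_locales
    fix x y assume "x \<in> carrier M" "y \<in> carrier M"
    then obtain a b where "a \<in> carrier L" "b \<in> carrier L" "x = f a" "y = f b"
      by (auto simp: im)
    then show "\<exists>s. least M s (Upper M {x, y})" "\<exists>s. greatest M s (Lower M {x, y})"
      using J[of a b] K[of a b] by blast+
  qed
  show "lattice_isomorphic L M"
    unfolding lattice_isomorphic_def join_pres_def meet_pres_def
    by (intro exI[of _ f] conjI ballI f M \<open>lattice L\<close> M.join_eqI[OF J, symmetric]
        M.meet_eqI[OF K, symmetric])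
qed

lemma lattice_isomorphic_order_iso:
  assumes "lattice_isomorphic L M"
  obtains f where "bij_betw f (carrier L) (carrier M)" "lattice L" "lattice M"
    "\<And>x y. x \<in> carrier L \<Longrightarrow> y \<in> carrier L \<Longrightarrow> f x \<sqsubseteq>\<^bsub>M\<^esub> f y \<longleftrightarrow> x \<sqsubseteq>\<^bsub>L\<^esub> y"
proof -
  obtain f where f: "bij_betw f (carrier L) (carrier M)" "join_pres L M f"
    using assms by (auto simp: lattice_isomorphic_def)
  then interpret L: lattice L + M: lattice M by (auto simp: join_pres_def)
  have fc: "f x \<in> carrier M" if "x \<in> carrier L" for x
    using f(1) that by (auto simp: bij_betw_def)
  have "f x \<sqsubseteq>\<^bsub>M\<^esub> f y \<longleftrightarrow> x \<sqsubseteq>\<^bsub>L\<^esub> y" if xy: "x \<in> carrier L" "y \<in> carrier L" for x y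
  proof
    assume "x \<sqsubseteq>\<^bsub>L\<^esub> y"
    then show "f x \<sqsubseteq>\<^bsub>M\<^esub> f y"
      using join_pres_isotone[OF _ f(2)] xy fc by (auto simp: isotone_def)
  next
    assume "f x \<sqsubseteq>\<^bsub>M\<^esub> f y"
    then have "f x \<squnion>\<^bsub>M\<^esub> f y = f y"
      using xy fc by (intro M.join_eqI) (auto simp: least_def Upper_def)
    then have "f (x \<squnion>\<^bsub>L\<^esub> y) = f y" using f(2) xy by (simp add: join_pres_def)
    then have "x \<squnion>\<^bsub>L\<^esub> y = y"
      using f(1) xy by (meson L.join_closed bij_betw_def inj_onD)
    then show "x \<sqsubseteq>\<^bsub>L\<^esub> y" using L.join_left[OF xy] by simp
  qed
  then show thesis using that f(1) L.lattice_axioms M.lattice_axioms by blast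
qed

lemma lattice_imp_partial_order: "lattice L \<Longrightarrow> partial_order L"
  by (simp add: lattice_def upper_semilattice_def)

lemma partial_order_eqI:
  fixes L :: "'a gorder"
  assumes "eq L = (=)"
    and "\<And>x. x \<in> carrier L \<Longrightarrow> x \<sqsubseteq>\<^bsub>L\<^esub> x"
    and "\<And>x y. x \<in> carrier L \<Longrightarrow> y \<in> carrier L \<Longrightarrow> x \<sqsubseteq>\<^bsub>L\<^esub> y \<Longrightarrow> y \<sqsubseteq>\<^bsub>L\<^esub> x \<Longrightarrow> x = y"
    and "\<And>x y z. x \<in> carrier L \<Longrightarrow> y \<in> carrier L \<Longrightarrow> z \<in> carrier L \<Longrightarrow>
           x \<sqsubseteq>\<^bsub>L\<^esub> y \<Longrightarrow> y \<sqsubseteq>\<^bsub>L\<^esub> z \<Longrightarrow> x \<sqsubseteq>\<^bsub>L\<^esub> z"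
  shows "partial_order L"
proof unfold_locales
  show "x \<sqsubseteq>\<^bsub>L\<^esub> z" if "x \<sqsubseteq>\<^bsub>L\<^esub> y" "y \<sqsubseteq>\<^bsub>L\<^esub> z" "x \<in> carrier L" "y \<in> carrier L" "z \<in> carrier L" for x y z
    using assms(4)[of x y z] that by blast
qed (simp_all add: assms(1-3))

lemma partial_order_prod_gorder:
  assumes "partial_order L" "partial_order M"
  shows "partial_order (prod_gorder L M)"
proof -
  interpret L: partial_order L by fact
  interpret M: partial_order M by fact
  show ?thesis
    by (rule partial_order_eqI)
      (auto simp: prod_gorder_def intro: L.le_antisym M.le_antisym L.le_trans M.le_trans)
qed

lemma partial_order_copy:
  fixes L :: "'a gorder" and g :: "'a \<Rightarrow> 'b"
  assumes "partial_order L" "inj_on g (carrier L)"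
  obtains L' :: "'b gorder" where "partial_order L'" "carrier L' = g ` carrier L"
    "\<And>x y. x \<in> carrier L \<Longrightarrow> y \<in> carrier L \<Longrightarrow> g x \<sqsubseteq>\<^bsub>L'\<^esub> g y \<longleftrightarrow> x \<sqsubseteq>\<^bsub>L\<^esub> y"
proof -
  interpret L: partial_order L by fact
  define h where "h = the_inv_into (carrier L) g"
  have h: "h (g x) = x" if "x \<in> carrier L" for x
    using that assms(2) by (simp add: h_def the_inv_into_f_f)
  define L' where "L' = \<lparr>carrier = g ` carrier L, eq = ((=) :: 'b \<Rightarrow> 'b \<Rightarrow> bool), le = (\<lambda>x y. h x \<sqsubseteq>\<^bsub>L\<^esub> h y)\<rparr>"
  have "partial_order L'"
    by (rule partial_order_eqI) (auto simp: L'_def h intro: L.le_trans dest: L.le_antisym)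
  then show thesis by (rule that) (auto simp: L'_def h)
qed

lemma has_nontrivial_chain_factorI:
  fixes L :: "'a gorder" and C :: "'b gorder" and M :: "'c gorder"
  assumes C: "total_order C" "\<exists>x\<in>carrier C. \<exists>y\<in>carrier C. x \<noteq> y"
    and M: "lattice M" and iso: "lattice_isomorphic L (prod_gorder C M)"
    and ne: "carrier L \<noteq> {}"
  shows "has_nontrivial_chain_factor L"
proof -
  interpret C: total_order C by fact
  obtain f where f: "bij_betw f (carrier L) (carrier (prod_gorder C M))"
    and L: "lattice L" and CM: "lattice (prod_gorder C M)"
    and le: "\<And>x y. x \<in> carrier L \<Longrightarrow> y \<in> carrier L \<Longrightarrow>
      f x \<sqsubseteq>\<^bsub>prod_gorder C M\<^esub> f y \<longleftrightarrow> x \<sqsubseteq>\<^bsub>L\<^esub> y"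
    using lattice_isomorphic_order_iso[OF iso] by metis
  define k where "k = the_inv_into (carrier L) f"
  have k: "inj_on k (carrier C \<times> carrier M)"
    using bij_betw_the_inv_into[OF f] by (simp add: k_def bij_betw_def prod_gorder_def)
  obtain c m where cm: "c \<in> carrier C" "m \<in> carrier M"
    using ne f by (fastforce simp: bij_betw_def prod_gorder_def)
  define g where "g = (\<lambda>x. k (x, m))"
  define h where "h = (\<lambda>y. k (c, y))"
  have g: "inj_on g (carrier C)" and h: "inj_on h (carrier M)"
    using k cm by (auto simp: inj_on_def g_def h_def)
  obtain C' :: "'a gorder" where C': "partial_order C'" "carrier C' = g ` carrier C"
    "\<And>x y. x \<in> carrier C \<Longrightarrow> y \<in> carrier C \<Longrightarrow> g x \<sqsubseteq>\<^bsub>C'\<^esub> g y \<longleftrightarrow> x \<sqsubseteq>\<^bsub>C\<^esub> y"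
    using partial_order_copy[OF C.partial_order_axioms g] by metis
  obtain M' :: "'a gorder" where M': "partial_order M'" "carrier M' = h ` carrier M"
    "\<And>x y. x \<in> carrier M \<Longrightarrow> y \<in> carrier M \<Longrightarrow> h x \<sqsubseteq>\<^bsub>M'\<^esub> h y \<longleftrightarrow> x \<sqsubseteq>\<^bsub>M\<^esub> y"
    using partial_order_copy[OF lattice_imp_partial_order[OF M] h] by metis
  have "total_order C'"
  proof (rule partial_order.total_orderI[OF C'(1)])
    fix x y assume "x \<in> carrier C'" "y \<in> carrier C'"
    then obtain a b where "a \<in> carrier C" "b \<in> carrier C" "x = g a" "y = g b"
      by (auto simp: C'(2))
    then show "x \<sqsubseteq>\<^bsub>C'\<^esub> y \<or> y \<sqsubseteq>\<^bsub>C'\<^esub> x"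
      using C.total_order_total[of a b] C'(3)[of a b] C'(3)[of b a] by blast
  qed
  moreover have "\<exists>x\<in>carrier C'. \<exists>y\<in>carrier C'. x \<noteq> y"
    using C(2) g unfolding C'(2) by (metis imageI inj_onD)
  moreover have "lattice M'"
    by (rule order_iso_imp_lattice(1)[OF M M'(1), of h]) (use h M'(2,3) in \<open>simp_all add: bij_betw_def\<close>)
  moreover have "lattice_isomorphic L (prod_gorder C' M')"
  proof (rule order_iso_imp_lattice(2)[OF L, of _ "map_prod g h \<circ> f"])
    show "partial_order (prod_gorder C' M')"
      by (rule partial_order_prod_gorder) fact+
    have "bij_betw (map_prod g h) (carrier C \<times> carrier M) (carrier C' \<times> carrier M')"
      using g h by (auto simp: bij_betw_def inj_on_def C'(2) M'(2) image_iff)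
    then show "bij_betw (map_prod g h \<circ> f) (carrier L) (carrier (prod_gorder C' M'))"
      using f by (auto simp: prod_gorder_def intro: bij_betw_trans)
    fix x y assume xy: "x \<in> carrier L" "y \<in> carrier L"
    then have "f x \<in> carrier C \<times> carrier M" "f y \<in> carrier C \<times> carrier M"
      using f by (auto simp: bij_betw_def prod_gorder_def)
    then show "(map_prod g h \<circ> f) x \<sqsubseteq>\<^bsub>prod_gorder C' M'\<^esub> (map_prod g h \<circ> f) y \<longleftrightarrow> x \<sqsubseteq>\<^bsub>L\<^esub> y"
      unfolding le[OF xy, symmetric] by (auto simp: prod_gorder_def C'(3) M'(3))
  qed
  ultimately show ?thesis
    unfolding has_nontrivial_chain_factor_def by blast
qed


section \<open>Isomorphism of profinite groups; joins and meets of closed and of open subgroups\<close>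

lemma equiv_profinite_iso:
  "equiv (Collect profinite_group) (profinite_iso :: ('a topgroup \<times> 'a topgroup) set)"
  (is "equiv ?A ?r")
proof (rule equivI)
  show "?r \<subseteq> ?A \<times> ?A"
    by (auto simp: profinite_iso_def)
  show "refl_on ?A ?r"
    by (auto simp: profinite_iso_def refl_on_def intro!: bexI[of _ id] id_iso)
  show "sym ?r"
  proof (rule symI)
    fix G H :: "'a topgroup" assume "(G, H) \<in> profinite_iso"
    then obtain f where f: "profinite_group G" "profinite_group H" "f \<in> iso G H"
      "homeomorphic_map (grp_topology G) (grp_topology H) f"
      by (auto simp: profinite_iso_def)
    interpret G: profinite_group G by fact
    interpret H: profinite_group H by fact
    have inv: "inv_into (carrier G) f \<in> iso H G"
      using f(3) by (rule G.iso_set_sym)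
    obtain g where g: "homeomorphic_maps (grp_topology G) (grp_topology H) f g"
      using f(4) by (auto simp: homeomorphic_map_maps)
    have "inv_into (carrier G) f y = g y" if "y \<in> carrier H" for y
    proof -
      have "g y \<in> carrier G" "f (g y) = y"
        using g that G.topspace_eq H.topspace_eq
        by (auto simp: homeomorphic_maps_def continuous_map_def Pi_iff)
      then show ?thesis
        using f(3) by (metis inv_into_f_f iso_iff)
    qed
    then have "homeomorphic_map (grp_topology H) (grp_topology G) (inv_into (carrier G) f)"
      using g homeomorphic_maps_sym homeomorphic_maps_imp_map homeomorphic_map_eq H.topspace_eq
      by metis
    then show "(H, G) \<in> profinite_iso"
      using f inv by (auto simp: profinite_iso_def)
  qed
  show "trans ?r"
  proof (rule transI)
    fix G H K :: "'a topgroup"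
    assume "(G, H) \<in> profinite_iso" "(H, K) \<in> profinite_iso"
    then show "(G, K) \<in> profinite_iso"
      unfolding profinite_iso_def
      using iso_set_trans homeomorphic_map_compose by fast
  qed
qed

context profinite_group
begin

lemma closure_of_subgroup:
  assumes "subgroup H G"
  shows "subgroup (grp_topology G closure_of H) G"
proof (rule subgroupI)
  let ?T = "grp_topology G"
  have sub: "H \<subseteq> topspace ?T" using subgroup.subset[OF assms] topspace_eq by simp
  show cl: "?T closure_of H \<subseteq> carrier G" using closure_of_subset_topspace topspace_eq by metis
  show "?T closure_of H \<noteq> {}"
    using closure_of_subset[OF sub] subgroup.one_closed[OF assms] by blast
  show "inv a \<in> ?T closure_of H" if "a \<in> ?T closure_of H" for a
  proof -
    have "(\<lambda>x. inv x) ` (?T closure_of H) \<subseteq> ?T closure_of ((\<lambda>x. inv x) ` H)"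
      by (rule continuous_map_image_closure_subset[OF continuous_inv])
    also have "\<dots> \<subseteq> ?T closure_of H"
      by (rule closure_of_mono) (use subgroup.m_inv_closed[OF assms] in blast)
    finally show ?thesis using that by blast
  qed
  show "a \<otimes> b \<in> ?T closure_of H" if "a \<in> ?T closure_of H" "b \<in> ?T closure_of H" for a b
  proof -
    have "(\<lambda>(x, y). x \<otimes> y) ` (prod_topology ?T ?T closure_of (H \<times> H))
        \<subseteq> ?T closure_of ((\<lambda>(x, y). x \<otimes> y) ` (H \<times> H))"
      by (rule continuous_map_image_closure_subset[OF continuous_mult])
    also have "\<dots> \<subseteq> ?T closure_of H"
      by (rule closure_of_mono) (use subgroup.m_closed[OF assms] in auto)
    finally show ?thesis using that by (force simp: closure_of_Times)
  qed
qed

lemma openin_subgroup_superset: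
  assumes "subgroup U G" "subgroup H G" "openin (grp_topology G) H" "H \<subseteq> U"
  shows "openin (grp_topology G) U"
proof (subst openin_subopen, intro ballI)
  fix u assume u: "u \<in> U"
  let ?T = "grp_topology G"
  have uc: "u \<in> carrier G" using subgroup.subset[OF assms(1)] u by blast
  have "continuous_map ?T (prod_topology ?T ?T) (\<lambda>x. (inv u, x))"
    using uc topspace_eq by (auto simp: continuous_map_pairwise o_def)
  from continuous_map_compose[OF this continuous_mult]
  have "continuous_map ?T ?T (\<lambda>x. inv u \<otimes> x)" by (simp add: o_def)
  then have "openin ?T {x \<in> topspace ?T. inv u \<otimes> x \<in> H}"
    using assms(3) by (simp add: openin_continuous_map_preimage)
  moreover have "u \<in> {x \<in> topspace ?T. inv u \<otimes> x \<in> H}"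
    using uc topspace_eq subgroup.one_closed[OF assms(2)] by simp
  moreover have "{x \<in> topspace ?T. inv u \<otimes> x \<in> H} \<subseteq> U"
  proof
    fix x assume x: "x \<in> {x \<in> topspace ?T. inv u \<otimes> x \<in> H}"
    then have xc: "x \<in> carrier G" and "inv u \<otimes> x \<in> U"
      using assms(4) topspace_eq by auto
    then have "u \<otimes> (inv u \<otimes> x) \<in> U"
      using subgroup.m_closed[OF assms(1) u] by simp
    then show "x \<in> U" using xc uc by (simp add: m_assoc[symmetric])
  qed
  ultimately show "\<exists>T. openin ?T T \<and> u \<in> T \<and> T \<subseteq> U" by blast
qed

lemma closed_subgroup_lattice:
  shows "lattice (closed_subgroup_lattice G)"
    and "\<lbrakk>A \<in> carrier (closed_subgroup_lattice G); B \<in> carrier (closed_subgroup_lattice G)\<rbrakk> \<Longrightarrow>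
      A \<squnion>\<^bsub>closed_subgroup_lattice G\<^esub> B = grp_topology G closure_of generate G (A \<union> B)"
    and "\<lbrakk>A \<in> carrier (closed_subgroup_lattice G); B \<in> carrier (closed_subgroup_lattice G)\<rbrakk> \<Longrightarrow>
      A \<sqinter>\<^bsub>closed_subgroup_lattice G\<^esub> B = A \<inter> B"
proof -
  let ?L = "closed_subgroup_lattice G" and ?T = "grp_topology G"
  interpret L: partial_order ?L
    by (rule partial_order_eqI) (auto simp: closed_subgroup_lattice_def)
  have J: "least ?L (?T closure_of generate G (A \<union> B)) (Upper ?L {A, B})"
    if "A \<in> carrier ?L" "B \<in> carrier ?L" for A B
  proof -
    have XY: "A \<union> B \<subseteq> carrier G"
      using that by (auto simp: closed_subgroup_lattice_def dest: subgroup.subset)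
    have sg: "subgroup (generate G (A \<union> B)) G" using XY by (rule generate_is_subgroup)
    have "A \<union> B \<subseteq> generate G (A \<union> B)" by (auto intro: generate.incl)
    also have "\<dots> \<subseteq> ?T closure_of generate G (A \<union> B)"
      using subgroup.subset[OF sg] topspace_eq by (intro closure_of_subset) simp
    finally have "A \<union> B \<subseteq> ?T closure_of generate G (A \<union> B)" .
    moreover have "?T closure_of generate G (A \<union> B) \<subseteq> Z"
      if "subgroup Z G" "closedin ?T Z" "A \<subseteq> Z" "B \<subseteq> Z" for Z
      using that generate_subgroup_incl[of "A \<union> B" Z] by (intro closure_of_minimal) auto
    ultimately show ?thesis
      using that closure_of_subgroup[OF sg]
      by (auto simp: least_def Upper_def closed_subgroup_lattice_def)
  qed
  have K: "greatest ?L (A \<inter> B) (Lower ?L {A, B})"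
    if "A \<in> carrier ?L" "B \<in> carrier ?L" for A B
    using that subgroups_Inter_pair
    by (auto simp: greatest_def Lower_def closed_subgroup_lattice_def)
  show "lattice ?L"
    by unfold_locales (blast intro: J K)+
  show "A \<squnion>\<^bsub>?L\<^esub> B = ?T closure_of generate G (A \<union> B)" "A \<sqinter>\<^bsub>?L\<^esub> B = A \<inter> B"
    if "A \<in> carrier ?L" "B \<in> carrier ?L"
    using L.join_eqI[OF J] L.meet_eqI[OF K] that by auto
qed

lemma open_subgroup_lattice:
  shows "lattice (open_subgroup_lattice G)"
    and "\<lbrakk>A \<in> carrier (open_subgroup_lattice G); B \<in> carrier (open_subgroup_lattice G)\<rbrakk> \<Longrightarrow>
      A \<squnion>\<^bsub>open_subgroup_lattice G\<^esub> B = generate G (A \<union> B)"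
    and "\<lbrakk>A \<in> carrier (open_subgroup_lattice G); B \<in> carrier (open_subgroup_lattice G)\<rbrakk> \<Longrightarrow>
      A \<sqinter>\<^bsub>open_subgroup_lattice G\<^esub> B = A \<inter> B"
proof -
  let ?L = "open_subgroup_lattice G" and ?T = "grp_topology G"
  interpret L: partial_order ?L
    by (rule partial_order_eqI) (auto simp: open_subgroup_lattice_def)
  have J: "least ?L (generate G (A \<union> B)) (Upper ?L {A, B})"
    if XY: "A \<in> carrier ?L" "B \<in> carrier ?L" for A B
  proof -
    have "A \<union> B \<subseteq> carrier G"
      using that by (auto simp: open_subgroup_lattice_def dest: subgroup.subset)
    then have sg: "subgroup (generate G (A \<union> B)) G" by (rule generate_is_subgroup)
    have sub: "A \<subseteq> generate G (A \<union> B)" "B \<subseteq> generate G (A \<union> B)"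
      by (auto intro: generate.incl)
    have "openin ?T (generate G (A \<union> B))"
      using XY(1) sub(1) openin_subgroup_superset[OF sg, of A]
      by (simp add: open_subgroup_lattice_def)
    moreover have "generate G (A \<union> B) \<subseteq> Z"
      if "subgroup Z G" "A \<subseteq> Z" "B \<subseteq> Z" for Z
      using that generate_subgroup_incl[of "A \<union> B" Z] by auto
    ultimately show ?thesis
      using sg sub XY by (auto simp: least_def Upper_def open_subgroup_lattice_def)
  qed
  have K: "greatest ?L (A \<inter> B) (Lower ?L {A, B})"
    if "A \<in> carrier ?L" "B \<in> carrier ?L" for A B
    using that subgroups_Inter_pair
    by (auto simp: greatest_def Lower_def open_subgroup_lattice_def)
  show "lattice ?L"
    by unfold_locales (blast intro: J K)+
  show "A \<squnion>\<^bsub>?L\<^esub> B = generate G (A \<union> B)" "A \<sqinter>\<^bsub>?L\<^esub> B = A \<inter> B"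
    if "A \<in> carrier ?L" "B \<in> carrier ?L"
    using L.join_eqI[OF J] L.meet_eqI[OF K] that by auto
qed

end

end

theory Submission
  imports Defs "HOL-Number_Theory.Cong"
begin

hide_const (open) Divisibility.prime Polynomial.order

text \<open>Only the bound \<open>w\<close> on antichains of closed subgroups matters for countability.  The maximal
  procyclic subgroups form an antichain, so at most \<open>w\<close> of them cover \<open>G\<close>; if \<open>G\<close> is infinite, one
  of them is open, and the same bound applied inside it produces an open copy \<open>A\<close> of the \<open>p\<close>-adic
  integers, which can be taken normal and is then central.  The transfer \<open>G \<rightarrow> A\<close> has a finite
  kernel \<open>S\<close> and splits, so \<open>G\<close> is a semidirect product of \<open>S\<close> with a copy of the \<open>p\<close>-adic
  integers, and \<open>p\<close>, the multiplication table of \<open>S\<close> and the action of a generator determine \<open>G\<close>.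

  For a prime \<open>q > w\<close> the \<open>q\<close>-elements of a finite quotient normalize every subgroup, generate a
  cyclic group and are central, and the transfer splits them off.  Hence if \<open>q > w\<close> divides the
  order of \<open>G\<close>, the pro-\<open>q\<close> part is a coprime direct factor and gives a chain factor of the
  lattice.  Without chain factors all primes involved are at most \<open>w\<close>, the exponents are bounded by
  antichains, and only finitely many data remain.\<close>


section \<open>Open normal and procyclic subgroups\<close>

text \<open>The p-adic integers are never constructed and no model group is built from a code. A
  copy of them is characterised by the exponents occurring in it, and two groups with the same code
  are compared directly: on both sides the products of \<open>S\<close> with the integer powers of
  the generator are dense, matching them respects two filtrations, and compactness extends the match
  to the groups.

  Everything is tested in finite quotients. Solutions found there are lifted by the finite
  intersection property, and closed subgroups are separated by open normal ones; this also reduces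
  the open lattice to a width bound for closed subgroups.

  Besides families of maximal members, the main antichains are of two kinds: distinct sets of equal
  finite size (conjugates of a finite subgroup, cyclic subgroups of one order), and families whose
  exponents trade off, such as p^(w-i) q^i.

  Width alone cannot bound exponents in finite groups, since the subgroups of a cyclic q-group form
  a chain. There the bound is the cardinality of the given lattice.\<close>

definition open_normal :: "'a topgroup \<Rightarrow> 'a set \<Rightarrow> bool" where
  "open_normal G N \<longleftrightarrow> N \<lhd> G \<and> openin (grp_topology G) N"

definition closed_subgroup :: "'a topgroup \<Rightarrow> 'a set \<Rightarrow> bool" where
  "closed_subgroup G H \<longleftrightarrow> subgroup H G \<and> closedin (grp_topology G) H"

definition procyclic :: "'a topgroup \<Rightarrow> 'a \<Rightarrow> 'a set" where
  "procyclic G x = grp_topology G closure_of generate G {x}"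

context group
begin

lemma inv_mult_cancel [simp]:
  "\<lbrakk>x \<in> carrier G; y \<in> carrier G\<rbrakk> \<Longrightarrow> inv x \<otimes> (x \<otimes> y) = y"
  "\<lbrakk>x \<in> carrier G; y \<in> carrier G\<rbrakk> \<Longrightarrow> x \<otimes> (inv x \<otimes> y) = y"
  by (simp_all add: m_assoc[symmetric])

lemma normal_conj:
  "\<lbrakk>N \<lhd> G; x \<in> carrier G; h \<in> N\<rbrakk> \<Longrightarrow> x \<otimes> h \<otimes> inv x \<in> N"
  using normal_inv_iff by blast

lemma rcos_eq_iff:
  assumes "subgroup N G" "x \<in> carrier G" "y \<in> carrier G"
  shows "N #> x = N #> y \<longleftrightarrow> x \<otimes> inv y \<in> N"
proof
  assume eq: "N #> x = N #> y"
  then have "x \<in> N #> y" using rcos_self[OF assms(2,1)] by simp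
  then obtain h where "h \<in> N" "x = h \<otimes> y" by (auto simp: r_coset_def)
  then show "x \<otimes> inv y \<in> N"
    using assms subgroup.mem_carrier[OF assms(1)] by (simp add: m_assoc)
next
  assume h: "x \<otimes> inv y \<in> N"
  have "x = (x \<otimes> inv y) \<otimes> y" using assms by (simp add: m_assoc)
  then have "x \<in> N #> y" using h unfolding r_coset_def by blast
  then show "N #> x = N #> y" using repr_independence[OF _ assms(3,1)] by simp
qed

end

section \<open>Neighbourhoods of the identity\<close>

context profinite_group
begin

abbreviation T where "T \<equiv> grp_topology G"

lemma topspace_T [simp]: "topspace T = carrier G" by (rule topspace_eq)

lemma continuous_mult2:
  assumes "continuous_map Y T f" "continuous_map Y T g"
  shows "continuous_map Y T (\<lambda>x. f x \<otimes> g x)"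
proof -
  have "continuous_map Y (prod_topology T T) (\<lambda>x. (f x, g x))"
    using assms by (simp add: continuous_map_pairwise o_def)
  from continuous_map_compose[OF this continuous_mult] show ?thesis by (simp add: o_def)
qed

lemma continuous_inv2:
  assumes "continuous_map Y T f"
  shows "continuous_map Y T (\<lambda>x. inv (f x))"
  using continuous_map_compose[OF assms continuous_inv] by (simp add: o_def)

lemma continuous_pow2:
  assumes "continuous_map Y T f"
  shows "continuous_map Y T (\<lambda>x. f x [^] (n::nat))"
  by (induction n) (auto intro: continuous_mult2 assms)

text \<open>Projection along a compact factor is closed, so the elements \<open>g\<close> missed by
  the image of the complement of \<open>W\<close> form an open set (the tube lemma). This makes
  conditions that quantify over all of \<open>G\<close> open.\<close>

lemma openin_tube:
  assumes "openin (prod_topology T T) W"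
  shows "openin T {g \<in> carrier G. \<forall>k\<in>carrier G. (k, g) \<in> W}"
proof -
  have "closed_map (prod_topology T T) T snd"
    using compact by (rule closed_map_snd)
  moreover have "closedin (prod_topology T T) (topspace (prod_topology T T) - W)"
    using assms by blast
  ultimately have "closedin T (snd ` (topspace (prod_topology T T) - W))"
    by (simp add: closed_map_def)
  then have "openin T (topspace T - snd ` (topspace (prod_topology T T) - W))" by blast
  also have "topspace T - snd ` (topspace (prod_topology T T) - W)
    = {g \<in> carrier G. \<forall>k\<in>carrier G. (k, g) \<in> W}"
    by (auto simp: image_iff) force
  finally show ?thesis .
qed

text \<open>Components are points, so no connected set meets both \<open>\<one>\<close> and the
  complement of \<open>U\<close>; in a compact Hausdorff space this suffices to separate the two
  closed sets by a clopen one.\<close>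

lemma clopen_nbhd_one:
  assumes "openin T U" "\<one> \<in> U"
  obtains K where "openin T K" "closedin T K" "\<one> \<in> K" "K \<subseteq> U"
proof -
  have "separated_between T {\<one>} (topspace T - U)"
  proof (rule cut_wire_fence_theorem_gen)
    show "compactin T {\<one>}" by simp
    show "closedin T (topspace T - U)" using assms by blast
    show "compact_space T" by (rule compact)
    show "disjnt C {\<one>} \<or> disjnt C (topspace T - U)" if "connectedin T C" for C
    proof (cases "\<one> \<in> C")
      case True
      then have "C \<subseteq> connected_component_of_set T \<one>"
        using that by (intro connected_component_of_maximal) auto
      then have "C \<subseteq> {\<one>}" using totally_disconnected[of "\<one>"] by simp
      then show ?thesis using assms by (auto simp: disjnt_def)
    qed (auto simp: disjnt_def)
  qed (use Hausdorff in blast)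
  then obtain K V where "openin T K" "openin T V" "K \<union> V = topspace T" "disjnt K V"
     "\<one> \<in> K" "topspace T - U \<subseteq> V"
    by (auto simp: separated_between_def)
  moreover from this have "K = topspace T - V" by (auto simp: disjnt_def)
  moreover have "K \<subseteq> U" using calculation by (auto simp: disjnt_def)
  ultimately show thesis using that by (metis closedin_diff closedin_topspace)
qed

text \<open>The elements that map a clopen \<open>K\<close> into itself by right multiplication form
  a monoid \<open>S\<close>, open by the tube lemma. Its symmetric part \<open>H\<close> is a group,
  and \<open>\<one> \<in> K\<close> gives \<open>H \<subseteq> K\<close>.\<close>

lemma open_subgroup_nbhd_one:
  assumes "openin T U" "\<one> \<in> U"
  obtains H where "subgroup H G" "openin T H" "H \<subseteq> U"
proof -
  obtain K where K: "openin T K" "closedin T K" "\<one> \<in> K" "K \<subseteq> U"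
    using clopen_nbhd_one[OF assms] .
  have Kc: "K \<subseteq> carrier G" using K(1) openin_subset by force
  define S where "S = {g \<in> carrier G. \<forall>k\<in>K. k \<otimes> g \<in> K}"
  \<comment> \<open>The summand \<open>(topspace T - K) \<times> topspace T\<close> turns the
    condition on \<open>k \<in> K\<close> into one on all \<open>k\<close>; it is open because
    \<open>K\<close> is closed.\<close>
  define W where "W = ((topspace T - K) \<times> topspace T) \<union> {p \<in> topspace (prod_topology T T). (\<lambda>(x, y). x \<otimes> y) p \<in> K}"
  have "openin (prod_topology T T) W"
    unfolding W_def
    using K(1,2) by (intro openin_Un openin_continuous_map_preimage[OF continuous_mult])
        (auto simp: openin_prod_Times_iff simp del: topspace_T)
  from openin_tube[OF this] have "openin T {g \<in> carrier G. \<forall>k\<in>carrier G. (k, g) \<in> W}" .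
  also have "{g \<in> carrier G. \<forall>k\<in>carrier G. (k, g) \<in> W} = S"
    using Kc by (auto simp: S_def W_def)
  finally have S: "openin T S" .
  define H where "H = S \<inter> {g \<in> topspace T. inv g \<in> S}"
  have "openin T H"
    unfolding H_def using S by (intro openin_Int openin_continuous_map_preimage[OF continuous_inv])
  moreover have "subgroup H G"
  proof (rule subgroupI)
    show "H \<subseteq> carrier G" by (auto simp: H_def)
    have "\<one> \<in> H" using Kc by (auto simp: H_def S_def)
    then show "H \<noteq> {}" by auto
    show "inv a \<in> H" if "a \<in> H" for a using that by (auto simp: H_def S_def)
    show "a \<otimes> b \<in> H" if "a \<in> H" "b \<in> H" for a b
    proof -
      have ab: "a \<in> carrier G" "b \<in> carrier G" using that by (auto simp: H_def)
      have "k \<otimes> (a \<otimes> b) \<in> K" if "k \<in> K" for k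
      proof -
        have "k \<otimes> a \<in> K" using that \<open>a \<in> H\<close> by (auto simp: H_def S_def)
        then have "k \<otimes> a \<otimes> b \<in> K" using \<open>b \<in> H\<close> by (auto simp: H_def S_def)
        then show ?thesis using ab Kc that by (auto simp: m_assoc)
      qed
      moreover have "k \<otimes> inv (a \<otimes> b) \<in> K" if "k \<in> K" for k
      proof -
        have "k \<otimes> inv b \<in> K" using that \<open>b \<in> H\<close> by (auto simp: H_def S_def)
        then have "k \<otimes> inv b \<otimes> inv a \<in> K" using \<open>a \<in> H\<close> by (auto simp: H_def S_def)
        moreover have "k \<in> carrier G" using that Kc by auto
        ultimately show ?thesis using ab by (simp add: m_assoc inv_mult_group)
      qed
      ultimately show ?thesis using ab by (simp add: H_def S_def)
    qed
  qed
  moreover have "H \<subseteq> U"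
    using K(3,4) Kc by (auto simp: H_def S_def)
  ultimately show thesis using that by blast
qed

text \<open>\<open>N\<close> is the intersection of all conjugates of an open subgroup. Conjugation
  is continuous in both variables, so the tube lemma shows that \<open>N\<close> is open without
  counting conjugates.\<close>

lemma open_normal_nbhd_one:
  assumes "openin T U" "\<one> \<in> U"
  obtains N where "open_normal G N" "N \<subseteq> U"
proof -
  obtain H where H: "subgroup H G" "openin T H" "H \<subseteq> U"
    using open_subgroup_nbhd_one[OF assms] .
  interpret H: subgroup H G by fact
  define N where "N = {g \<in> carrier G. \<forall>k\<in>carrier G. k \<otimes> g \<otimes> inv k \<in> H}"
  have f: "continuous_map (prod_topology T T) T fst" "continuous_map (prod_topology T T) T snd"
    by (simp_all add: continuous_map_fst continuous_map_snd)
  have "openin (prod_topology T T)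
     {p \<in> topspace (prod_topology T T). fst p \<otimes> snd p \<otimes> inv (fst p) \<in> H}"
    using H(2) by (intro openin_continuous_map_preimage[where Y = T] continuous_mult2 continuous_inv2 f)
  from openin_tube[OF this] have "openin T N" by (simp add: N_def conj_commute cong: conj_cong)
  moreover have "N \<lhd> G"
    unfolding normal_inv_iff
  proof (intro conjI ballI subgroupI)
    show "N \<subseteq> carrier G" by (auto simp: N_def)
    show "N \<noteq> {}" by (auto simp: N_def intro!: exI[of _ "\<one>"])
    show "inv a \<in> N" if "a \<in> N" for a
    proof -
      have "k \<otimes> inv a \<otimes> inv k \<in> H" if "k \<in> carrier G" for k
      proof -
        have "k \<otimes> a \<otimes> inv k \<in> H" and a: "a \<in> carrier G" using that \<open>a \<in> N\<close> by (auto simp: N_def)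
        then have "inv (k \<otimes> a \<otimes> inv k) \<in> H" by simp
        then show ?thesis using a that by (simp add: inv_mult_group m_assoc)
      qed
      then show ?thesis using that by (simp add: N_def)
    qed
    show "a \<otimes> b \<in> N" if "a \<in> N" "b \<in> N" for a b
    proof -
      have ab: "a \<in> carrier G" "b \<in> carrier G" using that by (auto simp: N_def)
      have "k \<otimes> (a \<otimes> b) \<otimes> inv k \<in> H" if k: "k \<in> carrier G" for k
      proof -
        have "k \<otimes> a \<otimes> inv k \<in> H" "k \<otimes> b \<otimes> inv k \<in> H"
          using that \<open>a \<in> N\<close> \<open>b \<in> N\<close> by (auto simp: N_def)
        then have "(k \<otimes> a \<otimes> inv k) \<otimes> (k \<otimes> b \<otimes> inv k) \<in> H" by simp
        then show ?thesis using ab k by (simp add: m_assoc)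
      qed
      then show ?thesis using ab by (simp add: N_def)
    qed
    show "x \<otimes> h \<otimes> inv x \<in> N" if "x \<in> carrier G" "h \<in> N" for x h
    proof -
      have h: "h \<in> carrier G" using that by (auto simp: N_def)
      have "k \<otimes> (x \<otimes> h \<otimes> inv x) \<otimes> inv k \<in> H" if k: "k \<in> carrier G" for k
      proof -
        have "(k \<otimes> x) \<otimes> h \<otimes> inv (k \<otimes> x) \<in> H"
          using that \<open>h \<in> N\<close> \<open>x \<in> carrier G\<close> by (auto simp: N_def)
        then show ?thesis using h k that \<open>x \<in> carrier G\<close> by (simp add: m_assoc inv_mult_group)
      qed
      then show ?thesis using that h by (simp add: N_def)
    qed
  qed
  moreover have "N \<subseteq> U"
    using H(3) by (auto simp: N_def dest!: bspec[of _ _ "\<one>"])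
  ultimately show thesis using that unfolding open_normal_def by blast
qed

lemma open_normal_subgroup: "open_normal G N \<Longrightarrow> subgroup N G"
  by (simp add: open_normal_def normal_imp_subgroup)

lemma open_normal_Int:
  "\<lbrakk>open_normal G N; open_normal G M\<rbrakk> \<Longrightarrow> open_normal G (N \<inter> M)"
  by (simp add: open_normal_def normal_subgroup_intersect openin_Int)

lemma open_normal_carrier: "open_normal G (carrier G)"
  using normal_self openin_topspace[of T] by (simp add: open_normal_def)

lemma open_normal_finite_Inter:
  assumes "finite I" "\<And>N. N \<in> I \<Longrightarrow> open_normal G N"
  shows "\<exists>M. open_normal G M \<and> (\<forall>N\<in>I. M \<subseteq> N)"
  using assms
proof (induction I)
  case empty
  then show ?case using open_normal_carrier by blast
next
  case (insert N I)
  then obtain M where "open_normal G M" "\<forall>N\<in>I. M \<subseteq> N" by auto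
  then show ?case using insert.prems open_normal_Int[of M N]
    by (intro exI[of _ "M \<inter> N"]) auto
qed

section \<open>Cosets, separation by open normal subgroups, compactness\<close>

lemma openin_lcoset:
  assumes "openin T U" "a \<in> carrier G"
  shows "openin T {x \<in> carrier G. inv a \<otimes> x \<in> U}"
proof -
  have "continuous_map T T (\<lambda>x. inv a \<otimes> x)"
    using assms by (intro continuous_mult2) auto
  from openin_continuous_map_preimage[OF this assms(1)] show ?thesis by simp
qed

lemma closedin_lcoset:
  assumes "closedin T U" "a \<in> carrier G"
  shows "closedin T {x \<in> carrier G. inv a \<otimes> x \<in> U}"
proof -
  have "continuous_map T T (\<lambda>x. inv a \<otimes> x)"
    using assms by (intro continuous_mult2) auto
  from closedin_continuous_map_preimage[OF this assms(1)] show ?thesis by simp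
qed

text \<open>The complement of \<open>K\<close>, translated by \<open>inv g\<close>, is a
  neighbourhood of the identity. Hence \<open>g\<close> is distinguished from all of
  \<open>K\<close> already in one finite quotient.\<close>

lemma open_normal_separation:
  assumes "closedin T K" "g \<in> carrier G" "g \<notin> K"
  obtains N where "open_normal G N" "\<And>h. h \<in> K \<Longrightarrow> inv g \<otimes> h \<notin> N"
proof -
  have "openin T (topspace T - K)" using assms by blast
  from openin_lcoset[OF this, of "inv g"]
  have "openin T {x \<in> carrier G. g \<otimes> x \<in> topspace T - K}" (is "openin T ?U")
    using assms by simp
  then obtain N where "open_normal G N" "N \<subseteq> ?U"
    by (rule open_normal_nbhd_one) (use assms in auto)
  moreover have "inv g \<otimes> h \<notin> N" if "h \<in> K" for h
  proof
    assume "inv g \<otimes> h \<in> N"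
    then have "g \<otimes> (inv g \<otimes> h) \<notin> K" using calculation by blast
    moreover have "h \<in> carrier G" using that assms(1) closedin_subset by force
    ultimately show False using that assms(2) by simp
  qed
  ultimately show thesis using that by blast
qed

text \<open>\<open>{\<one>}\<close> is closed. In this form equations in \<open>G\<close> are
  checked modulo open normal subgroups.\<close>

lemma open_normal_trivial:
  assumes "g \<in> carrier G" "\<And>N. open_normal G N \<Longrightarrow> g \<in> N"
  shows "g = \<one>"
proof (rule ccontr)
  assume "g \<noteq> \<one>"
  moreover have "closedin T {\<one>}"
    using Hausdorff by (simp add: closedin_Hausdorff_singleton)
  ultimately obtain N where N: "open_normal G N" "\<And>h. h \<in> {\<one>} \<Longrightarrow> inv g \<otimes> h \<notin> N"
    using open_normal_separation[of "{\<one>}" g] assms(1) by auto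
  then have "inv g \<notin> N" using assms(1) by auto
  then show False using assms N(1) subgroup.m_inv_closed[OF open_normal_subgroup] by blast
qed

lemma closedin_open_subgroup:
  assumes "subgroup H G" "openin T H"
  shows "closedin T H"
proof -
  interpret H: subgroup H G by fact
  have "topspace T - H = (\<Union>g\<in>carrier G - H. {x \<in> carrier G. inv g \<otimes> x \<in> H})"
  proof (intro equalityI subsetI)
    fix x assume x: "x \<in> (\<Union>g\<in>carrier G - H. {x \<in> carrier G. inv g \<otimes> x \<in> H})"
    then obtain g where g: "g \<in> carrier G" "g \<notin> H" "x \<in> carrier G" "inv g \<otimes> x \<in> H" by auto
    have "x \<notin> H"
    proof
      assume "x \<in> H"
      then have "x \<otimes> inv (inv g \<otimes> x) \<in> H" using g by simp
      then show False using g by (simp add: inv_mult_group)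
    qed
    then show "x \<in> topspace T - H" using g by simp
  qed (auto intro!: bexI)
  moreover have "openin T (\<Union>g\<in>carrier G - H. {x \<in> carrier G. inv g \<otimes> x \<in> H})"
    using openin_lcoset[OF assms(2)] by (intro openin_Union) auto
  ultimately show ?thesis by (metis H.subset closedin_def topspace_T)
qed

lemma open_normal_closedin: "open_normal G N \<Longrightarrow> closedin T N"
  using closedin_open_subgroup[OF open_normal_subgroup] by (simp add: open_normal_def)

lemma open_subgroup_transversal:
  assumes "subgroup H G" "openin T H"
  obtains F where "finite F" "F \<subseteq> carrier G" "\<And>x. x \<in> carrier G \<Longrightarrow> \<exists>g\<in>F. inv g \<otimes> x \<in> H"
proof -
  have "\<exists>\<F>. finite \<F> \<and> \<F> \<subseteq> (\<lambda>g. {x \<in> carrier G. inv g \<otimes> x \<in> H}) ` carrier G \<and> topspace T \<subseteq> \<Union>\<F>"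
  proof (rule compact[unfolded compact_space_alt, rule_format], intro conjI)
    show "topspace T \<subseteq> \<Union> ((\<lambda>g. {x \<in> carrier G. inv g \<otimes> x \<in> H}) ` carrier G)"
      using subgroup.one_closed[OF assms(1)] by auto
  qed (use openin_lcoset[OF assms(2)] in auto)
  then obtain \<F> where \<F>: "finite \<F>" "\<F> \<subseteq> (\<lambda>g. {x \<in> carrier G. inv g \<otimes> x \<in> H}) ` carrier G"
    "topspace T \<subseteq> \<Union>\<F>" by blast
  from finite_subset_image[OF \<F>(1,2)] \<F>(3) obtain F where F: "finite F" "F \<subseteq> carrier G"
    "topspace T \<subseteq> \<Union> ((\<lambda>g. {x \<in> carrier G. inv g \<otimes> x \<in> H}) ` F)"
    by blast
  then show thesis using that[of F] by auto
qed

text \<open>\<open>H\<close> is what remains of the open set \<open>U\<close> after removing the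
  finitely many closed cosets of \<open>H\<close> by elements of \<open>F - H\<close>. Only
  \<open>U\<close>, not all of \<open>G\<close>, has to be covered by cosets.\<close>

lemma openin_closed_finite_index:
  assumes "subgroup H G" "closedin T H" "finite F" "F \<subseteq> carrier G"
    "\<And>x. x \<in> U \<Longrightarrow> \<exists>g\<in>F. inv g \<otimes> x \<in> H" "openin T U" "H \<subseteq> U"
  shows "openin T H"
proof -
  interpret H: subgroup H G by fact
  define F' where "F' = F - H"
  have eq: "H = U - (\<Union>g\<in>F'. {x \<in> carrier G. inv g \<otimes> x \<in> H})"
  proof (intro equalityI subsetI)
    fix x assume x: "x \<in> H"
    have "inv g \<otimes> x \<notin> H" if "g \<in> F'" for g
    proof
      assume "inv g \<otimes> x \<in> H"
      moreover have "g \<in> carrier G" "g \<notin> H" using that assms(4) by (auto simp: F'_def)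
      ultimately have "x \<otimes> inv (inv g \<otimes> x) \<in> H" using x by simp
      then show False using \<open>g \<notin> H\<close> \<open>g \<in> carrier G\<close> x by (simp add: inv_mult_group)
    qed
    then show "x \<in> U - (\<Union>g\<in>F'. {x \<in> carrier G. inv g \<otimes> x \<in> H})" using x assms by auto
  next
    fix x assume x: "x \<in> U - (\<Union>g\<in>F'. {x \<in> carrier G. inv g \<otimes> x \<in> H})"
    then have xc: "x \<in> carrier G" using openin_subset[OF assms(6)] by auto
    then obtain g where g: "g \<in> F" "inv g \<otimes> x \<in> H" using assms(5) x by auto
    then have "g \<in> H" using x xc by (auto simp: F'_def)
    then have "g \<otimes> (inv g \<otimes> x) \<in> H" using g by blast
    then show "x \<in> H" using \<open>g \<in> H\<close> xc by simp
  qed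
  have "closedin T (\<Union>g\<in>F'. {x \<in> carrier G. inv g \<otimes> x \<in> H})"
    using closedin_lcoset[OF assms(2)] assms(3,4) by (intro closedin_Union) (auto simp: F'_def)
  with assms(6) have "openin T (U - (\<Union>g\<in>F'. {x \<in> carrier G. inv g \<otimes> x \<in> H}))" by (rule openin_diff)
  then show ?thesis by (subst eq)
qed

lemma finite_rcosets_open:
  assumes "open_normal G N"
  shows "finite (rcosets N)"
proof -
  interpret N: subgroup N G using assms by (rule open_normal_subgroup)
  have nN: "N \<lhd> G" using assms by (simp add: open_normal_def)
  obtain F where F: "finite F" "F \<subseteq> carrier G" "\<And>x. x \<in> carrier G \<Longrightarrow> \<exists>g\<in>F. inv g \<otimes> x \<in> N"
    using open_subgroup_transversal[of N] assms N.subgroup_axioms by (auto simp: open_normal_def)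
  have "rcosets N \<subseteq> (\<lambda>g. N #> g) ` F"
  proof
    fix C assume "C \<in> rcosets N"
    then obtain x where x: "x \<in> carrier G" "C = N #> x" by (auto simp: RCOSETS_def)
    obtain g where g: "g \<in> F" "inv g \<otimes> x \<in> N" using F(3)[OF x(1)] by auto
    then have "g \<otimes> (inv g \<otimes> x) \<otimes> inv g \<in> N" using F(2) normal_conj[OF nN] by blast
    then have "x \<otimes> inv g \<in> N" using g F(2) x by auto
    then have "N #> x = N #> g" using rcos_eq_iff x g F(2) N.subgroup_axioms by blast
    then show "C \<in> (\<lambda>g. N #> g) ` F" using x g by blast
  qed
  then show ?thesis using F(1) finite_surj by blast
qed

text \<open>Finitely many of the sets all contain \<open>F M\<close> for an open normal
  \<open>M\<close> below the indices involved, so the finite intersection property holds. This is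
  the passage from solutions in every finite quotient to a solution in \<open>G\<close>.\<close>

lemma directed_Inter_nonempty:
  assumes closed: "\<And>N. open_normal G N \<Longrightarrow> closedin T (F N)"
    and ne: "\<And>N. open_normal G N \<Longrightarrow> F N \<noteq> {}"
    and mono: "\<And>N M. \<lbrakk>open_normal G N; open_normal G M; M \<subseteq> N\<rbrakk> \<Longrightarrow> F M \<subseteq> F N"
  obtains y where "y \<in> carrier G" "\<And>N. open_normal G N \<Longrightarrow> y \<in> F N"
proof -
  have "\<Inter> (F ` Collect (open_normal G)) \<noteq> {}"
  proof (rule compact[unfolded compact_space_fip, rule_format], intro conjI ballI allI impI)
    fix \<F> assume "finite \<F> \<and> \<F> \<subseteq> F ` Collect (open_normal G)"
    then have "finite \<F>" "\<F> \<subseteq> F ` Collect (open_normal G)" by auto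
    from finite_subset_image[OF this] obtain I where I: "finite I" "I \<subseteq> Collect (open_normal G)" "\<F> = F ` I"
      by blast
    then obtain M where M: "open_normal G M" "\<forall>N\<in>I. M \<subseteq> N"
      using open_normal_finite_Inter[of I] by auto
    then have "F M \<subseteq> \<Inter>\<F>" using I mono by blast
    then show "\<Inter>\<F> \<noteq> {}" using ne[OF M(1)] by auto
  qed (use closed in auto)
  then obtain y where "\<And>N. open_normal G N \<Longrightarrow> y \<in> F N" by auto
  moreover from this have "y \<in> carrier G"
    using closedin_subset[OF closed[OF open_normal_carrier]] open_normal_carrier by auto
  ultimately show thesis using that by blast
qed

section \<open>Procyclic subgroups\<close>

lemma procyclic_closed_subgroup: "x \<in> carrier G \<Longrightarrow> closed_subgroup G (procyclic G x)"
  unfolding closed_subgroup_def procyclic_def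
  by (simp add: closure_of_subgroup generate_is_subgroup)

lemma procyclic_subgroup: "x \<in> carrier G \<Longrightarrow> subgroup (procyclic G x) G"
  using procyclic_closed_subgroup closed_subgroup_def by blast

lemma procyclic_closedin: "x \<in> carrier G \<Longrightarrow> closedin T (procyclic G x)"
  using procyclic_closed_subgroup closed_subgroup_def by blast

lemma procyclic_minimal:
  assumes "closed_subgroup G H" "x \<in> H"
  shows "procyclic G x \<subseteq> H"
  unfolding procyclic_def using assms generate_subgroup_incl[of "{x}" H]
  by (intro closure_of_minimal) (auto simp: closed_subgroup_def)

lemma procyclic_self: "x \<in> carrier G \<Longrightarrow> x \<in> procyclic G x"
proof -
  assume x: "x \<in> carrier G"
  then have "generate G {x} \<subseteq> procyclic G x"
    unfolding procyclic_def by (intro closure_of_subset) (simp add: generate_incl)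
  then show ?thesis by (auto intro: generate.incl)
qed

lemma procyclic_carrier: "x \<in> carrier G \<Longrightarrow> procyclic G x \<subseteq> carrier G"
  using procyclic_subgroup subgroup.subset by blast

lemma procyclic_mono: "\<lbrakk>x \<in> carrier G; y \<in> procyclic G x\<rbrakk> \<Longrightarrow> procyclic G y \<subseteq> procyclic G x"
  using procyclic_minimal procyclic_closed_subgroup by blast

lemma procyclic_pow: "x \<in> carrier G \<Longrightarrow> x [^] (i::int) \<in> procyclic G x"
  using subgroup_int_pow_closed[OF procyclic_subgroup procyclic_self] by blast

lemma procyclic_nat_pow: "x \<in> carrier G \<Longrightarrow> x [^] (i::nat) \<in> procyclic G x"
  using procyclic_pow[of x "int i"] by (simp add: int_pow_int)

lemma procyclic_approx:
  assumes "x \<in> carrier G" "y \<in> procyclic G x" "openin T U" "\<one> \<in> U"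
  obtains i :: int where "inv y \<otimes> x [^] i \<in> U"
proof -
  have yc: "y \<in> carrier G" using assms procyclic_carrier by blast
  have "openin T {z \<in> carrier G. inv y \<otimes> z \<in> U}" using openin_lcoset[OF assms(3) yc] .
  moreover have "y \<in> {z \<in> carrier G. inv y \<otimes> z \<in> U}" using yc assms by simp
  moreover have "\<And>W. y \<in> W \<and> openin T W \<Longrightarrow> \<exists>z. z \<in> generate G {x} \<and> z \<in> W"
    using assms(2) by (simp add: procyclic_def in_closure_of)
  ultimately obtain z where "z \<in> generate G {x}" "inv y \<otimes> z \<in> U" by (metis (no_types, lifting) mem_Collect_eq)
  then show thesis using that generate_pow[OF assms(1)] by auto
qed

lemma procyclicI:
  assumes "x \<in> carrier G" "y \<in> carrier G"
    "\<And>N. open_normal G N \<Longrightarrow> \<exists>z\<in>procyclic G x. inv y \<otimes> z \<in> N"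
  shows "y \<in> procyclic G x"
proof (rule ccontr)
  assume "y \<notin> procyclic G x"
  with procyclic_closedin[OF assms(1)] assms(2)
  obtain N where "open_normal G N" "\<And>h. h \<in> procyclic G x \<Longrightarrow> inv y \<otimes> h \<notin> N"
    using open_normal_separation by blast
  then show False using assms(3) by blast
qed

text \<open>The centralizer is the preimage of the closed set \<open>{\<one>}\<close> under a
  commutator map. Closedness is what extends commutation from a generator to its procyclic
  closure.\<close>

lemma centralizer_closed_subgroup:
  assumes "g \<in> carrier G"
  shows "closed_subgroup G {x \<in> carrier G. x \<otimes> g = g \<otimes> x}"
proof -
  have "closedin T {x \<in> topspace T. (g \<otimes> x) \<otimes> inv g \<otimes> inv x \<in> {\<one>}}"
    using assms closedin_Hausdorff_singleton[OF Hausdorff, of "\<one>"]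
    by (intro closedin_continuous_map_preimage[where Y = T] continuous_mult2 continuous_inv2) auto
  also have "{x \<in> topspace T. (g \<otimes> x) \<otimes> inv g \<otimes> inv x \<in> {\<one>}} = {x \<in> carrier G. x \<otimes> g = g \<otimes> x}"
  proof -
    have "(g \<otimes> x \<otimes> inv g \<otimes> inv x = \<one>) = (x \<otimes> g = g \<otimes> x)" if "x \<in> carrier G" for x
    proof -
      have "(g \<otimes> x \<otimes> inv g \<otimes> inv x = \<one>) \<longleftrightarrow> (g \<otimes> x) \<otimes> inv (x \<otimes> g) = \<one>"
        using that assms by (simp add: inv_mult_group m_assoc)
      also have "\<dots> \<longleftrightarrow> g \<otimes> x = x \<otimes> g"
        using that assms by (metis inv_closed inv_equality inv_inv m_closed r_inv)
      finally show ?thesis by auto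
    qed
    then show ?thesis by auto
  qed
  finally have "closedin T {x \<in> carrier G. x \<otimes> g = g \<otimes> x}" .
  moreover have "subgroup {x \<in> carrier G. x \<otimes> g = g \<otimes> x} G"
  proof (rule subgroupI)
    show "inv a \<in> {x \<in> carrier G. x \<otimes> g = g \<otimes> x}" if "a \<in> {x \<in> carrier G. x \<otimes> g = g \<otimes> x}" for a
    proof -
      have a: "a \<in> carrier G" "a \<otimes> g = g \<otimes> a" using that by auto
      have "inv a \<otimes> g = inv a \<otimes> (g \<otimes> a) \<otimes> inv a" using a assms by (simp add: m_assoc)
      also have "\<dots> = g \<otimes> inv a" using a assms by (simp add: a(2)[symmetric])
      finally show ?thesis using a by simp
    qed
    show "a \<otimes> b \<in> {x \<in> carrier G. x \<otimes> g = g \<otimes> x}"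
      if "a \<in> {x \<in> carrier G. x \<otimes> g = g \<otimes> x}" "b \<in> {x \<in> carrier G. x \<otimes> g = g \<otimes> x}" for a b
    proof -
      have ab: "a \<in> carrier G" "b \<in> carrier G" "a \<otimes> g = g \<otimes> a" "b \<otimes> g = g \<otimes> b" using that by auto
      have "a \<otimes> b \<otimes> g = (a \<otimes> g) \<otimes> b" using ab(1,2) assms by (simp add: m_assoc ab(4))
      also have "\<dots> = g \<otimes> (a \<otimes> b)" using ab(1,2) assms by (simp add: m_assoc ab(3))
      finally show ?thesis using ab by simp
    qed
    have "\<one> \<in> {x \<in> carrier G. x \<otimes> g = g \<otimes> x}" using assms by simp
    then show "{x \<in> carrier G. x \<otimes> g = g \<otimes> x} \<noteq> {}" by blast
  qed simp
  ultimately show ?thesis by (simp add: closed_subgroup_def)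
qed

lemma procyclic_commute:
  assumes "x \<in> carrier G" "g \<in> carrier G" "x \<otimes> g = g \<otimes> x" "y \<in> procyclic G x"
  shows "y \<otimes> g = g \<otimes> y"
  using procyclic_minimal[OF centralizer_closed_subgroup[OF assms(2)], of x] assms by auto

end


section \<open>Prime-power elements and the central transfer\<close>

text \<open>Only finite antichains are tested, as an infinite one contains finite ones of every
  size. The notion is one of plain families of sets, so that the same bound can be moved between
  closed subgroups, open subgroups and subgroups of quotients.\<close>

definition width_at_most :: "'a set set \<Rightarrow> nat \<Rightarrow> bool" where
  "width_at_most \<C> w \<longleftrightarrow>
     (\<forall>F. finite F \<longrightarrow> F \<subseteq> \<C> \<longrightarrow> (\<forall>H\<in>F. \<forall>K\<in>F. H \<subseteq> K \<longrightarrow> H = K) \<longrightarrow> card F \<le> w)"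

definition p_elements :: "('a, 'b) monoid_scheme \<Rightarrow> nat \<Rightarrow> 'a set" where
  "p_elements G q = {y \<in> carrier G. \<exists>k::nat. y [^]\<^bsub>G\<^esub> (q ^ k) = \<one>\<^bsub>G\<^esub>}"

text \<open>For a prime \<open>q\<close>, coprimality excludes \<open>n = 0\<close>, so the exponent
  is a genuine condition.\<close>

definition p'_elements :: "('a, 'b) monoid_scheme \<Rightarrow> nat \<Rightarrow> 'a set" where
  "p'_elements G q = {z \<in> carrier G. \<exists>n::nat. coprime n q \<and> z [^]\<^bsub>G\<^esub> n = \<one>\<^bsub>G\<^esub>}"

lemma prime_power_of_unique_prime_factor:
  fixes n q :: nat
  assumes "n > 0" "prime q" "\<And>s. \<lbrakk>prime s; s dvd n\<rbrakk> \<Longrightarrow> s = q"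
  shows "\<exists>e. n = q ^ e"
proof -
  obtain m y where my: "n = q ^ m * y" "\<not> q dvd y"
    using multiplicity_decompose'[of n q] assms by (metis not_prime_unit is_unit_power_iff multiplicity_unit_left neq0_conv)
  have "y = 1"
  proof (rule ccontr)
    assume "y \<noteq> 1"
    then obtain s where "prime s" "s dvd y" using prime_factor_nat by blast
    then show False using assms(3)[of s] my by auto
  qed
  then show ?thesis using my by auto
qed

context group
begin

lemma pow_mod_order:
  assumes "y \<in> carrier G" "y [^] (m::nat) = \<one>" "[a = b] (mod m)"
  shows "y [^] a = y [^] (b::nat)"
proof -
  have *: "y [^] c = y [^] (c mod m)" for c :: nat
  proof -
    have "y [^] c = y [^] (m * (c div m) + c mod m)" by simp
    also have "\<dots> = (y [^] m) [^] (c div m) \<otimes> y [^] (c mod m)"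
      using assms(1) by (simp add: nat_pow_mult nat_pow_pow)
    finally show ?thesis using assms by simp
  qed
  show ?thesis using *[of a] *[of b] assms(3) by (simp add: cong_def)
qed

lemma pow_unit_inverse:
  assumes "y \<in> carrier G" "y [^] (m::nat) = \<one>" "coprime i m"
  obtains e :: nat where "(y [^] (i::nat)) [^] e = y"
proof -
  obtain e where "[i * e = 1] (mod m)" using cong_solve_coprime_nat[OF assms(3)] by auto
  then have "y [^] (i * e) = y [^] (1::nat)" using pow_mod_order assms(1,2) by blast
  then show thesis using that[of e] assms(1) by (simp add: nat_pow_pow)
qed

lemma pow_coprime_trivial:
  assumes "y \<in> carrier G" "y [^] (m::nat) = \<one>" "y [^] (i::nat) = \<one>" "coprime i m"
  shows "y = \<one>"
  using pow_unit_inverse[OF assms(1,2,4)] assms(1,3) by (metis nat_pow_one)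

text \<open>Write \<open>d\<close> as a power of \<open>q\<close> times a cofactor prime to
  \<open>q\<close>. Bezout gives \<open>i + j = 1\<close> with \<open>i\<close> a multiple of the
  cofactor and \<open>j\<close> a multiple of the power of \<open>q\<close>. Both parts are powers
  of \<open>g\<close> and so stay in every subgroup containing \<open>g\<close>.\<close>

lemma coprime_decomposition:
  assumes "g \<in> carrier G" "g [^] (d::nat) = \<one>" "d > 0" "prime q"
  obtains i j :: int where "i + j = 1" "g [^] i \<in> p_elements G q" "g [^] j \<in> p'_elements G q"
proof -
  obtain a d' where d: "d = q ^ a * d'" "\<not> q dvd d'"
    using multiplicity_decompose'[of d q] assms by (metis not_prime_unit neq0_conv)
  have cop: "coprime d' q" using d(2) assms(4) by (metis prime_imp_coprime_nat coprime_commute)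
  then have "coprime (int d') (int (q ^ a))" by simp
  then obtain v u where "v * int d' + u * int (q ^ a) = 1"
    using bezout_int[of "int d'" "int (q ^ a)"] by auto
  moreover have "(g [^] (v * int d')) [^] (q ^ a) = \<one>"
  proof -
    have "(g [^] (v * int d')) [^] (q ^ a) = g [^] (v * int d' * int (q ^ a))"
      using assms(1) by (metis int_pow_int int_pow_pow)
    also have "v * int d' * int (q ^ a) = int d * v" using d(1) by simp
    also have "g [^] (int d * v) = (g [^] d) [^] v"
      using assms(1) by (metis int_pow_int int_pow_pow)
    finally show ?thesis using assms(2) by simp
  qed
  moreover have "(g [^] (u * int (q ^ a))) [^] d' = \<one>"
  proof -
    have "(g [^] (u * int (q ^ a))) [^] d' = g [^] (u * int (q ^ a) * int d')"
      using assms(1) by (metis int_pow_int int_pow_pow)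
    also have "u * int (q ^ a) * int d' = int d * u" using d(1) by simp
    also have "g [^] (int d * u) = (g [^] d) [^] u"
      using assms(1) by (metis int_pow_int int_pow_pow)
    finally show ?thesis using assms(2) by simp
  qed
  ultimately show thesis
    using that[of "v * int d'" "u * int (q ^ a)"] assms(1) cop
    unfolding p_elements_def p'_elements_def by blast
qed

text \<open>Sylow's theorem with exponent \<open>1\<close> gives a subgroup of order
  \<open>s\<close>; any of its nontrivial elements will do.\<close>

lemma cauchy:
  assumes "finite (carrier G)" "prime s" "s dvd order G"
  obtains h where "h \<in> carrier G" "h \<noteq> \<one>" "h [^] s = \<one>"
proof -
  obtain m where "order G = s ^ 1 * m" using assms(3) by auto
  then obtain H where H: "subgroup H G" "card H = s"
    using sylow_thm[OF assms(2) group_axioms _ assms(1), of 1 m] by auto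
  interpret H: subgroup H G by fact
  have "card H > 1" using H assms(2) prime_gt_1_nat by simp
  then have "\<not> H \<subseteq> {\<one>}" using card_mono[of "{\<one>}" H] by auto
  then obtain h where h: "h \<in> H" "h \<noteq> \<one>" by auto
  have "h [^]\<^bsub>G\<lparr>carrier := H\<rparr>\<^esub> order (G\<lparr>carrier := H\<rparr>) = \<one>\<^bsub>G\<lparr>carrier := H\<rparr>\<^esub>"
    using group.pow_order_eq_1[OF subgroup_imp_group[OF H(1)]] h by simp
  then have "h [^] s = \<one>"
    using H(2) by (simp add: Coset.order_def nat_pow_consistent[symmetric])
  with h show thesis using that[of h] H.mem_carrier by simp
qed

text \<open>The transfer is a product over the cosets of \<open>A\<close>, with \<open>s\<close>
  choosing representatives. It is multiplicative because the factors satisfy a cocycle identity and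
  right translation permutes the cosets. An element of the central \<open>A\<close> fixes each coset
  and contributes itself once per coset, whence the power.\<close>

lemma central_transfer:
  assumes A: "subgroup A G" and central: "\<And>a g. \<lbrakk>a \<in> A; g \<in> carrier G\<rbrakk> \<Longrightarrow> a \<otimes> g = g \<otimes> a"
    and fin: "finite (rcosets A)"
  obtains V where "\<And>g. g \<in> carrier G \<Longrightarrow> V g \<in> A"
    "\<And>g h. \<lbrakk>g \<in> carrier G; h \<in> carrier G\<rbrakk> \<Longrightarrow> V (g \<otimes> h) = V g \<otimes> V h"
    "\<And>a. a \<in> A \<Longrightarrow> V a = a [^] card (rcosets A)"
proof -
  interpret A: subgroup A G by fact
  let ?A = "G\<lparr>carrier := A\<rparr>"
  interpret AG: comm_group ?A
  proof (rule group.group_comm_groupI)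
    show "group ?A" using A by (rule subgroup_imp_group)
  qed (use central in auto)
  define s where "s C = (SOME x. x \<in> C)" for C :: "'a set"
  have s: "s C \<in> carrier G" "C = A #> s C" if C: "C \<in> rcosets A" for C
  proof -
    obtain x where x: "x \<in> carrier G" "C = A #> x" using C by (auto simp: RCOSETS_def)
    then have "x \<in> C" using rcos_self[OF x(1) A] by simp
    then have *: "s C \<in> C" unfolding s_def by (rule someI)
    then show "s C \<in> carrier G" using x r_coset_subset_G[OF A.subset] by blast
    show "C = A #> s C" using repr_independence[OF _ x(1) A] * x(2) by simp
  qed
  have mult: "C #> g \<in> rcosets A" if "C \<in> rcosets A" "g \<in> carrier G" for C g
    using that s[of C] by (metis A.subset coset_mult_assoc m_closed rcosetsI)
  have assoc: "(C #> g) #> h = C #> (g \<otimes> h)" if "C \<in> rcosets A" "g \<in> carrier G" "h \<in> carrier G" for C g h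
    using that s[of C] by (metis A.subset coset_mult_assoc r_coset_subset_G)
  \<comment> \<open>\<open>t g C\<close> is the correction in \<open>A\<close> between the
    translated representative of \<open>C\<close> and the representative of
    \<open>C #> g\<close>.\<close>
  define t where "t g C = s C \<otimes> g \<otimes> inv (s (C #> g))" for g C
  have t: "t g C \<in> A" if "C \<in> rcosets A" "g \<in> carrier G" for C g
  proof -
    have "A #> (s C \<otimes> g) = A #> s (C #> g)"
      using s[OF that(1)] s[OF mult[OF that]] that(2) by (metis A.subset coset_mult_assoc)
    moreover have "s C \<otimes> g \<in> carrier G" using s(1)[OF that(1)] that(2) by simp
    ultimately show ?thesis
      unfolding t_def using rcos_eq_iff[OF A _ s(1)[OF mult[OF that]]] by blast
  qed
  define V where "V g = finprod ?A (t g) (rcosets A)" for g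
  have VA: "V g \<in> A" if "g \<in> carrier G" for g
    using AG.finprod_closed[of "t g" "rcosets A"] t that by (auto simp: V_def)
  moreover have "V (g \<otimes> h) = V g \<otimes> V h" if g: "g \<in> carrier G" and h: "h \<in> carrier G" for g h
  proof -
    have "V (g \<otimes> h) = finprod ?A (\<lambda>C. t g C \<otimes>\<^bsub>?A\<^esub> t h (C #> g)) (rcosets A)"
      unfolding V_def
    proof (rule AG.finprod_cong')
      fix C assume C: "C \<in> rcosets A"
      show "t (g \<otimes> h) C = t g C \<otimes>\<^bsub>?A\<^esub> t h (C #> g)"
        using s[OF C] s[OF mult[OF C g]] s[OF mult[OF mult[OF C g] h]] g h
        by (simp add: t_def assoc[OF C g h] m_assoc)
    qed (use t g h mult in auto)
    also have "\<dots> = V g \<otimes>\<^bsub>?A\<^esub> finprod ?A (\<lambda>C. t h (C #> g)) (rcosets A)"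
      unfolding V_def by (rule AG.finprod_multf) (use t g h mult in auto)
    also have "finprod ?A (\<lambda>C. t h (C #> g)) (rcosets A) = V h"
    proof -
      have inj: "inj_on (\<lambda>C. C #> g) (rcosets A)"
      proof (rule inj_onI)
        fix C D assume C: "C \<in> rcosets A" and D: "D \<in> rcosets A" and "C #> g = D #> g"
        then have "C #> (g \<otimes> inv g) = D #> (g \<otimes> inv g)" using assoc g by (metis inv_closed)
        then show "C = D" using g C D s by (metis coset_mult_one r_coset_subset_G A.subset r_inv)
      qed
      have "(\<lambda>C. C #> g) ` (rcosets A) = rcosets A"
        by (rule endo_inj_surj[OF fin _ inj]) (use mult g in auto)
      then show ?thesis
        using AG.finprod_reindex[of "t h" "\<lambda>C. C #> g" "rcosets A"] inj t h by (auto simp: V_def)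
    qed
    finally show ?thesis by simp
  qed
  moreover have "V a = a [^] card (rcosets A)" if a: "a \<in> A" for a
  proof -
    have "t a C = a" if C: "C \<in> rcosets A" for C
    proof -
      have "C #> a = A #> (s C \<otimes> a)" using s[OF C] a by (metis A.mem_carrier A.subset coset_mult_assoc)
      also have "\<dots> = A #> (a \<otimes> s C)" using central[OF a s(1)[OF C]] by simp
      also have "\<dots> = A #> s C" using a s[OF C] by (metis A.mem_carrier A.subset coset_join2 coset_mult_assoc A.is_subgroup)
      finally have "C #> a = C" using s[OF C] by simp
      then have "t a C = a \<otimes> s C \<otimes> inv (s C)" using central[OF a s(1)[OF C]] by (simp add: t_def)
      then show ?thesis using s(1)[OF C] a by (simp add: m_assoc)
    qed
    then have "V a = finprod ?A (\<lambda>C. a) (rcosets A)"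
      unfolding V_def using a by (intro AG.finprod_cong') auto
    also have "\<dots> = a [^]\<^bsub>?A\<^esub> card (rcosets A)" using a by (intro AG.finprod_const) simp
    finally show ?thesis by (simp add: nat_pow_consistent[symmetric])
  qed
  ultimately show thesis using that by blast
qed

section \<open>The q-elements of a finite group whose width is below q\<close>

definition conj_set :: "'a \<Rightarrow> 'a set \<Rightarrow> 'a set" where
  "conj_set y H = (\<lambda>h. y \<otimes> h \<otimes> inv y) ` H"

lemma conj_set_subgroup:
  assumes "subgroup H G" "y \<in> carrier G"
  shows "subgroup (conj_set y H) G"
proof -
  interpret H: subgroup H G by fact
  show ?thesis
  proof (rule subgroupI)
    show "conj_set y H \<subseteq> carrier G" using assms by (auto simp: conj_set_def)
    show "conj_set y H \<noteq> {}" using H.one_closed unfolding conj_set_def by blast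
    show "inv a \<in> conj_set y H" if a: "a \<in> conj_set y H" for a
    proof -
      obtain h where h: "h \<in> H" "a = y \<otimes> h \<otimes> inv y" using a by (auto simp: conj_set_def)
      then have "inv a = y \<otimes> inv h \<otimes> inv y" using assms by (simp add: inv_mult_group m_assoc)
      then show ?thesis unfolding conj_set_def using h H.m_inv_closed by blast
    qed
    show "a \<otimes> b \<in> conj_set y H" if a: "a \<in> conj_set y H" and b: "b \<in> conj_set y H" for a b
    proof -
      obtain h where h: "h \<in> H" "a = y \<otimes> h \<otimes> inv y" using a by (auto simp: conj_set_def)
      obtain k where k: "k \<in> H" "b = y \<otimes> k \<otimes> inv y" using b by (auto simp: conj_set_def)
      have "a \<otimes> b = y \<otimes> (h \<otimes> k) \<otimes> inv y" using assms h k by (simp add: m_assoc)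
      then show ?thesis unfolding conj_set_def using h(1) k(1) by blast
    qed
  qed
qed

lemma card_conj_set:
  assumes "H \<subseteq> carrier G" "y \<in> carrier G"
  shows "card (conj_set y H) = card H"
  unfolding conj_set_def
proof (rule card_image, rule inj_onI)
  fix a b assume "a \<in> H" "b \<in> H" "y \<otimes> a \<otimes> inv y = y \<otimes> b \<otimes> inv y"
  then show "a = b" using assms by (metis inv_closed l_cancel m_closed r_cancel subsetD)
qed

lemma conj_pow_mem:
  assumes "y \<in> carrier G" "H \<subseteq> carrier G" "\<And>h. h \<in> H \<Longrightarrow> y \<otimes> h \<otimes> inv y \<in> H" "h \<in> H"
  shows "y [^] (n::nat) \<otimes> h \<otimes> inv (y [^] n) \<in> H"
proof (induction n)
  case 0
  then show ?case using assms by (simp add: subset_iff)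
next
  case (Suc n)
  have "y [^] Suc n \<otimes> h \<otimes> inv (y [^] Suc n) = y \<otimes> (y [^] n \<otimes> h \<otimes> inv (y [^] n)) \<otimes> inv y"
    unfolding nat_pow_Suc2[OF assms(1)] using assms by (simp add: inv_mult_group m_assoc subset_iff)
  then show ?case using assms(3)[OF Suc.IH] by simp
qed

lemma p_elements_nat_pow:
  assumes "y \<in> p_elements G q"
  shows "y [^] (n::nat) \<in> p_elements G q"
proof -
  obtain k :: nat where k: "y \<in> carrier G" "y [^] (q ^ k) = \<one>" using assms by (auto simp: p_elements_def)
  have "(y [^] n) [^] (q ^ k) = (y [^] (q ^ k)) [^] n" using k(1) by (simp add: nat_pow_pow mult.commute)
  then show ?thesis using k by (auto simp: p_elements_def)
qed

lemma p_elements_conj: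
  assumes "y \<in> p_elements G q" "g \<in> carrier G"
  shows "g \<otimes> y \<otimes> inv g \<in> p_elements G q"
proof -
  obtain k :: nat where k: "y \<in> carrier G" "y [^] (q ^ k) = \<one>" using assms by (auto simp: p_elements_def)
  have "(g \<otimes> y \<otimes> inv g) [^] n = g \<otimes> y [^] n \<otimes> inv g" for n :: nat
    using k(1) assms(2) by (induction n) (simp_all add: m_assoc)
  then have "(g \<otimes> y \<otimes> inv g) [^] (q ^ k) = \<one>" using k assms(2) by simp
  then show ?thesis using k assms(2) unfolding p_elements_def by blast
qed

lemma p_p'_trivial:
  assumes "y \<in> p_elements G q" "y \<in> p'_elements G q"
  shows "y = \<one>"
proof -
  obtain k n :: nat where "y \<in> carrier G" "y [^] (q ^ k) = \<one>" "y [^] n = \<one>" "coprime n q"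
    using assms by (auto simp: p_elements_def p'_elements_def)
  then show ?thesis using pow_coprime_trivial[of y "q ^ k" n] by simp
qed

text \<open>A \<open>q\<close>-element permutes at most \<open>w < q\<close> conjugates of \<open>H\<close>, so all orbits are trivial.\<close>

lemma p_element_normalizes:
  assumes fin: "finite (carrier G)" and w: "width_at_most {H. subgroup H G} w"
    and q: "prime q" "w < q" and y: "y \<in> p_elements G q" and H: "subgroup H G" and h: "h \<in> H"
  shows "y \<otimes> h \<otimes> inv y \<in> H"
proof -
  interpret H: subgroup H G by fact
  obtain k :: nat where k: "y \<in> carrier G" "y [^] (q ^ k) = \<one>" using y by (auto simp: p_elements_def)
  define c where "c i = conj_set (y [^] i) H" for i :: nat
  \<comment> \<open>All conjugates have the size of \<open>H\<close>, so distinct ones are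
    incomparable and at most \<open>w < q\<close> of them occur.\<close>
  have "card (c ` {..<q}) \<le> w"
  proof (rule w[unfolded width_at_most_def, rule_format])
    show "A = B" if "A \<in> c ` {..<q}" "B \<in> c ` {..<q}" "A \<subseteq> B" for A B
    proof (rule card_subset_eq)
      show "card A = card B" using that k card_conj_set[OF H.subset] by (auto simp: c_def)
      have "finite H" using fin H.subset finite_subset by blast
      then show "finite B" using that by (auto simp: c_def conj_set_def)
    qed (rule that)
  qed (use conj_set_subgroup[OF H] k in \<open>auto simp: c_def\<close>)
  then have "\<not> inj_on c {..<q}" using q(2) card_image[of c "{..<q}"] by fastforce
  then have "\<exists>i j. i < j \<and> j < q \<and> c i = c j"
    unfolding inj_on_def by (metis lessThan_iff linorder_neqE_nat)
  then obtain i j where ij: "i < j" "j < q" "c i = c j" by blast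
  define d where "d = j - i"
  have yd: "y [^] d \<in> carrier G" using k by simp
  have step: "y [^] d \<otimes> h \<otimes> inv (y [^] d) \<in> H" if h: "h \<in> H" for h
  proof -
    have "y [^] j \<otimes> h \<otimes> inv (y [^] j) \<in> c i" using h ij(3) by (simp add: c_def conj_set_def)
    then obtain h' where h': "h' \<in> H" "y [^] j \<otimes> h \<otimes> inv (y [^] j) = y [^] i \<otimes> h' \<otimes> inv (y [^] i)"
      by (auto simp: c_def conj_set_def)
    have "y [^] j = y [^] i \<otimes> y [^] d" using ij(1) k(1) by (simp add: d_def nat_pow_mult)
    then have "y [^] i \<otimes> (y [^] d \<otimes> h \<otimes> inv (y [^] d)) \<otimes> inv (y [^] i) = y [^] i \<otimes> h' \<otimes> inv (y [^] i)"
      using h'(2) k(1) h by (simp add: inv_mult_group m_assoc)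
    then have "y [^] d \<otimes> h \<otimes> inv (y [^] d) = h'"
      using k(1) h h'(1) by (metis H.mem_carrier inv_closed l_cancel m_closed nat_pow_closed r_cancel)
    then show ?thesis using h' by simp
  qed
  \<comment> \<open>As \<open>d\<close> is prime to \<open>q\<close>, the q-element \<open>y\<close>
    is itself a power of \<open>y [^] d\<close>, for which \<open>H\<close> is already known to be
    stable.\<close>
  have "0 < d" "d < q" using ij by (auto simp: d_def)
  then have "coprime d (q ^ k)"
    using q(1) by (metis coprime_commute coprime_power_right_iff nat_dvd_not_less prime_imp_coprime_nat)
  then obtain e :: nat where "(y [^] d) [^] e = y" using pow_unit_inverse[OF k] by metis
  moreover have "(y [^] d) [^] e \<otimes> h \<otimes> inv ((y [^] d) [^] e) \<in> H"
    using conj_pow_mem[OF yd H.subset step h] by blast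
  ultimately show ?thesis by simp
qed

text \<open>Since \<open>z\<close> normalizes the cyclic group of \<open>y\<close>, the n-th power
  of \<open>y \<otimes> z\<close> is an element of that group times \<open>z [^] n\<close>. For
  \<open>n\<close> an exponent of \<open>z\<close> only a power of \<open>y\<close> is left.\<close>

lemma p_elements_mult:
  assumes fin: "finite (carrier G)" and w: "width_at_most {H. subgroup H G} w"
    and q: "prime q" "w < q" and y: "y \<in> p_elements G q" and z: "z \<in> p_elements G q"
  shows "y \<otimes> z \<in> p_elements G q"
proof -
  obtain a :: nat where a: "y \<in> carrier G" "y [^] (q ^ a) = \<one>" using y by (auto simp: p_elements_def)
  obtain b :: nat where b: "z \<in> carrier G" "z [^] (q ^ b) = \<one>" using z by (auto simp: p_elements_def)
  let ?Y = "generate G {y}"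
  have Y: "subgroup ?Y G" using a by (simp add: generate_is_subgroup)
  interpret Y: subgroup ?Y G by fact
  have yY: "y \<in> ?Y" by (auto intro: generate.incl)
  have "\<exists>u\<in>?Y. (y \<otimes> z) [^] n = u \<otimes> z [^] n" for n :: nat
  proof (induction n)
    case 0
    then show ?case using a by (auto intro: bexI[of _ \<one>])
  next
    case (Suc n)
    then obtain u where u: "u \<in> ?Y" "(y \<otimes> z) [^] n = u \<otimes> z [^] n" by blast
    define v where "v = z [^] n \<otimes> y \<otimes> inv (z [^] n)"
    have v: "v \<in> ?Y" unfolding v_def
      by (rule p_element_normalizes[OF fin w q p_elements_nat_pow[OF z] Y yY])
    have "(y \<otimes> z) [^] Suc n = (u \<otimes> z [^] n) \<otimes> (y \<otimes> z)" using u by simp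
    also have "\<dots> = (u \<otimes> v) \<otimes> z [^] Suc n"
      using a b u(1) by (simp add: v_def m_assoc)
    finally show ?case using u v by blast
  qed
  then obtain u where u: "u \<in> ?Y" "(y \<otimes> z) [^] (q ^ b) = u \<otimes> z [^] (q ^ b)" by blast
  then obtain i :: int where i: "u = y [^] i" using generate_pow[OF a(1)] by auto
  have "u [^] (q ^ a) = y [^] (i * int (q ^ a))" unfolding i using a(1) by (metis int_pow_int int_pow_pow)
  also have "\<dots> = (y [^] (q ^ a)) [^] i" using a(1) by (metis int_pow_int int_pow_pow mult.commute)
  finally have "u [^] (q ^ a) = \<one>" using a by simp
  then have "((y \<otimes> z) [^] (q ^ b)) [^] (q ^ a) = \<one>" using u b by simp
  then have "(y \<otimes> z) [^] (q ^ (b + a)) = \<one>" using a b by (simp add: nat_pow_pow power_add)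
  then show ?thesis using a b by (auto simp: p_elements_def)
qed

lemma p_elements_subgroup:
  assumes fin: "finite (carrier G)" and w: "width_at_most {H. subgroup H G} w"
    and q: "prime q" "w < q"
  shows "subgroup (p_elements G q) G"
proof (rule subgroupI)
  show "p_elements G q \<subseteq> carrier G" by (auto simp: p_elements_def)
  have "\<one> \<in> p_elements G q" by (simp add: p_elements_def)
  then show "p_elements G q \<noteq> {}" by blast
  show "inv a \<in> p_elements G q" if "a \<in> p_elements G q" for a
    using that nat_pow_inv by (fastforce simp: p_elements_def)
  show "a \<otimes> b \<in> p_elements G q" if "a \<in> p_elements G q" "b \<in> p_elements G q" for a b
    using p_elements_mult[OF assms that] .
qed

text \<open>By Cauchy's theorem a prime divisor \<open>s\<close> of the order yields a nontrivial
  element of exponent \<open>s\<close>, which is a q-element only for \<open>s = q\<close>.\<close>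

lemma card_p_group:
  assumes fin: "finite (carrier G)" and P: "subgroup P G" "P \<subseteq> p_elements G q" and q: "prime q"
  obtains e where "card P = q ^ e"
proof -
  interpret P: subgroup P G by fact
  let ?P = "G\<lparr>carrier := P\<rparr>"
  have gP: "group ?P" using P(1) by (rule subgroup_imp_group)
  have finP: "finite P" using fin P.subset finite_subset by blast
  have "\<exists>e. card P = q ^ e"
  proof (rule prime_power_of_unique_prime_factor[OF _ q])
    show "card P > 0" using finP P.one_closed unfolding card_gt_0_iff by blast
    fix s :: nat assume s: "prime s" "s dvd card P"
    obtain h where h: "h \<in> P" "h \<noteq> \<one>" "h [^] s = \<one>"
      using group.cauchy[OF gP, of s] finP s by (auto simp: Coset.order_def nat_pow_consistent[symmetric])
    obtain k :: nat where k: "h \<in> carrier G" "h [^] (q ^ k) = \<one>" using h P(2) by (auto simp: p_elements_def)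
    show "s = q"
    proof (rule ccontr)
      assume "s \<noteq> q"
      then have "coprime s (q ^ k)" using s(1) q by (simp add: primes_coprime)
      then show False using pow_coprime_trivial[OF k h(3)] h(2) by blast
    qed
  qed
  then show thesis using that by blast
qed

text \<open>The maximal cyclic subgroups of a group of order \<open>q ^ e\<close> form an antichain, and fewer than
  \<open>q\<close> proper subgroups cannot cover it.\<close>

lemma p_group_cyclic:
  assumes fin: "finite (carrier G)" and w: "width_at_most {H. subgroup H G} w"
    and q: "prime q" "w < q" and P: "subgroup P G" "P \<subseteq> p_elements G q"
  obtains r where "r \<in> P" "P = generate G {r}"
proof -
  interpret P: subgroup P G by fact
  have finP: "finite P" using fin P.subset finite_subset by blast
  obtain e where e: "card P = q ^ e" using card_p_group[OF fin P q(1)] .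
  define \<C> where "\<C> = (\<lambda>x. generate G {x}) ` P"
  have \<C>: "finite \<C>" "\<And>C. C \<in> \<C> \<Longrightarrow> subgroup C G \<and> C \<subseteq> P"
    using finP P.subset generate_subgroup_incl[OF _ P(1)] unfolding \<C>_def
    by (auto simp del: generate_in_carrier intro!: generate_is_subgroup) blast
  define M where "M = {C \<in> \<C>. \<forall>D\<in>\<C>. C \<subseteq> D \<longrightarrow> C = D}"
  have "card M \<le> w"
    by (rule w[unfolded width_at_most_def, rule_format]) (use \<C> in \<open>auto simp: M_def\<close>)
  have cover: "P = \<Union>M"
  proof
    show "\<Union>M \<subseteq> P" using \<C> by (auto simp: M_def)
    show "P \<subseteq> \<Union>M"
    proof
      fix x assume x: "x \<in> P"
      then have "generate G {x} \<in> \<C>" by (auto simp: \<C>_def)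
      then obtain m where "m \<in> \<C>" "generate G {x} \<subseteq> m" "\<forall>b\<in>\<C>. m \<subseteq> b \<longrightarrow> m = b"
        using finite_has_maximal2[OF \<C>(1)] by blast
      then show "x \<in> \<Union>M" by (auto simp: M_def intro: generate.incl)
    qed
  qed
  show thesis
  proof (cases "P \<in> M")
    case True
    then show ?thesis using that by (auto simp: M_def \<C>_def)
  next
    case False
    \<comment> \<open>By Lagrange a proper subgroup of the q-group \<open>P\<close> has index at
      least \<open>q\<close>, so at most \<open>w < q\<close> of them together have too few elements
      to cover \<open>P\<close>.\<close>
    have bound: "card C * q \<le> card P" if "C \<in> M" for C
    proof -
      have C: "subgroup C G" "C \<subseteq> P" "C \<noteq> P" using that False \<C> by (auto simp: M_def)
      have "subgroup C (G\<lparr>carrier := P\<rparr>)" using subgroup_incl[OF C(1) P(1) C(2)] .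
      then have "card (rcosets\<^bsub>G\<lparr>carrier := P\<rparr>\<^esub> C) * card C = card P"
        using group.lagrange[OF subgroup_imp_group[OF P(1)]] by (simp add: Coset.order_def)
      then have "card C dvd q ^ e" using e by (metis dvd_triv_right)
      then obtain f where f: "f \<le> e" "card C = q ^ f" using divides_primepow_nat[OF q(1)] by blast
      have "card C < card P" using C finP by (simp add: psubset_card_mono psubset_eq)
      then have "f < e" using f e by (metis le_neq_implies_less less_irrefl)
      then have "q ^ Suc f \<le> q ^ e" using prime_ge_1_nat[OF q(1)] by (intro power_increasing) auto
      then show ?thesis using e f by (simp add: mult.commute)
    qed
    have "card P * q \<le> (\<Sum>C\<in>M. card C) * q"
      using card_Union_le_sum_card[of M] cover by simp
    also have "\<dots> \<le> (\<Sum>C\<in>M. card P)" unfolding sum_distrib_right using bound by (intro sum_mono)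
    also have "\<dots> = card M * card P" by simp
    also have "\<dots> \<le> w * card P" using \<open>card M \<le> w\<close> by simp
    also have "\<dots> < q * card P" using q(2) finP P.one_closed by (metis card_gt_0_iff empty_iff mult_less_mono1)
    finally show ?thesis by (simp add: mult.commute)
  qed
qed

lemma generate_nat_pow:
  assumes "x \<in> carrier G" "x [^] (m::nat) = \<one>" "m > 0" "y \<in> generate G {x}"
  obtains i :: nat where "y = x [^] i"
proof -
  obtain k :: int where k: "y = x [^] k" using generate_pow[OF assms(1)] assms(4) by auto
  have "k = int (nat (k mod int m)) + int m * (k div int m)" using assms(3) by simp
  then have "y = x [^] int (nat (k mod int m)) \<otimes> x [^] (int m * (k div int m))"
    using k assms(1) by (metis int_pow_mult)
  also have "x [^] (int m * (k div int m)) = (x [^] m) [^] (k div int m)"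
    using assms(1) by (metis int_pow_int int_pow_pow)
  finally have "y = x [^] nat (k mod int m)" using assms(1,2) by (simp add: int_pow_int)
  then show thesis by (rule that)
qed

text \<open>Inclusion is decided by the q-adic valuation of the exponent: the part of
  \<open>i\<close> prime to \<open>q\<close> is invertible modulo the order of \<open>r\<close>, so
  \<open>r [^] i\<close> generates the same group as \<open>r [^] (q ^ s)\<close> with
  \<open>s\<close> the valuation of \<open>i\<close>.\<close>

lemma cyclic_p_group_comparable:
  assumes q: "prime q" and r: "r \<in> p_elements G q" "y \<in> generate G {r}" "z \<in> generate G {r}"
    and fin: "finite (carrier G)"
  shows "y \<in> generate G {z} \<or> z \<in> generate G {y}"
proof -
  obtain a :: nat where a: "r \<in> carrier G" "r [^] (q ^ a) = \<one>" using r by (auto simp: p_elements_def)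
  have *: "r [^] (j::nat) \<in> generate G {r [^] (i::nat)}"
    if ij: "i > 0" "j > 0" "multiplicity q i \<le> multiplicity q j" for i j
  proof -
    define s where "s = multiplicity q i"
    obtain i' where i': "i = q ^ s * i'" "\<not> q dvd i'"
      using multiplicity_decompose'[of i q] ij q by (metis not_prime_unit neq0_conv s_def)
    have "q ^ s dvd j" using ij(3) by (simp add: s_def multiplicity_dvd')
    then obtain j' where j': "j = q ^ s * j'" by auto
    have "coprime i' (q ^ a)" using i'(2) q by (metis coprime_commute coprime_power_right_iff prime_imp_coprime_nat)
    moreover have "(r [^] (q ^ s)) [^] (q ^ a) = \<one>"
    proof -
      have "(r [^] (q ^ s)) [^] (q ^ a) = (r [^] (q ^ a)) [^] (q ^ s)" using a(1) by (simp add: nat_pow_pow mult.commute)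
      then show ?thesis using a by simp
    qed
    ultimately obtain e :: nat where e: "((r [^] (q ^ s)) [^] i') [^] e = r [^] (q ^ s)"
      using pow_unit_inverse a(1) by (metis nat_pow_closed)
    have "r [^] j = (r [^] i) [^] (e * j')"
      using e a(1) i' j' by (metis nat_pow_closed nat_pow_pow)
    then have "r [^] j = (r [^] i) [^] int (e * j')" by (simp only: int_pow_int)
    then show ?thesis using generate_pow[of "r [^] i"] a(1) by auto
  qed
  have "q ^ a > 0" using q by (simp add: prime_gt_0_nat)
  then obtain i j :: nat where ij: "y = r [^] i" "z = r [^] j"
    using r(2,3) generate_nat_pow[OF a] by metis
  have one: "\<one> \<in> generate G {x}" for x by (rule generate.one)
  show ?thesis
  \<comment> \<open>\<open>multiplicity q 0\<close> is \<open>0\<close> by convention although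
    \<open>0\<close> is divisible by every power of \<open>q\<close>, so the identity is treated
    separately.\<close>
  proof (cases "i = 0 \<or> j = 0")
    case True
    then show ?thesis using ij one by auto
  next
    case False
    then show ?thesis using *[of i j] *[of j i] ij by (metis linorder_le_cases neq0_conv)
  qed
qed

context
  fixes w q :: nat
  assumes fin: "finite (carrier G)" and w: "width_at_most {H. subgroup H G} w"
    and q: "prime q" "w < q"
begin

lemma p_elements_comparable:
  assumes "y \<in> p_elements G q" "z \<in> p_elements G q"
  shows "y \<in> generate G {z} \<or> z \<in> generate G {y}"
proof -
  obtain r where "r \<in> p_elements G q" "p_elements G q = generate G {r}"
    using p_group_cyclic[OF fin w q p_elements_subgroup[OF fin w q]] by blast
  then show ?thesis using cyclic_p_group_comparable[OF q(1)] assms fin by blast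
qed

lemma finite_order_decomposition:
  assumes g: "g \<in> carrier G"
  obtains i j :: int where "i + j = 1" "g [^] i \<in> p_elements G q" "g [^] j \<in> p'_elements G q"
proof -
  have "g [^] order G = \<one>" using g by (rule pow_order_eq_1)
  moreover have "order G > 0" using fin by (simp add: order_gt_0_iff_finite)
  ultimately show thesis using coprime_decomposition[OF g _ _ q(1)] that by blast
qed

text \<open>The commutator is a q'-element, being in the cyclic group of \<open>z\<close> which
  \<open>y\<close> normalizes, and a q-element, being the product of \<open>y\<close> and a
  conjugate of its inverse. Hence it is trivial.\<close>

lemma p_elements_p'_commute:
  assumes y: "y \<in> p_elements G q" and z: "z \<in> p'_elements G q"
  shows "y \<otimes> z = z \<otimes> y"
proof -
  obtain n :: nat where n: "z \<in> carrier G" "coprime n q" "z [^] n = \<one>" using z by (auto simp: p'_elements_def)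
  have yc: "y \<in> carrier G" using y by (auto simp: p_elements_def)
  interpret Q: subgroup "p_elements G q" G using p_elements_subgroup[OF fin w q] .
  interpret Z: subgroup "generate G {z}" G using n by (simp add: generate_is_subgroup)
  have zZ: "z \<in> generate G {z}" by (auto intro: generate.incl)
  define c where "c = y \<otimes> z \<otimes> inv y \<otimes> inv z"
  have "y \<otimes> z \<otimes> inv y \<in> generate G {z}"
    by (rule p_element_normalizes[OF fin w q y Z.subgroup_axioms zZ])
  then have "c \<in> generate G {z}" using zZ unfolding c_def by blast
  then obtain i :: int where i: "c = z [^] i" using generate_pow[OF n(1)] by auto
  have "c [^] n = z [^] (i * int n)" unfolding i using n(1) by (metis int_pow_int int_pow_pow)
  also have "\<dots> = (z [^] n) [^] i" using n(1) by (metis int_pow_int int_pow_pow mult.commute)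
  finally have "c [^] n = \<one>" using n by simp
  then have "c \<in> p'_elements G q" using n yc by (auto simp: p'_elements_def c_def)
  moreover have "c = y \<otimes> (z \<otimes> inv y \<otimes> inv z)" using n yc by (simp add: c_def m_assoc)
  then have "c \<in> p_elements G q" using p_elements_conj[of "inv y" q z] y n(1) by simp
  ultimately have "c = \<one>" by (rule p_p'_trivial[rotated])
  then have "y \<otimes> z \<otimes> inv (z \<otimes> y) = \<one>" using n yc by (simp add: c_def inv_mult_group m_assoc)
  then show ?thesis using n yc by (metis inv_closed inv_equality inv_inv m_closed)
qed

text \<open>Split \<open>g\<close> into powers of itself. The q-part lies with \<open>y\<close> in
  one cyclic group, and the q'-part commutes with \<open>y\<close> by coprimality.\<close>

lemma p_elements_central:
  assumes y: "y \<in> p_elements G q" and g: "g \<in> carrier G"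
  shows "y \<otimes> g = g \<otimes> y"
proof -
  obtain i j :: int where ij: "i + j = 1" "g [^] i \<in> p_elements G q" "g [^] j \<in> p'_elements G q"
    using finite_order_decomposition[OF g] .
  have yc: "y \<in> carrier G" using y by (auto simp: p_elements_def)
  have cyc: "a \<otimes> b = b \<otimes> a" if a: "a \<in> carrier G" and b: "b \<in> generate G {a}" for a b
  proof -
    obtain k :: int where "b = a [^] k" using generate_pow[OF a] b by auto
    moreover have "a \<otimes> a [^] k = a [^] (1 + k)" using a by (simp add: int_pow_mult)
    moreover have "a [^] k \<otimes> a = a [^] (k + 1)" using a by (simp add: int_pow_mult)
    ultimately show ?thesis by (simp add: add.commute)
  qed
  have "y \<otimes> g [^] i = g [^] i \<otimes> y"
    using p_elements_comparable[OF y ij(2)] cyc[of y "g [^] i"] cyc[of "g [^] i" y] yc g by auto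
  moreover have "y \<otimes> g [^] j = g [^] j \<otimes> y" by (rule p_elements_p'_commute[OF y ij(3)])
  moreover have "g = g [^] i \<otimes> g [^] j" using ij(1) g by (simp add: int_pow_mult[symmetric])
  ultimately show ?thesis using yc g by (metis int_pow_closed m_assoc)
qed

text \<open>The transfer to the central group of q-elements kills every q'-element, hence also
  \<open>y \<otimes> z\<close> and the q-part \<open>a\<close> of that product. On \<open>a\<close>
  it is a power with exponent prime to \<open>q\<close>, which forces
  \<open>a = \<one>\<close>.\<close>

lemma p'_elements_mult:
  assumes y: "y \<in> p'_elements G q" and z: "z \<in> p'_elements G q"
  shows "y \<otimes> z \<in> p'_elements G q"
proof -
  let ?Q = "p_elements G q"
  have Q: "subgroup ?Q G" using p_elements_subgroup[OF fin w q] .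
  have finR: "finite (rcosets ?Q)" using fin by (simp add: RCOSETS_def)
  obtain V where V: "\<And>g. g \<in> carrier G \<Longrightarrow> V g \<in> ?Q"
    "\<And>g h. \<lbrakk>g \<in> carrier G; h \<in> carrier G\<rbrakk> \<Longrightarrow> V (g \<otimes> h) = V g \<otimes> V h"
    "\<And>a. a \<in> ?Q \<Longrightarrow> V a = a [^] card (rcosets ?Q)"
    using central_transfer[OF Q p_elements_central finR] by blast
  \<comment> \<open>Were \<open>q\<close> to divide the index, Sylow would give a subgroup of order
    \<open>q ^ Suc e\<close>, consisting of q-elements but larger than the set of all of
    them.\<close>
  have cop: "coprime (card (rcosets ?Q)) q"
  proof (rule ccontr)
    assume "\<not> ?thesis"
    then have "q dvd card (rcosets ?Q)" using q(1) by (metis coprime_commute prime_imp_coprime_nat)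
    then obtain k where k: "card (rcosets ?Q) = q * k" by auto
    obtain e where e: "card ?Q = q ^ e" using card_p_group[OF fin Q order_refl q(1)] .
    have "order G = q ^ Suc e * k" using lagrange[OF Q] k e by (simp add: ac_simps)
    then obtain P where P: "subgroup P G" "card P = q ^ Suc e"
      using sylow_thm[OF q(1) group_axioms _ fin] by blast
    interpret P: subgroup P G by fact
    have "P \<subseteq> ?Q"
    proof
      fix x assume x: "x \<in> P"
      have "x [^]\<^bsub>G\<lparr>carrier := P\<rparr>\<^esub> Coset.order (G\<lparr>carrier := P\<rparr>) = \<one>\<^bsub>G\<lparr>carrier := P\<rparr>\<^esub>"
        using group.pow_order_eq_1[OF subgroup_imp_group[OF P(1)]] x by simp
      then have "x [^] (q ^ Suc e) = \<one>"
        using P(2) by (simp add: Coset.order_def nat_pow_consistent[symmetric])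
      then show "x \<in> ?Q" using P.mem_carrier[OF x] unfolding p_elements_def by blast
    qed
    then have "card P \<le> card ?Q" using fin by (intro card_mono) (auto simp: p_elements_def)
    then show False using P(2) e prime_gt_1_nat[OF q(1)] by simp
  qed
  have pow: "V (g [^] n) = V g [^] n" if "g \<in> carrier G" for g and n :: nat
  proof (induction n)
    case 0
    have "V \<one> = \<one>" using V(3)[of \<one>] subgroup.one_closed[OF Q] by simp
    then show ?case by simp
  next
    case (Suc n)
    then show ?case using V(2)[of "g [^] n" g] that by simp
  qed
  have V1: "V g = \<one>" if "g \<in> p'_elements G q" for g
  proof (rule p_p'_trivial)
    obtain n :: nat where n: "g \<in> carrier G" "coprime n q" "g [^] n = \<one>" using \<open>g \<in> p'_elements G q\<close> by (auto simp: p'_elements_def)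
    then show "V g \<in> ?Q" using V(1) by blast
    have "V g [^] n = \<one>" using pow[OF n(1), of n] V(3)[of \<one>] n subgroup.one_closed[OF Q] by simp
    then show "V g \<in> p'_elements G q" using V(1)[OF n(1)] n(2) by (auto simp: p'_elements_def p_elements_def)
  qed
  have c: "y \<in> carrier G" "z \<in> carrier G" using y z by (auto simp: p'_elements_def)
  then obtain i j :: int where ij: "i + j = 1" "(y \<otimes> z) [^] i \<in> ?Q" "(y \<otimes> z) [^] j \<in> p'_elements G q"
    using finite_order_decomposition[of "y \<otimes> z"] by blast
  define a where "a = (y \<otimes> z) [^] i"
  define b where "b = (y \<otimes> z) [^] j"
  have ab: "y \<otimes> z = a \<otimes> b" using c by (simp add: a_def b_def int_pow_mult[symmetric] ij(1))
  have abc: "a \<in> carrier G" "b \<in> carrier G" using c by (auto simp: a_def b_def)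
  have "V y \<otimes> V z = V a \<otimes> V b" using V(2)[OF c] V(2)[OF abc] ab by simp
  moreover have "V b = \<one>" using V1[of b] ij(3) by (simp add: b_def)
  moreover have "V a \<in> carrier G" using V(1)[OF abc(1)] by (simp add: p_elements_def)
  ultimately have "V a = \<one>" using V1[OF y] V1[OF z] by simp
  then have "a [^] card (rcosets ?Q) = \<one>" using V(3)[of a] ij(2) by (simp add: a_def)
  then have "a \<in> p'_elements G q" using abc cop by (auto simp: p'_elements_def)
  then have "a = \<one>" using p_p'_trivial ij(2) by (simp add: a_def)
  then show ?thesis using ab abc ij(3) by (simp add: b_def)
qed

end

end


section \<open>Pro-p and pro-p' parts of a profinite group\<close>

declare one_FactGroup [simp del] mult_FactGroup [simp del]

text \<open>Finite quotients replace a condition on the order, because an element of the pro-q part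
  may have infinite order.\<close>

definition pro_p :: "'a topgroup \<Rightarrow> nat \<Rightarrow> 'a set" where
  "pro_p G q = {y \<in> carrier G. \<forall>N. open_normal G N \<longrightarrow> N #>\<^bsub>G\<^esub> y \<in> p_elements (G Mod N) q}"

definition pro_p' :: "'a topgroup \<Rightarrow> nat \<Rightarrow> 'a set" where
  "pro_p' G q = {y \<in> carrier G. \<forall>N. open_normal G N \<longrightarrow> N #>\<^bsub>G\<^esub> y \<in> p'_elements (G Mod N) q}"

context group
begin

lemma one_p'_elements: "\<one> \<in> p'_elements G q"
  by (auto simp: p'_elements_def intro!: exI[of _ "1::nat"])

lemma inv_p'_elements: "z \<in> p'_elements G q \<Longrightarrow> inv z \<in> p'_elements G q"
  unfolding p'_elements_def using nat_pow_inv by fastforce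

end

context profinite_group
begin

section \<open>Arithmetic in the finite quotients\<close>

lemma open_normal_normal: "open_normal G N \<Longrightarrow> N \<lhd> G"
  by (simp add: open_normal_def)

lemma quotient_group: "open_normal G N \<Longrightarrow> group (G Mod N)"
  using normal.factorgroup_is_group[OF open_normal_normal] .

lemma quotient_hom:
  "open_normal G N \<Longrightarrow> (\<lambda>x. N #> x) \<in> hom G (G Mod N)"
  using normal.r_coset_hom_Mod[OF open_normal_normal] .

lemma quotient_group_hom: "open_normal G N \<Longrightarrow> group_hom G (G Mod N) (\<lambda>x. N #> x)"
  using quotient_group quotient_hom group_hom.intro group_hom_axioms.intro group_axioms by blast

lemma quotient_finite: "open_normal G N \<Longrightarrow> finite (carrier (G Mod N))"
  using finite_rcosets_open by (simp add: FactGroup_def)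

lemma quotient_carrier: "open_normal G N \<Longrightarrow> x \<in> carrier G \<Longrightarrow> N #> x \<in> carrier (G Mod N)"
  by (auto simp: FactGroup_def RCOSETS_def)

lemma quotient_carrierE:
  assumes "c \<in> carrier (G Mod N)"
  obtains x where "x \<in> carrier G" "c = N #> x"
  using assms by (auto simp: FactGroup_def RCOSETS_def)

lemma quotient_mult:
  "\<lbrakk>open_normal G N; x \<in> carrier G; y \<in> carrier G\<rbrakk> \<Longrightarrow>
    (N #> x) \<otimes>\<^bsub>G Mod N\<^esub> (N #> y) = N #> (x \<otimes> y)"
  using quotient_hom[of N] by (simp add: hom_def)

lemma quotient_inv:
  "\<lbrakk>open_normal G N; x \<in> carrier G\<rbrakk> \<Longrightarrow> inv\<^bsub>G Mod N\<^esub> (N #> x) = N #> inv x"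
  using group_hom.hom_inv[OF quotient_group_hom] by simp

lemma quotient_nat_pow:
  "\<lbrakk>open_normal G N; x \<in> carrier G\<rbrakk> \<Longrightarrow> (N #> x) [^]\<^bsub>G Mod N\<^esub> (n::nat) = N #> x [^] n"
  using group_hom.hom_nat_pow[OF quotient_group_hom] by metis

lemma quotient_int_pow:
  "\<lbrakk>open_normal G N; x \<in> carrier G\<rbrakk> \<Longrightarrow> (N #> x) [^]\<^bsub>G Mod N\<^esub> (n::int) = N #> x [^] n"
  using group_hom.hom_int_pow[OF quotient_group_hom] by metis

text \<open>Normality allows right cosets to be compared through \<open>inv x \<otimes> y\<close>,
  the form in which neighbourhoods are translated throughout.\<close>

lemma quotient_eq:
  "\<lbrakk>open_normal G N; x \<in> carrier G; y \<in> carrier G\<rbrakk> \<Longrightarrow> N #> x = N #> y \<longleftrightarrow> inv x \<otimes> y \<in> N"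
proof -
  assume N: "open_normal G N" and xy: "x \<in> carrier G" "y \<in> carrier G"
  interpret N: normal N G using N by (rule open_normal_normal)
  have "N #> x = N #> y \<longleftrightarrow> y \<otimes> inv x \<in> N"
    using rcos_eq_iff[OF N.subgroup_axioms xy(2,1)] by auto
  also have "\<dots> \<longleftrightarrow> inv x \<otimes> y \<in> N"
  proof
    assume "y \<otimes> inv x \<in> N"
    from N.inv_op_closed1[OF xy(1) this] show "inv x \<otimes> y \<in> N" using xy by (simp add: m_assoc)
  next
    assume "inv x \<otimes> y \<in> N"
    from N.inv_op_closed2[OF xy(1) this] show "y \<otimes> inv x \<in> N" using xy by (simp add: m_assoc)
  qed
  finally show ?thesis .
qed

lemma quotient_eq_one:
  "\<lbrakk>open_normal G N; x \<in> carrier G\<rbrakk> \<Longrightarrow> N #> x = N \<longleftrightarrow> x \<in> N"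
  using coset_join1 coset_join2 open_normal_subgroup subgroup.subset by metis

lemma quotient_one: "\<lbrakk>open_normal G N; x \<in> carrier G\<rbrakk> \<Longrightarrow> N #> x = \<one>\<^bsub>G Mod N\<^esub> \<longleftrightarrow> x \<in> N"
  using quotient_eq_one by (simp add: one_FactGroup)

lemma quotient_subset:
  assumes "open_normal G N" "open_normal G M" "M \<subseteq> N" "x \<in> carrier G" "y \<in> carrier G" "M #> x = M #> y"
  shows "N #> x = N #> y"
  using assms quotient_eq by blast

text \<open>A condition on the coset alone is locally constant. Applied to the negation it gives
  closedness as well, which is why \<open>P\<close> is arbitrary.\<close>

lemma openin_coset_pred:
  assumes "open_normal G N"
  shows "openin T {y \<in> carrier G. P (N #> y)}"
proof (subst openin_subopen, intro ballI)
  fix y assume y: "y \<in> {y \<in> carrier G. P (N #> y)}"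
  have "openin T {x \<in> carrier G. inv y \<otimes> x \<in> N}"
    using openin_lcoset[of N y] assms y by (simp add: open_normal_def)
  moreover have "y \<in> {x \<in> carrier G. inv y \<otimes> x \<in> N}"
    using y subgroup.one_closed[OF open_normal_subgroup[OF assms]] by simp
  moreover have "{x \<in> carrier G. inv y \<otimes> x \<in> N} \<subseteq> {y \<in> carrier G. P (N #> y)}"
      proof
    fix x assume x: "x \<in> {x \<in> carrier G. inv y \<otimes> x \<in> N}"
    then have "N #> y = N #> x" using quotient_eq[OF assms, of y x] y by simp
    then show "x \<in> {y \<in> carrier G. P (N #> y)}" using x y by simp
  qed
  ultimately show "\<exists>S. openin T S \<and> y \<in> S \<and> S \<subseteq> {y \<in> carrier G. P (N #> y)}" by blast
qed

lemma closedin_coset_pred: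
  assumes "open_normal G N"
  shows "closedin T {y \<in> carrier G. P (N #> y)}"
proof -
  have "topspace T - {y \<in> carrier G. P (N #> y)} = {y \<in> carrier G. \<not> P (N #> y)}" by auto
  then show ?thesis using openin_coset_pred[OF assms, of "\<lambda>c. \<not> P c"] by (auto simp: closedin_def)
qed

text \<open>Preimages of subgroups of the quotient are closed, and taking preimages reflects
  inclusion, so antichains lift.\<close>

lemma quotient_width:
  assumes N: "open_normal G N" and w: "width_at_most (Collect (closed_subgroup G)) w"
  shows "width_at_most {H. subgroup H (G Mod N)} w"
  unfolding width_at_most_def
proof (intro allI impI)
  fix F assume F: "finite F" "F \<subseteq> {H. subgroup H (G Mod N)}" "\<forall>H\<in>F. \<forall>K\<in>F. H \<subseteq> K \<longrightarrow> H = K"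
  define p where "p H = {x \<in> carrier G. N #> x \<in> H}" for H
  have mono: "H \<subseteq> K" if "H \<in> F" "p H \<subseteq> p K" for H K
  proof
    fix c assume c: "c \<in> H"
    then have "c \<in> carrier (G Mod N)" using F(2) that(1) subgroup.subset by blast
    then obtain x where "x \<in> carrier G" "c = N #> x" by (rule quotient_carrierE)
    then show "c \<in> K" using c that(2) by (auto simp: p_def)
  qed
  have "inj_on p F"
  proof (rule inj_onI)
    fix H K assume "H \<in> F" "K \<in> F" "p H = p K"
    then show "H = K" using mono[of H K] mono[of K H] by simp
  qed
  moreover have "card (p ` F) \<le> w"
  proof (rule w[unfolded width_at_most_def, rule_format])
    show "p ` F \<subseteq> Collect (closed_subgroup G)"
    proof clarify
      fix H assume "H \<in> F"
      then have H: "subgroup H (G Mod N)" using F(2) by auto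
      have "subgroup (p H) G"
      proof (rule subgroupI)
        have "N #> \<one> \<in> H" using subgroup.one_closed[OF H] quotient_one[OF N, of \<one>]
          subgroup.one_closed[OF open_normal_subgroup[OF N]] by simp
        then show "p H \<noteq> {}" unfolding p_def by blast
        show "inv a \<in> p H" if "a \<in> p H" for a
          using that subgroup.m_inv_closed[OF H] quotient_inv[OF N] by (fastforce simp: p_def)
        show "a \<otimes> b \<in> p H" if "a \<in> p H" "b \<in> p H" for a b
          using that subgroup.m_closed[OF H] quotient_mult[OF N] by (fastforce simp: p_def)
      qed (auto simp: p_def)
      moreover have "closedin T (p H)" unfolding p_def by (rule closedin_coset_pred[OF N])
      ultimately show "closed_subgroup G (p H)" by (simp add: closed_subgroup_def)
    qed
    show "A = B" if "A \<in> p ` F" "B \<in> p ` F" "A \<subseteq> B" for A B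
    proof -
      obtain H K where "H \<in> F" "K \<in> F" "A = p H" "B = p K" using \<open>A \<in> p ` F\<close> \<open>B \<in> p ` F\<close> by auto
      then show "A = B" using mono[of H K] F(3) \<open>A \<subseteq> B\<close> by auto
    qed
  qed (use F(1) in simp)
  ultimately show "card F \<le> w" by (simp add: card_image)
qed

lemma quotient_p_elements_mono:
  assumes N: "open_normal G N" and M: "open_normal G M" and sub: "M \<subseteq> N" and y: "y \<in> carrier G"
  shows "M #> y \<in> p_elements (G Mod M) q \<Longrightarrow> N #> y \<in> p_elements (G Mod N) q"
    and "M #> y \<in> p'_elements (G Mod M) q \<Longrightarrow> N #> y \<in> p'_elements (G Mod N) q"
  using sub y quotient_carrier[OF N y] quotient_one[OF N] quotient_one[OF M]
  unfolding p_elements_def p'_elements_def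
  by (auto simp: quotient_nat_pow[OF N y] quotient_nat_pow[OF M y])

text \<open>In each finite quotient the coprime decomposition provides a power of \<open>g\<close>;
  the solution sets \<open>F N\<close> are closed and decreasing, so they have a common point.
  Keeping them inside the procyclic group of \<open>g\<close> puts both parts of \<open>g\<close>
  into every closed subgroup containing \<open>g\<close>.\<close>

lemma pro_p_decomposition:
  assumes g: "g \<in> carrier G" and q: "prime q"
  obtains y where "y \<in> procyclic G g" "y \<in> pro_p G q" "inv y \<otimes> g \<in> pro_p' G q"
proof -
  define F where "F N = procyclic G g \<inter> {y \<in> carrier G. N #> y \<in> p_elements (G Mod N) q \<and>
      inv\<^bsub>G Mod N\<^esub> (N #> y) \<otimes>\<^bsub>G Mod N\<^esub> (N #> g) \<in> p'_elements (G Mod N) q}" for N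
  have Feq: "inv\<^bsub>G Mod N\<^esub> (N #> y) \<otimes>\<^bsub>G Mod N\<^esub> (N #> g) = N #> (inv y \<otimes> g)"
    if "open_normal G N" "y \<in> carrier G" for N y
    using that g by (simp only: quotient_inv quotient_mult inv_closed)
  obtain y where y: "y \<in> carrier G" "\<And>N. open_normal G N \<Longrightarrow> y \<in> F N"
  proof (rule directed_Inter_nonempty[of F])
    fix N assume N: "open_normal G N"
    show "closedin T (F N)" unfolding F_def
      by (rule closedin_Int[OF procyclic_closedin[OF g] closedin_coset_pred[OF N]])
    interpret Q: group "G Mod N" using quotient_group[OF N] .
    obtain i j :: int where ij: "i + j = 1" "(N #> g) [^]\<^bsub>G Mod N\<^esub> i \<in> p_elements (G Mod N) q"
      "(N #> g) [^]\<^bsub>G Mod N\<^esub> j \<in> p'_elements (G Mod N) q"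
    proof (rule Q.coprime_decomposition[OF _ _ _ q])
      show "N #> g \<in> carrier (G Mod N)" using quotient_carrier[OF N g] .
      then show "(N #> g) [^]\<^bsub>G Mod N\<^esub> order (G Mod N) = \<one>\<^bsub>G Mod N\<^esub>" by (rule Q.pow_order_eq_1)
      show "0 < order (G Mod N)" using quotient_finite[OF N] by (simp add: Q.order_gt_0_iff_finite)
    qed
    have "g [^] i \<in> F N"
    proof -
      have "inv (g [^] i) \<otimes> g = g [^] (- i) \<otimes> g [^] (1::int)" using g by (simp add: int_pow_neg)
      also have "\<dots> = g [^] j" using g ij(1) by (simp add: int_pow_mult[symmetric] del: int_pow_1)
         (metis add.commute add_diff_cancel_left' uminus_add_conv_diff)
      finally show ?thesis
        using ij g procyclic_pow[OF g, of i] by (simp add: F_def Feq[OF N] quotient_int_pow[OF N])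
    qed
    then show "F N \<noteq> {}" by blast
  next
    fix N M assume NM: "open_normal G N" "open_normal G M" "M \<subseteq> N"
    show "F M \<subseteq> F N"
    proof
      fix y assume "y \<in> F M"
      then have y: "y \<in> procyclic G g" "y \<in> carrier G" "M #> y \<in> p_elements (G Mod M) q"
         "M #> (inv y \<otimes> g) \<in> p'_elements (G Mod M) q"
        using Feq[OF NM(2)] by (auto simp: F_def)
      then show "y \<in> F N"
        using quotient_p_elements_mono[OF NM] g Feq[OF NM(1) y(2)] by (auto simp: F_def)
    qed
  qed blast
  show thesis
  proof (rule that)
    show "y \<in> procyclic G g" using y(2)[OF open_normal_carrier] by (simp add: F_def)
    show "y \<in> pro_p G q" using y by (auto simp: pro_p_def F_def)
    show "inv y \<otimes> g \<in> pro_p' G q" using y g Feq by (auto simp: pro_p'_def F_def)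
  qed
qed

lemma pro_p_p'_trivial:
  assumes "y \<in> pro_p G q" "y \<in> pro_p' G q"
  shows "y = \<one>"
proof (rule open_normal_trivial)
  show y: "y \<in> carrier G" using assms by (simp add: pro_p_def)
  fix N assume N: "open_normal G N"
  then have "N #> y = \<one>\<^bsub>G Mod N\<^esub>"
    using group.p_p'_trivial[OF quotient_group[OF N], of "N #> y" q] assms by (auto simp: pro_p_def pro_p'_def)
  then show "y \<in> N" using quotient_one[OF N y] by simp
qed

lemma closedin_pro_p: "closedin T (pro_p G q)" and closedin_pro_p': "closedin T (pro_p' G q)"
proof -
  have "pro_p G q = (\<Inter>N\<in>Collect (open_normal G). {y \<in> carrier G. N #> y \<in> p_elements (G Mod N) q})"
    using open_normal_carrier by (auto simp: pro_p_def)
  then show "closedin T (pro_p G q)"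
    using closedin_coset_pred open_normal_carrier by (auto intro!: closedin_Inter)
  have "pro_p' G q = (\<Inter>N\<in>Collect (open_normal G). {y \<in> carrier G. N #> y \<in> p'_elements (G Mod N) q})"
    using open_normal_carrier by (auto simp: pro_p'_def)
  then show "closedin T (pro_p' G q)"
    using closedin_coset_pred open_normal_carrier by (auto intro!: closedin_Inter)
qed

section \<open>The pro-q part for a prime q above the width\<close>

context
  fixes w q :: nat
  assumes w: "width_at_most (Collect (closed_subgroup G)) w" and q: "prime q" "w < q"
begin

lemma pro_p_subgroup: "subgroup (pro_p G q) G"
proof (rule subgroupI)
  have *: "subgroup (p_elements (G Mod N) q) (G Mod N)" if "open_normal G N" for N
    using group.p_elements_subgroup[OF quotient_group[OF that] quotient_finite[OF that] quotient_width[OF that w] q] .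
  show "pro_p G q \<subseteq> carrier G" by (auto simp: pro_p_def)
  have "\<one> \<in> pro_p G q"
    using subgroup.one_closed[OF *] quotient_one[of _ \<one>] subgroup.one_closed[OF open_normal_subgroup]
    by (auto simp: pro_p_def)
  then show "pro_p G q \<noteq> {}" by blast
  show "inv a \<in> pro_p G q" if "a \<in> pro_p G q" for a
    using that subgroup.m_inv_closed[OF *] quotient_inv by (fastforce simp: pro_p_def)
  show "a \<otimes> b \<in> pro_p G q" if "a \<in> pro_p G q" "b \<in> pro_p G q" for a b
    using that subgroup.m_closed[OF *] quotient_mult[symmetric] by (auto simp: pro_p_def)
qed

lemma pro_p'_subgroup: "subgroup (pro_p' G q) G"
proof (rule subgroupI)
  show "pro_p' G q \<subseteq> carrier G" by (auto simp: pro_p'_def)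
  have "\<one> \<in> pro_p' G q"
    using quotient_one[of _ \<one>] subgroup.one_closed[OF open_normal_subgroup] group.one_p'_elements[OF quotient_group]
    by (auto simp: pro_p'_def)
  then show "pro_p' G q \<noteq> {}" by blast
  show "inv a \<in> pro_p' G q" if "a \<in> pro_p' G q" for a
    using that group.inv_p'_elements[OF quotient_group] unfolding pro_p'_def
    by (auto simp: quotient_inv[symmetric])
  show "a \<otimes> b \<in> pro_p' G q" if "a \<in> pro_p' G q" "b \<in> pro_p' G q" for a b
  proof -
    have "N #> (a \<otimes> b) \<in> p'_elements (G Mod N) q" if N: "open_normal G N" for N
      using group.p'_elements_mult[OF quotient_group[OF N] quotient_finite[OF N] quotient_width[OF N w] q,
         of "N #> a" "N #> b"] \<open>a \<in> pro_p' G q\<close> \<open>b \<in> pro_p' G q\<close> N quotient_mult[OF N, of a b]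
      by (auto simp: pro_p'_def)
    then show ?thesis using that by (auto simp: pro_p'_def)
  qed
qed

lemma pro_p_central:
  assumes "y \<in> pro_p G q" "g \<in> carrier G"
  shows "y \<otimes> g = g \<otimes> y"
proof -
  have y: "y \<in> carrier G" using assms by (simp add: pro_p_def)
  have "inv (g \<otimes> y) \<otimes> (y \<otimes> g) = \<one>"
  proof (rule open_normal_trivial)
    fix N assume N: "open_normal G N"
    have "N #> (y \<otimes> g) = N #> (g \<otimes> y)"
      using group.p_elements_central[OF quotient_group[OF N] quotient_finite[OF N] quotient_width[OF N w] q,
         of "N #> y" "N #> g"] assms quotient_carrier[OF N assms(2)] N y
        quotient_mult[OF N y assms(2)] quotient_mult[OF N assms(2) y]
      by (auto simp: pro_p_def)
    then show "inv (g \<otimes> y) \<otimes> (y \<otimes> g) \<in> N" using quotient_eq[OF N, of "g \<otimes> y" "y \<otimes> g"] y assms(2) by simp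
  qed (use y assms in simp)
  then show ?thesis using y assms(2) by (metis inv_closed inv_equality inv_inv m_closed)
qed

text \<open>If \<open>h\<close> and \<open>k\<close> witness that neither inclusion holds, one open
  normal subgroup keeps \<open>h\<close> away from \<open>K\<close> and \<open>k\<close> away from
  \<open>H\<close>. Modulo it one of the two images is a power of the other, a
  contradiction.\<close>

lemma pro_p_subgroups_comparable:
  assumes H: "closed_subgroup G H" "H \<subseteq> pro_p G q" and K: "closed_subgroup G K" "K \<subseteq> pro_p G q"
  shows "H \<subseteq> K \<or> K \<subseteq> H"
proof (rule ccontr)
  assume "\<not> ?thesis"
  then obtain h k where hk: "h \<in> H" "h \<notin> K" "k \<in> K" "k \<notin> H" by blast
  have hkc: "h \<in> carrier G" "k \<in> carrier G" using hk H(2) K(2) by (auto simp: pro_p_def)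
  obtain N where N: "open_normal G N" "\<And>x. x \<in> K \<Longrightarrow> inv h \<otimes> x \<notin> N"
    using open_normal_separation[of K h] K(1) hk hkc by (auto simp: closed_subgroup_def)
  obtain M where M: "open_normal G M" "\<And>x. x \<in> H \<Longrightarrow> inv k \<otimes> x \<notin> M"
    using open_normal_separation[of H k] H(1) hk hkc by (auto simp: closed_subgroup_def)
  define O' where "O' = N \<inter> M"
  have O': "open_normal G O'" unfolding O'_def using N M open_normal_Int by blast
  have "\<not> O' #> h \<in> generate (G Mod O') {O' #> k}"
  proof
    assume "O' #> h \<in> generate (G Mod O') {O' #> k}"
    then obtain i :: int where "O' #> h = (O' #> k) [^]\<^bsub>G Mod O'\<^esub> i"
      using group.generate_pow[OF quotient_group[OF O'] quotient_carrier[OF O' hkc(2)]] by auto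
    then have "inv h \<otimes> k [^] i \<in> O'"
      using quotient_int_pow[OF O' hkc(2)] quotient_eq[OF O' hkc(1), of "k [^] i"] hkc by simp
    moreover have "k [^] i \<in> K" using hk K(1) subgroup_int_pow_closed by (auto simp: closed_subgroup_def)
    ultimately show False using N by (auto simp: O'_def)
  qed
  moreover have "\<not> O' #> k \<in> generate (G Mod O') {O' #> h}"
  proof
    assume "O' #> k \<in> generate (G Mod O') {O' #> h}"
    then obtain i :: int where "O' #> k = (O' #> h) [^]\<^bsub>G Mod O'\<^esub> i"
      using group.generate_pow[OF quotient_group[OF O'] quotient_carrier[OF O' hkc(1)]] by auto
    then have "inv k \<otimes> h [^] i \<in> O'"
      using quotient_int_pow[OF O' hkc(1)] quotient_eq[OF O' hkc(2), of "h [^] i"] hkc by simp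
    moreover have "h [^] i \<in> H" using hk H(1) subgroup_int_pow_closed by (auto simp: closed_subgroup_def)
    ultimately show False using M by (auto simp: O'_def)
  qed
  ultimately show False
    using group.p_elements_comparable[OF quotient_group[OF O'] quotient_finite[OF O'] quotient_width[OF O' w] q,
       of "O' #> h" "O' #> k"] hk H(2) K(2) O' by (auto simp: pro_p_def)
qed

end

end


section \<open>Chain factors of the subgroup lattices\<close>

lemma ex_other_element: "\<lbrakk>a \<in> A; A \<noteq> {a}\<rbrakk> \<Longrightarrow> \<exists>x\<in>A. x \<noteq> a"
  by auto

text \<open>Bounds in \<open>M\<close> are the second components of bounds in the slice over
  \<open>c\<close>. Reusing \<open>fst s\<close> as first component of the competitor avoids having
  to identify it with \<open>c\<close>.\<close>

lemma lattice_prod_factor: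
  assumes P: "lattice (prod_gorder C M)" and C: "partial_order C" and M: "partial_order M" and c: "c \<in> carrier C"
  shows "lattice M"
proof -
  interpret P: lattice "prod_gorder C M" by fact
  interpret C: partial_order C by fact
  interpret M: partial_order M by fact
  show ?thesis
  proof unfold_locales
    fix x y assume xy: "x \<in> carrier M" "y \<in> carrier M"
    have car: "(c, x) \<in> carrier (prod_gorder C M)" "(c, y) \<in> carrier (prod_gorder C M)"
      using xy c by (auto simp: prod_gorder_def)
    obtain s where s: "least (prod_gorder C M) s (Upper (prod_gorder C M) {(c, x), (c, y)})"
      using P.sup_of_two_exists[OF car] by blast
    show "\<exists>s. least M s (Upper M {x, y})"
    proof (intro exI[of _ "snd s"])
      have sc: "fst s \<in> carrier C" "snd s \<in> carrier M" "c \<sqsubseteq>\<^bsub>C\<^esub> fst s" "x \<sqsubseteq>\<^bsub>M\<^esub> snd s" "y \<sqsubseteq>\<^bsub>M\<^esub> snd s"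
        using s car by (auto simp: least_def Upper_def prod_gorder_def)
      have "snd s \<sqsubseteq>\<^bsub>M\<^esub> u" if "u \<in> carrier M" "x \<sqsubseteq>\<^bsub>M\<^esub> u" "y \<sqsubseteq>\<^bsub>M\<^esub> u" for u
      proof -
        have "(fst s, u) \<in> Upper (prod_gorder C M) {(c, x), (c, y)}"
          using that sc by (auto simp: Upper_def prod_gorder_def)
        then show ?thesis using s by (auto simp: least_def prod_gorder_def)
      qed
      then show "least M (snd s) (Upper M {x, y})" using sc xy by (auto simp: least_def Upper_def)
    qed
    obtain s where s: "greatest (prod_gorder C M) s (Lower (prod_gorder C M) {(c, x), (c, y)})"
      using P.inf_of_two_exists[OF car] by blast
    show "\<exists>s. greatest M s (Lower M {x, y})"
    proof (intro exI[of _ "snd s"])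
      have sc: "fst s \<in> carrier C" "snd s \<in> carrier M" "fst s \<sqsubseteq>\<^bsub>C\<^esub> c" "snd s \<sqsubseteq>\<^bsub>M\<^esub> x" "snd s \<sqsubseteq>\<^bsub>M\<^esub> y"
        using s car by (auto simp: greatest_def Lower_def prod_gorder_def)
      have "u \<sqsubseteq>\<^bsub>M\<^esub> snd s" if "u \<in> carrier M" "u \<sqsubseteq>\<^bsub>M\<^esub> x" "u \<sqsubseteq>\<^bsub>M\<^esub> y" for u
      proof -
        have "(fst s, u) \<in> Lower (prod_gorder C M) {(c, x), (c, y)}"
          using that sc by (auto simp: Lower_def prod_gorder_def)
        then show ?thesis using s by (auto simp: greatest_def prod_gorder_def)
      qed
      then show "greatest M (snd s) (Lower M {x, y})" using sc xy by (auto simp: greatest_def Lower_def)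
    qed
  qed
qed

text \<open>A common form of both subgroup lattices, so that width and chain factor arguments are
  given once.\<close>

definition inclusion_order :: "'a set set \<Rightarrow> 'a set gorder" where
  "inclusion_order \<C> = \<lparr>carrier = \<C>, eq = (=), le = (\<subseteq>)\<rparr>"

lemma partial_order_inclusion_order: "partial_order (inclusion_order \<C>)"
  by (rule partial_order_eqI) (auto simp: inclusion_order_def)

lemma closed_subgroup_lattice_eq:
  "closed_subgroup_lattice G = inclusion_order (Collect (closed_subgroup G))"
  by (auto simp: closed_subgroup_lattice_def inclusion_order_def closed_subgroup_def)

lemma open_subgroup_lattice_eq:
  "open_subgroup_lattice G = inclusion_order {H. subgroup H G \<and> openin (grp_topology G) H}"
  by (auto simp: open_subgroup_lattice_def inclusion_order_def)

text \<open>The map sending \<open>H\<close> to its traces on \<open>Q\<close> and \<open>R\<close>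
  is the isomorphism with the product: \<open>split\<close> says that it reflects the order and
  \<open>glue\<close> that every pair of traces is attained. The traces on \<open>Q\<close> form the
  chain.\<close>

lemma chain_factorI:
  fixes \<C> :: "'a set set" and L :: "'l gorder"
  assumes iso: "lattice_isomorphic (inclusion_order \<C>) L"
    and chain: "\<And>H K. \<lbrakk>H \<in> \<C>; K \<in> \<C>\<rbrakk> \<Longrightarrow> H \<inter> Q \<subseteq> K \<inter> Q \<or> K \<inter> Q \<subseteq> H \<inter> Q"
    and nontrivial: "H0 \<in> \<C>" "K0 \<in> \<C>" "H0 \<inter> Q \<noteq> K0 \<inter> Q"
    and split: "\<And>H K. \<lbrakk>H \<in> \<C>; K \<in> \<C>; H \<inter> Q \<subseteq> K \<inter> Q; H \<inter> R \<subseteq> K \<inter> R\<rbrakk> \<Longrightarrow> H \<subseteq> K"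
    and glue: "\<And>H K. \<lbrakk>H \<in> \<C>; K \<in> \<C>\<rbrakk> \<Longrightarrow> \<exists>J\<in>\<C>. J \<inter> Q = H \<inter> Q \<and> J \<inter> R = K \<inter> R"
  shows "has_nontrivial_chain_factor L"
proof -
  let ?A = "inclusion_order \<C>"
  let ?C = "inclusion_order ((\<lambda>H. H \<inter> Q) ` \<C>)"
  let ?M = "inclusion_order ((\<lambda>H. H \<inter> R) ` \<C>)"
  obtain g where g: "bij_betw g (carrier ?A) (carrier L)" "lattice ?A" "lattice L"
    and gle: "\<And>x y. x \<in> carrier ?A \<Longrightarrow> y \<in> carrier ?A \<Longrightarrow> g x \<sqsubseteq>\<^bsub>L\<^esub> g y \<longleftrightarrow> x \<sqsubseteq>\<^bsub>?A\<^esub> y"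
    using lattice_isomorphic_order_iso[OF iso] by metis
  define f where "f H = (H \<inter> Q, H \<inter> R)" for H
  have f: "bij_betw f (carrier ?A) (carrier (prod_gorder ?C ?M))"
    unfolding bij_betw_def
  proof
    show "inj_on f (carrier ?A)"
    proof (rule inj_onI)
      fix H K assume "H \<in> carrier ?A" "K \<in> carrier ?A" "f H = f K"
      then show "H = K" using split[of H K] split[of K H] by (simp add: inclusion_order_def f_def)
    qed
    show "f ` carrier ?A = carrier (prod_gorder ?C ?M)"
    proof
      show "carrier (prod_gorder ?C ?M) \<subseteq> f ` carrier ?A"
      proof
        fix p assume "p \<in> carrier (prod_gorder ?C ?M)"
        then obtain H K where HK: "H \<in> \<C>" "K \<in> \<C>" "p = (H \<inter> Q, K \<inter> R)"
          by (auto simp: prod_gorder_def inclusion_order_def)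
        from glue[OF HK(1,2)] obtain J where J: "J \<in> \<C>" "J \<inter> Q = H \<inter> Q" "J \<inter> R = K \<inter> R" by auto
        then show "p \<in> f ` carrier ?A"
          using HK J by (intro image_eqI[of _ _ J]) (simp_all add: f_def inclusion_order_def)
      qed
    qed (auto simp: f_def prod_gorder_def inclusion_order_def)
  qed
  have fle: "f x \<sqsubseteq>\<^bsub>prod_gorder ?C ?M\<^esub> f y \<longleftrightarrow> x \<sqsubseteq>\<^bsub>?A\<^esub> y" if "x \<in> carrier ?A" "y \<in> carrier ?A" for x y
  proof
    assume "f x \<sqsubseteq>\<^bsub>prod_gorder ?C ?M\<^esub> f y"
    then show "x \<sqsubseteq>\<^bsub>?A\<^esub> y" using split[of x y] that by (simp add: f_def prod_gorder_def inclusion_order_def)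
  next
    assume "x \<sqsubseteq>\<^bsub>?A\<^esub> y"
    then show "f x \<sqsubseteq>\<^bsub>prod_gorder ?C ?M\<^esub> f y" by (auto simp: f_def prod_gorder_def inclusion_order_def)
  qed
  have po: "partial_order (prod_gorder ?C ?M)"
    by (intro partial_order_prod_gorder partial_order_inclusion_order)
  have latP: "lattice (prod_gorder ?C ?M)"
    using order_iso_imp_lattice(1)[OF g(2) po f fle] .
  have latM: "lattice ?M"
    by (rule lattice_prod_factor[OF latP partial_order_inclusion_order partial_order_inclusion_order, of "H0 \<inter> Q"])
      (use nontrivial in \<open>auto simp: inclusion_order_def\<close>)
  define h where "h = the_inv_into (carrier ?A) g"
  have h: "bij_betw h (carrier L) (carrier ?A)"
    unfolding h_def by (rule bij_betw_the_inv_into[OF g(1)])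
  have gh: "g (h x) = x" "h x \<in> carrier ?A" if "x \<in> carrier L" for x
  proof -
    show "g (h x) = x" unfolding h_def using f_the_inv_into_f_bij_betw[OF g(1), of x] that by auto
    show "h x \<in> carrier ?A" using h that by (auto simp: bij_betw_def)
  qed
  have "lattice_isomorphic L (prod_gorder ?C ?M)"
  proof (rule order_iso_imp_lattice(2)[OF g(3) po bij_betw_trans[OF h f]])
    fix x y assume xy: "x \<in> carrier L" "y \<in> carrier L"
    show "(f \<circ> h) x \<sqsubseteq>\<^bsub>prod_gorder ?C ?M\<^esub> (f \<circ> h) y \<longleftrightarrow> x \<sqsubseteq>\<^bsub>L\<^esub> y"
      using fle[OF gh(2)[OF xy(1)] gh(2)[OF xy(2)]] gle[OF gh(2)[OF xy(1)] gh(2)[OF xy(2)]] gh xy by simp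
  qed
  moreover have "carrier L \<noteq> {}"
    using g(1) nontrivial(1) by (auto simp: bij_betw_def inclusion_order_def)
  moreover have "total_order ?C"
    by (rule partial_order.total_orderI[OF partial_order_inclusion_order])
      (use chain in \<open>auto simp: inclusion_order_def\<close>)
  moreover have "\<exists>x\<in>carrier ?C. \<exists>y\<in>carrier ?C. x \<noteq> y"
    using nontrivial by (auto simp: inclusion_order_def)
  ultimately show ?thesis using has_nontrivial_chain_factorI latM by blast
qed

lemma width_of_isomorphic:
  assumes iso: "lattice_isomorphic (inclusion_order \<C>) L" and w: "has_width L w"
  shows "width_at_most \<C> w"
  unfolding width_at_most_def
proof (intro allI impI)
  fix F assume F: "finite F" "F \<subseteq> \<C>" "\<forall>H\<in>F. \<forall>K\<in>F. H \<subseteq> K \<longrightarrow> H = K"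
  let ?A = "inclusion_order \<C>"
  obtain g where g: "bij_betw g (carrier ?A) (carrier L)"
    and gle: "\<And>x y. x \<in> carrier ?A \<Longrightarrow> y \<in> carrier ?A \<Longrightarrow> g x \<sqsubseteq>\<^bsub>L\<^esub> g y \<longleftrightarrow> x \<sqsubseteq>\<^bsub>?A\<^esub> y"
    using lattice_isomorphic_order_iso[OF iso] by metis
  have car: "carrier ?A = \<C>" by (simp add: inclusion_order_def)
  have inj: "inj_on g F" using g F(2) by (auto simp: bij_betw_def car intro: inj_on_subset)
  have "antichain L (g ` F)"
    unfolding antichain_def
  proof (intro conjI ballI impI)
    show "g ` F \<subseteq> carrier L" using g F(2) by (auto simp: bij_betw_def car)
    fix x y assume "x \<in> g ` F" "y \<in> g ` F" "x \<noteq> y"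
    then obtain H K where HK: "H \<in> F" "K \<in> F" "x = g H" "y = g K" "H \<noteq> K" by auto
    then show "\<not> x \<sqsubseteq>\<^bsub>L\<^esub> y" using gle[of H K] F by (auto simp: inclusion_order_def)
  qed
  then have "card (g ` F) \<le> w" using w by (simp add: has_width_def)
  then show "card F \<le> w" using inj by (simp add: card_image)
qed

lemma (in group) commuting_product_subgroup:
  assumes A: "subgroup A G" and B: "subgroup B G" and com: "\<And>a b. \<lbrakk>a \<in> A; b \<in> B\<rbrakk> \<Longrightarrow> a \<otimes> b = b \<otimes> a"
  shows "subgroup (A <#> B) G"
proof -
  interpret A: subgroup A G by fact
  interpret B: subgroup B G by fact
  have I: "a \<otimes> b \<in> A <#> B" if "a \<in> A" "b \<in> B" for a b
    using that unfolding set_mult_def by blast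
  have E: "\<exists>a\<in>A. \<exists>b\<in>B. y = a \<otimes> b" if "y \<in> A <#> B" for y
    using that unfolding set_mult_def by blast
  show ?thesis
  proof (rule subgroupI)
    show "A <#> B \<subseteq> carrier G" using E A.mem_carrier B.mem_carrier by blast
    show "A <#> B \<noteq> {}" using I[OF A.one_closed B.one_closed] by blast
    show "inv y \<in> A <#> B" if y: "y \<in> A <#> B" for y
    proof -
      obtain a b where ab: "a \<in> A" "b \<in> B" "y = a \<otimes> b" using E[OF y] by blast
      then have "inv y = inv a \<otimes> inv b"
        using com[OF ab(1,2)] A.mem_carrier[OF ab(1)] B.mem_carrier[OF ab(2)] by (metis inv_mult_group)
      then show ?thesis using I[OF A.m_inv_closed[OF ab(1)] B.m_inv_closed[OF ab(2)]] by simp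
    qed
    show "y \<otimes> y' \<in> A <#> B" if y: "y \<in> A <#> B" and y': "y' \<in> A <#> B" for y y'
    proof -
      obtain a b where ab: "a \<in> A" "b \<in> B" "y = a \<otimes> b" using E[OF y] by blast
      obtain c d where cd: "c \<in> A" "d \<in> B" "y' = c \<otimes> d" using E[OF y'] by blast
      note car = A.mem_carrier[OF ab(1)] B.mem_carrier[OF ab(2)] A.mem_carrier[OF cd(1)] B.mem_carrier[OF cd(2)]
      have "y \<otimes> y' = a \<otimes> (b \<otimes> c) \<otimes> d" using ab cd car by (simp add: m_assoc)
      also have "\<dots> = a \<otimes> (c \<otimes> b) \<otimes> d" using com[OF cd(1) ab(2)] by simp
      also have "\<dots> = (a \<otimes> c) \<otimes> (b \<otimes> d)" using car by (simp add: m_assoc)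
      finally show ?thesis using I[OF A.m_closed[OF ab(1) cd(1)] B.m_closed[OF ab(2) cd(2)]] by simp
    qed
  qed
qed

context profinite_group
begin

lemma closed_subgroup_mem: "\<lbrakk>closed_subgroup G H; h \<in> H\<rbrakk> \<Longrightarrow> h \<in> carrier G"
  using subgroup.mem_carrier unfolding closed_subgroup_def by metis

lemma compact_set_mult_closed:
  assumes "closedin T A" "closedin T B"
  shows "closedin T (A <#> B)"
proof -
  have AB: "A \<subseteq> carrier G" "B \<subseteq> carrier G" using assms closedin_subset by force+
  have "compactin (prod_topology T T) (A \<times> B)"
    using closedin_compact_space[OF compact] assms by (simp add: compactin_Times)
  then have "compactin T ((\<lambda>(x, y). x \<otimes> y) ` (A \<times> B))"
    using image_compactin continuous_mult by blast
  moreover have "(\<lambda>(x, y). x \<otimes> y) ` (A \<times> B) = A <#> B"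
    by (auto simp: set_mult_def)
  ultimately show ?thesis using compactin_imp_closedin[OF Hausdorff] by simp
qed

text \<open>Incomparable closed subgroups stay incomparable after multiplication by a small open normal
  subgroup, so open antichains are at least as long as closed ones.\<close>

lemma width_closed_of_width_open:
  assumes w: "width_at_most {H. subgroup H G \<and> openin T H} w"
  shows "width_at_most (Collect (closed_subgroup G)) w"
  unfolding width_at_most_def
proof (intro allI impI)
  fix F assume F: "finite F" "F \<subseteq> Collect (closed_subgroup G)" "\<forall>H\<in>F. \<forall>K\<in>F. H \<subseteq> K \<longrightarrow> H = K"
  \<comment> \<open>\<open>S N H K\<close> says that \<open>N\<close> certifies a failing inclusion:
    \<open>H\<close> is not even contained in the union of the \<open>N\<close>-cosets meeting
    \<open>K\<close>.\<close>
  define S where "S N H K \<longleftrightarrow> open_normal G N \<and> (\<not> H \<subseteq> K \<longrightarrow> \<not> H \<subseteq> {x \<in> carrier G. N #> x \<in> (\<lambda>k. N #> k) ` K})"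
    for N H K
  have ex: "\<exists>N. S N H K"
    if HK: "H \<in> F" "K \<in> F" for H K
  proof (cases "H \<subseteq> K")
    case True
    then show ?thesis using open_normal_carrier unfolding S_def by blast
  next
    case False
    then obtain h where h: "h \<in> H" "h \<notin> K" by blast
    have hc: "h \<in> carrier G" using h F(2) HK closed_subgroup_mem by blast
    have K: "closedin T K" "K \<subseteq> carrier G" using F(2) HK closed_subgroup_mem[of K] by (auto simp: closed_subgroup_def)
    obtain N where N: "open_normal G N" "\<And>x. x \<in> K \<Longrightarrow> inv h \<otimes> x \<notin> N"
      using open_normal_separation[OF K(1) hc h(2)] by blast
    have "N #> h \<noteq> N #> k" if "k \<in> K" for k
      using quotient_eq[OF N(1) hc, of k] N(2)[OF that] that K(2) by auto
    then show ?thesis using N(1) h unfolding S_def by blast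
  qed
  define N where "N H K = (SOME N. S N H K)" for H K
  have N: "open_normal G (N H K) \<and>
      (\<not> H \<subseteq> K \<longrightarrow> \<not> H \<subseteq> {x \<in> carrier G. N H K #> x \<in> (\<lambda>k. N H K #> k) ` K})"
    if "H \<in> F" "K \<in> F" for H K
    using someI_ex[OF ex[OF that]] unfolding N_def S_def .
  have "\<exists>M. open_normal G M \<and> (\<forall>U\<in>(\<lambda>(H, K). N H K) ` (F \<times> F). M \<subseteq> U)"
    by (rule open_normal_finite_Inter) (use F(1) N in auto)
  then obtain M where M: "open_normal G M" "\<forall>U\<in>(\<lambda>(H, K). N H K) ` (F \<times> F). M \<subseteq> U" by blast
  define p where "p H = {x \<in> carrier G. M #> x \<in> (\<lambda>k. M #> k) ` H}" for H
  have Hp: "H \<subseteq> p H" if "H \<in> F" for H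
    using that F(2) closed_subgroup_mem unfolding p_def by blast
  have key: "H \<subseteq> K" if HK: "H \<in> F" "K \<in> F" "p H \<subseteq> p K" for H K
  proof (rule ccontr)
    assume "\<not> H \<subseteq> K"
    then obtain h where h: "h \<in> H" "h \<in> carrier G" "N H K #> h \<notin> (\<lambda>k. N H K #> k) ` K"
      using N[OF HK(1,2)] F(2) HK(1) closed_subgroup_mem by blast
    have "h \<in> p K" using h Hp[OF HK(1)] HK(3) by blast
    then obtain k where k: "k \<in> K" "M #> h = M #> k" by (auto simp: p_def)
    have "k \<in> carrier G" using k F(2) HK(2) closed_subgroup_mem by blast
    then have "N H K #> h = N H K #> k"
      using quotient_subset[of "N H K" M h k] N[OF HK(1,2)] M HK h k by auto
    then show False using h k by blast
  qed
  have "card (p ` F) \<le> w"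
  proof (rule w[unfolded width_at_most_def, rule_format])
    show "p ` F \<subseteq> {H. subgroup H G \<and> openin T H}"
    proof clarify
      fix H assume "H \<in> F"
      then have H: "subgroup H G" using F(2) by (auto simp: closed_subgroup_def)
      have "subgroup (p H) G"
      proof (rule subgroupI)
        show "p H \<noteq> {}" using Hp[OF \<open>H \<in> F\<close>] subgroup.one_closed[OF H] by blast
        show "inv a \<in> p H" if a: "a \<in> p H" for a
        proof -
          obtain k where k: "a \<in> carrier G" "k \<in> H" "M #> a = M #> k" using a by (auto simp: p_def)
          then have "M #> inv a = M #> inv k"
            using quotient_inv[OF M(1), of a] quotient_inv[OF M(1), of k] subgroup.mem_carrier[OF H] by simp
          then show ?thesis using k subgroup.m_inv_closed[OF H] by (auto simp: p_def)
        qed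
        show "a \<otimes> b \<in> p H" if a: "a \<in> p H" and b: "b \<in> p H" for a b
        proof -
          obtain k where k: "a \<in> carrier G" "k \<in> H" "M #> a = M #> k" using a by (auto simp: p_def)
          obtain l where l: "b \<in> carrier G" "l \<in> H" "M #> b = M #> l" using b by (auto simp: p_def)
          have "M #> (a \<otimes> b) = M #> (k \<otimes> l)"
            using quotient_mult[OF M(1), of a b] quotient_mult[OF M(1), of k l] k l subgroup.mem_carrier[OF H] by simp
          then show ?thesis using k l subgroup.m_closed[OF H] by (auto simp: p_def)
        qed
      qed (auto simp: p_def)
      moreover have "openin T (p H)" unfolding p_def by (rule openin_coset_pred[OF M(1)])
      ultimately show "subgroup (p H) G \<and> openin T (p H)" by simp
    qed
    show "A = B" if AB: "A \<in> p ` F" "B \<in> p ` F" "A \<subseteq> B" for A B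
    proof -
      obtain H K where "H \<in> F" "K \<in> F" "A = p H" "B = p K" using AB by auto
      then show "A = B" using key[of H K] F(3) AB(3) by auto
    qed
  qed (use F(1) in simp)
  moreover have "inj_on p F"
  proof (rule inj_onI)
    fix H K assume "H \<in> F" "K \<in> F" "p H = p K"
    then show "H = K" using key[of H K] key[of K H] by simp
  qed
  ultimately show "card F \<le> w" by (simp add: card_image)
qed

text \<open>A closed subgroup contains the pro-q and the pro-q' part of each of its elements, so its
  traces on \<open>?Q\<close> and \<open>?R\<close> determine it. Conversely \<open>?Q\<close> is
  central and meets \<open>?R\<close> trivially, so the product of two traces is a subgroup with
  exactly these traces.\<close>

lemma pro_p_chain_factor:
  assumes w: "width_at_most (Collect (closed_subgroup G)) w" and q: "prime q" "w < q"
    and nt: "pro_p G q \<noteq> {\<one>}"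
    and iso: "lattice_isomorphic (closed_subgroup_lattice G) L \<or> lattice_isomorphic (open_subgroup_lattice G) L"
  shows "has_nontrivial_chain_factor L"
proof -
  let ?Q = "pro_p G q" and ?R = "pro_p' G q"
  let ?O = "{H. subgroup H G \<and> openin T H}" and ?K = "Collect (closed_subgroup G)"
  have Q: "subgroup ?Q G" using pro_p_subgroup[OF w q] .
  have R: "subgroup ?R G" using pro_p'_subgroup[OF w q] .
  interpret Q: subgroup ?Q G by fact
  interpret R: subgroup ?R G by fact
  have OK: "?O \<subseteq> ?K" using closedin_open_subgroup by (auto simp: closed_subgroup_def)
  have cQ: "closed_subgroup G (H \<inter> ?Q)" "closed_subgroup G (H \<inter> ?R)" if "H \<in> ?K" for H
    using that Q R subgroups_Inter_pair closedin_pro_p closedin_pro_p' by (auto simp: closed_subgroup_def)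
  have chain: "H \<inter> ?Q \<subseteq> K \<inter> ?Q \<or> K \<inter> ?Q \<subseteq> H \<inter> ?Q" if "H \<in> ?K" "K \<in> ?K" for H K
    using pro_p_subgroups_comparable[OF w q cQ(1)[OF that(1)] _ cQ(1)[OF that(2)]] by blast
  obtain y where y: "y \<in> ?Q" "y \<noteq> \<one>" using ex_other_element[OF Q.one_closed nt] by metis
  then obtain N where N: "open_normal G N" "y \<notin> N" using open_normal_trivial[OF Q.mem_carrier] by metis
  have N': "N \<in> ?O" using N open_normal_subgroup by (auto simp: open_normal_def)
  have G': "carrier G \<in> ?O" using subgroup_self openin_topspace[of T] by auto
  \<comment> \<open>\<open>N\<close> omits the element \<open>y\<close> of \<open>?Q\<close> while
    the whole group contains it: these are the two members needed for a non-trivial chain.\<close>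
  have nt': "N \<inter> ?Q \<noteq> carrier G \<inter> ?Q" using y N Q.subset by blast
  have split: "H \<subseteq> K" if HK: "H \<in> ?K" "K \<in> ?K" "H \<inter> ?Q \<subseteq> K \<inter> ?Q" "H \<inter> ?R \<subseteq> K \<inter> ?R" for H K
  proof
    fix h assume h: "h \<in> H"
    interpret H: subgroup H G using HK(1) by (simp add: closed_subgroup_def)
    interpret K: subgroup K G using HK(2) by (simp add: closed_subgroup_def)
    obtain y where y: "y \<in> procyclic G h" "y \<in> ?Q" "inv y \<otimes> h \<in> ?R"
      using pro_p_decomposition[OF _ q(1), of h] h by auto
    have "y \<in> H" using procyclic_minimal[of H h] HK(1) h y(1) by auto
    then have "y \<in> K" "inv y \<otimes> h \<in> K" using HK(3,4) y h by auto
    then have "y \<otimes> (inv y \<otimes> h) \<in> K" by simp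
    then show "h \<in> K" using \<open>y \<in> H\<close> h by simp
  qed
  define J where "J H K = (H \<inter> ?Q) <#> (K \<inter> ?R)" for H K
  have J: "subgroup (J H K) G \<and> J H K \<inter> ?Q = H \<inter> ?Q \<and> J H K \<inter> ?R = K \<inter> ?R"
    if HK: "H \<in> ?K" "K \<in> ?K" for H K
  proof (intro conjI)
    interpret H: subgroup "H \<inter> ?Q" G using cQ(1)[OF HK(1)] by (simp add: closed_subgroup_def)
    interpret K: subgroup "K \<inter> ?R" G using cQ(2)[OF HK(2)] by (simp add: closed_subgroup_def)
    have com: "a \<otimes> b = b \<otimes> a" if "a \<in> H \<inter> ?Q" "b \<in> carrier G" for a b
      using pro_p_central[OF w q] that by blast
    have JI: "a \<otimes> b \<in> J H K" if "a \<in> H \<inter> ?Q" "b \<in> K \<inter> ?R" for a b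
      using that unfolding J_def set_mult_def by blast
    have JE: "\<exists>a\<in>H \<inter> ?Q. \<exists>b\<in>K \<inter> ?R. x = a \<otimes> b" if "x \<in> J H K" for x
      using that unfolding J_def set_mult_def by blast
    show "subgroup (J H K) G" unfolding J_def
      by (rule commuting_product_subgroup[OF H.subgroup_axioms K.subgroup_axioms com[OF _ K.mem_carrier]])
    have sub1: "H \<inter> ?Q \<subseteq> J H K"
    proof
      fix a assume a: "a \<in> H \<inter> ?Q"
      then show "a \<in> J H K" using JI[OF a K.one_closed] H.mem_carrier[OF a] by simp
    qed
    have sub2: "K \<inter> ?R \<subseteq> J H K"
    proof
      fix a assume a: "a \<in> K \<inter> ?R"
      then show "a \<in> J H K" using JI[OF H.one_closed a] K.mem_carrier[OF a] by simp
    qed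
    show "J H K \<inter> ?Q = H \<inter> ?Q"
    proof
      show "J H K \<inter> ?Q \<subseteq> H \<inter> ?Q"
      proof
        fix x assume x: "x \<in> J H K \<inter> ?Q"
        then obtain a b where ab: "a \<in> H \<inter> ?Q" "b \<in> K \<inter> ?R" "x = a \<otimes> b" using JE by blast
        note car = H.mem_carrier[OF ab(1)] K.mem_carrier[OF ab(2)]
        have "b = inv a \<otimes> x" using ab car by simp
        then have "b \<in> ?Q" using ab(1) x Q.m_closed[of "inv a" x] Q.m_inv_closed by auto
        then have "b = \<one>" using pro_p_p'_trivial ab(2) by blast
        then show "x \<in> H \<inter> ?Q" using ab car by simp
      qed
    qed (use sub1 in blast)
    show "J H K \<inter> ?R = K \<inter> ?R"
    proof
      show "J H K \<inter> ?R \<subseteq> K \<inter> ?R"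
      proof
        fix x assume x: "x \<in> J H K \<inter> ?R"
        then obtain a b where ab: "a \<in> H \<inter> ?Q" "b \<in> K \<inter> ?R" "x = a \<otimes> b" using JE by blast
        note car = H.mem_carrier[OF ab(1)] K.mem_carrier[OF ab(2)]
        have "a = x \<otimes> inv b" using ab car by (simp add: m_assoc)
        then have "a \<in> ?R" using ab(2) x R.m_closed[of x "inv b"] R.m_inv_closed by auto
        then have "a = \<one>" using pro_p_p'_trivial ab(1) by blast
        then show "x \<in> K \<inter> ?R" using ab car by simp
      qed
    qed (use sub2 in blast)
  qed
  show ?thesis using iso
  proof
    assume "lattice_isomorphic (closed_subgroup_lattice G) L"
    then have "lattice_isomorphic (inclusion_order ?K) L" by (simp add: closed_subgroup_lattice_eq)
    then show ?thesis
    proof (rule chain_factorI[OF _ chain _ _ nt' split])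
      show "\<exists>M\<in>?K. M \<inter> ?Q = H \<inter> ?Q \<and> M \<inter> ?R = K \<inter> ?R" if HK: "H \<in> ?K" "K \<in> ?K" for H K
      proof (intro bexI[of _ "J H K"] CollectI)
        have "closedin T (J H K)" unfolding J_def
          using cQ HK by (intro compact_set_mult_closed) (auto simp: closed_subgroup_def)
        then show "closed_subgroup G (J H K)" using J[OF HK] by (simp add: closed_subgroup_def)
      qed (use J[OF HK] in blast)
    qed (use N' G' OK in auto)
  next
    assume "lattice_isomorphic (open_subgroup_lattice G) L"
    then have "lattice_isomorphic (inclusion_order ?O) L" by (simp add: open_subgroup_lattice_eq)
    then show ?thesis
    proof (rule chain_factorI[OF _ _ _ _ nt'])
      show "\<exists>M\<in>?O. M \<inter> ?Q = H \<inter> ?Q \<and> M \<inter> ?R = K \<inter> ?R" if HK: "H \<in> ?O" "K \<in> ?O" for H K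
      proof (intro bexI[of _ "J H K"] CollectI conjI)
        have HK': "H \<in> ?K" "K \<in> ?K" using HK OK by auto
        show sJ: "subgroup (J H K) G" using J[OF HK'] by simp
        have HKi: "H \<inter> K \<in> ?O" using HK subgroups_Inter_pair by auto
        \<comment> \<open>For open \<open>H\<close> and \<open>K\<close> the product is open because
          it contains the open subgroup \<open>H \<inter> K\<close>, as a comparison of traces
          shows.\<close>
        have sub: "H \<inter> K \<subseteq> J H K"
        proof (rule split)
          show "H \<inter> K \<in> ?K" using HKi OK by auto
          have "closedin T (J H K)" unfolding J_def
            using cQ HK' by (intro compact_set_mult_closed) (auto simp: closed_subgroup_def)
          then show "J H K \<in> ?K" using sJ by (simp add: closed_subgroup_def)
        qed (use J[OF HK'] in blast)+
        show "openin T (J H K)" using openin_subgroup_superset[OF sJ _ _ sub] HKi by blast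
      qed (use J HK OK in blast)+
      show "H \<inter> ?Q \<subseteq> K \<inter> ?Q \<or> K \<inter> ?Q \<subseteq> H \<inter> ?Q" if "H \<in> ?O" "K \<in> ?O" for H K
        using chain[of H K] that OK by blast
      show "H \<subseteq> K" if "H \<in> ?O" "K \<in> ?O" "H \<inter> ?Q \<subseteq> K \<inter> ?Q" "H \<inter> ?R \<subseteq> K \<inter> ?R" for H K
        using split[of H K] that OK by blast
    qed (use N' G' in auto)
  qed
qed

end


section \<open>Open procyclic subgroups\<close>

lemma dvd_prod_prime_powers:
  fixes n :: nat
  assumes "n > 0" "finite P" "\<And>p. p \<in> P \<Longrightarrow> prime p"
    "\<And>p. \<lbrakk>prime p; p dvd n\<rbrakk> \<Longrightarrow> p \<in> P \<and> \<not> p ^ e dvd n"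
  shows "n dvd (\<Prod>p\<in>P. p ^ e)"
proof -
  show ?thesis
  proof (rule multiplicity_le_imp_dvd)
    fix p :: nat assume p: "prime p"
    show "multiplicity p n \<le> multiplicity p (\<Prod>p\<in>P. p ^ e)"
    proof (cases "p dvd n")
      case True
      then have pP: "p \<in> P" "\<not> p ^ e dvd n" using assms(4) p by auto
      then have "multiplicity p n < e"
        using assms(1) by (intro multiplicity_lessI) (use p prime_gt_1_nat in force)+
      moreover have "e \<le> multiplicity p (\<Prod>p\<in>P. p ^ e)"
      proof (rule multiplicity_geI)
        show "p ^ e dvd (\<Prod>p\<in>P. p ^ e)" using assms(2) pP by (intro dvd_prodI)
        show "(\<Prod>p\<in>P. p ^ e) \<noteq> 0" using assms(2) assms(3)[of 0] by (auto simp: prod_zero_iff)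
      qed (use p prime_gt_1_nat[OF p] in simp)
      ultimately show ?thesis by simp
    qed (simp add: not_dvd_imp_multiplicity_0)
  qed (use assms(1) in simp)
qed

text \<open>\<open>S\<close> is the set of divisors of a supernatural number, and the claim is that
  this number is \<open>m\<close> times an infinite power of one prime. Its primes form an
  antichain, hence are finitely many, so some \<open>p\<close> has all its powers in
  \<open>S\<close>. A second prime with a large power would give an antichain of products with
  powers of \<open>p\<close>; thus the part prime to \<open>p\<close> is finite.\<close>

lemma divisor_closed_prime_direction:
  fixes S :: "nat set"
  assumes pos: "\<And>n. n \<in> S \<Longrightarrow> n > 0" and inf: "infinite S"
    and dvd: "\<And>n d. \<lbrakk>n \<in> S; d dvd n\<rbrakk> \<Longrightarrow> d \<in> S"
    and lcm: "\<And>m n. \<lbrakk>m \<in> S; n \<in> S\<rbrakk> \<Longrightarrow> lcm m n \<in> S"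
    and anti: "\<And>F. \<lbrakk>finite F; F \<subseteq> S; \<And>a b. \<lbrakk>a \<in> F; b \<in> F; a dvd b\<rbrakk> \<Longrightarrow> a = b\<rbrakk> \<Longrightarrow> card F \<le> w"
  obtains p m where "prime p" "\<And>k. m * p ^ k \<in> S" "\<And>s. s \<in> S \<Longrightarrow> \<exists>k. s dvd m * p ^ k"
proof -
  define P where "P = {p \<in> S. prime p}"
  have finP: "finite P"
  proof (rule ccontr)
    assume "infinite P"
    then obtain F where F: "finite F" "card F = Suc w" "F \<subseteq> P"
      using infinite_arbitrarily_large by blast
    have "card F \<le> w"
    proof (rule anti)
      show "a = b" if "a \<in> F" "b \<in> F" "a dvd b" for a b
        using primes_dvd_imp_eq[of a b] that F(3) by (auto simp: P_def)
    qed (use F in \<open>auto simp: P_def\<close>)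
    then show False using F by simp
  qed
  have "\<exists>p\<in>P. \<forall>k. p ^ k \<in> S"
  proof (rule ccontr)
    assume "\<not> ?thesis"
    then have "\<forall>p\<in>P. \<exists>k. p ^ k \<notin> S" by blast
    then obtain f where f: "\<And>p. p \<in> P \<Longrightarrow> p ^ f p \<notin> S" by metis
    \<comment> \<open>The sum serves as a common upper bound of the missing exponents
      \<open>f p\<close>.\<close>
    define e where "e = (\<Sum>p\<in>P. f p)"
    have e: "\<not> p ^ e dvd n" if "p \<in> P" "n \<in> S" for p n
    proof
      assume "p ^ e dvd n"
      moreover have "f p \<le> e" unfolding e_def using finP that(1) by (intro member_le_sum) auto
      ultimately have "p ^ f p dvd n" using le_imp_power_dvd dvd_trans by blast
      then show False using dvd[OF that(2)] f[OF that(1)] by blast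
    qed
    have "S \<subseteq> {n. n dvd (\<Prod>p\<in>P. p ^ e)}"
    proof clarify
      fix n assume n: "n \<in> S"
      show "n dvd (\<Prod>p\<in>P. p ^ e)"
        by (rule dvd_prod_prime_powers[OF pos[OF n] finP]) (use e n dvd P_def in auto)
    qed
    moreover have "finite {n. n dvd (\<Prod>p\<in>P. p ^ e)}"
      by (rule finite_divisors_nat) (use prime_gt_0_nat in \<open>force simp: P_def intro!: prod_pos\<close>)
    ultimately have "finite S" by (rule finite_subset)
    then show False using inf by blast
  qed
  then obtain p where p: "prime p" "\<And>k. p ^ k \<in> S" by (auto simp: P_def)
  define R where "R = {r \<in> S. coprime r p}"
  have "R \<subseteq> {n. n dvd (\<Prod>p\<in>P. p ^ w)}"
  proof clarify
    fix r assume r: "r \<in> R"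
    show "r dvd (\<Prod>p\<in>P. p ^ w)"
    proof (rule dvd_prod_prime_powers[OF _ finP])
      show "prime p" if "p \<in> P" for p using that by (simp add: P_def)
      show "0 < r" using r pos by (simp add: R_def)
      fix q assume q: "prime q" "q dvd r"
      have qP: "q \<in> P" using q r dvd by (auto simp: P_def R_def)
      have qp: "q \<noteq> p" using q r p(1) unfolding R_def by (auto simp: coprime_commute dest: coprime_common_divisor)
      have "\<not> q ^ w dvd r"
      proof
        assume "q ^ w dvd r"
        then have qS: "q ^ i \<in> S" if "i \<le> w" for i
          using that r dvd le_imp_power_dvd dvd_trans unfolding R_def by blast
        \<comment> \<open>There are \<open>w + 1\<close> of these numbers, and what one gains at
          \<open>q\<close> it loses at \<open>p\<close>, so none divides another.\<close>
        define g where "g i = p ^ (w - i) * q ^ i" for i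
        have cop: "coprime (p ^ a) (q ^ b)" for a b using p(1) q(1) qp by (simp add: primes_coprime)
        have gdvd: "i = j" if "i \<le> w" "j \<le> w" "g i dvd g j" for i j
        proof -
          have "p ^ (w - i) dvd p ^ (w - j) * q ^ j" using that(3) unfolding g_def by (rule dvd_mult_left)
          then have "p ^ (w - i) dvd p ^ (w - j)" using cop coprime_dvd_mult_left_iff by blast
          then have "w - i \<le> w - j" using p(1) prime_gt_1_nat power_dvd_imp_le by blast
          moreover have "q ^ i dvd p ^ (w - j) * q ^ j" using that(3) unfolding g_def by (rule dvd_mult_right)
          then have "q ^ i dvd q ^ j" using cop coprime_dvd_mult_right_iff coprime_commute by metis
          then have "i \<le> j" using q(1) prime_gt_1_nat power_dvd_imp_le by blast
          ultimately show ?thesis using that by simp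
        qed
        have "card (g ` {..w}) \<le> w"
        proof (rule anti)
          show "g ` {..w} \<subseteq> S"
          proof (rule image_subsetI)
            fix i assume "i \<in> {..w}"
            then have "lcm (p ^ (w - i)) (q ^ i) \<in> S" using lcm p(2) qS by auto
            then show "g i \<in> S" using lcm_coprime[OF cop[of "w - i" i]] by (simp add: g_def)
          qed
        qed (use gdvd in auto)
        moreover have "inj_on g {..w}" using gdvd by (auto intro!: inj_onI)
        ultimately show False by (simp add: card_image)
      qed
      then show "q \<in> P \<and> \<not> q ^ w dvd r" using qP by blast
    qed
  qed
  moreover have "finite {n. n dvd (\<Prod>p\<in>P. p ^ w)}"
    by (rule finite_divisors_nat) (use prime_gt_0_nat in \<open>force simp: P_def intro!: prod_pos\<close>)
  ultimately have finR: "finite R" by (rule finite_subset)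
  have "1 \<in> R" using p(2)[of 0] by (simp add: R_def)
  \<comment> \<open>\<open>R\<close> is closed under \<open>lcm\<close>, so its maximum is a
    multiple of all its members.\<close>
  define m where "m = Max R"
  have mR: "m \<in> R" unfolding m_def using finR \<open>1 \<in> R\<close> by (intro Max_in) auto
  have Rm: "r dvd m" if r: "r \<in> R" for r
  proof -
    have "coprime (r * m) p" using r mR by (simp add: R_def)
    then have "coprime (lcm r m) p" by (rule coprime_divisors[rotated 2]) (simp_all add: lcm_least)
    then have "lcm r m \<in> R" using r mR lcm by (simp add: R_def)
    then have "lcm r m \<le> m" unfolding m_def using finR by simp
    moreover have "lcm r m \<ge> m" using \<open>lcm r m \<in> R\<close> pos by (intro dvd_imp_le) (auto simp: R_def)
    ultimately show ?thesis by (metis dvd_lcm1 le_antisym)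
  qed
  show thesis
  proof (rule that[OF p(1)])
    show "m * p ^ k \<in> S" for k
    proof -
      have "lcm m (p ^ k) \<in> S" using lcm mR p(2) by (simp add: R_def)
      moreover have "coprime m (p ^ k)" using mR by (simp add: R_def)
      ultimately show ?thesis by (simp add: lcm_coprime)
    qed
    show "\<exists>k. s dvd m * p ^ k" if s: "s \<in> S" for s
    proof -
      have "s \<noteq> 0" "\<not> is_unit p" using s pos p(1) by (auto dest: not_prime_unit)
      then obtain r where r: "s = p ^ multiplicity p s * r" "\<not> p dvd r"
        using multiplicity_decompose'[of s p] by blast
      then have "r \<in> S" using s dvd by (metis dvd_triv_right)
      moreover have "coprime r p" using r(2) p(1) by (metis coprime_commute prime_imp_coprime_nat)
      ultimately have "r dvd m" using Rm by (simp add: R_def)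
      then show ?thesis using r(1) by (metis dvd_refl mult.commute mult_dvd_mono)
    qed
  qed
qed

text \<open>The closure of the powers of \<open>a\<close> is an open copy of the p-adic integers,
  expressed through exponents: the powers \<open>p ^ k\<close> tend to the identity, and the
  subgroup generated by \<open>a [^] (p ^ k)\<close> has index no smaller than
  \<open>p ^ k\<close>.\<close>

definition padic_generator :: "'a topgroup \<Rightarrow> nat \<Rightarrow> 'a \<Rightarrow> bool" where
  "padic_generator G p a \<longleftrightarrow> prime p \<and> a \<in> carrier G \<and> openin (grp_topology G) (procyclic G a) \<and>
     (\<forall>i::int. \<forall>k::nat. a [^]\<^bsub>G\<^esub> i \<in> procyclic G (a [^]\<^bsub>G\<^esub> (p ^ k)) \<longrightarrow> int (p ^ k) dvd i) \<and>
     (\<forall>N. open_normal G N \<longrightarrow> (\<exists>k::nat. a [^]\<^bsub>G\<^esub> (p ^ k) \<in> N))"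

context profinite_group
begin

text \<open>Membership of \<open>d\<close> in a procyclic subgroup is equivalent to the image of
  \<open>d\<close> being a power of the image of \<open>g\<close> in every finite quotient, and each
  of these conditions is closed in \<open>g\<close>.\<close>

lemma closedin_procyclic_containing:
  assumes "d \<in> carrier G"
  shows "closedin T {g \<in> carrier G. d \<in> procyclic G g}"
proof -
  define S where "S N = {g \<in> carrier G. \<exists>i::int. N #> d = (N #> g) [^]\<^bsub>G Mod N\<^esub> i}" for N
  have "{g \<in> carrier G. d \<in> procyclic G g} = (\<Inter>N\<in>Collect (open_normal G). S N)"
  proof (intro equalityI subsetI)
    fix g assume g: "g \<in> {g \<in> carrier G. d \<in> procyclic G g}"
    have "g \<in> S N" if N: "open_normal G N" for N
    proof -
      have "openin T N" "\<one> \<in> N" using N subgroup.one_closed[OF open_normal_subgroup[OF N]] by (auto simp: open_normal_def)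
      then obtain i :: int where "inv d \<otimes> g [^] i \<in> N" using g procyclic_approx[of g d N] by blast
      then have "N #> d = N #> g [^] i" using g assms quotient_eq[OF N] by simp
      then show ?thesis using g quotient_int_pow[OF N] by (auto simp: S_def)
    qed
    then show "g \<in> (\<Inter>N\<in>Collect (open_normal G). S N)" by blast
  next
    fix g assume g: "g \<in> (\<Inter>N\<in>Collect (open_normal G). S N)"
    then have gc: "g \<in> carrier G" using open_normal_carrier by (auto simp: S_def)
    have "d \<in> procyclic G g"
    proof (rule procyclicI[OF gc assms])
      fix N assume N: "open_normal G N"
      then obtain i :: int where "N #> d = (N #> g) [^]\<^bsub>G Mod N\<^esub> i" using g by (auto simp: S_def)
      then have "N #> d = N #> g [^] i" using quotient_int_pow[OF N gc] by simp
      then have "inv d \<otimes> g [^] i \<in> N" using quotient_eq[OF N assms] gc by simp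
      then show "\<exists>z\<in>procyclic G g. inv d \<otimes> z \<in> N" using procyclic_pow[OF gc] by blast
    qed
    then show "g \<in> {g \<in> carrier G. d \<in> procyclic G g}" using gc by blast
  qed
  moreover have "closedin T (\<Inter>N\<in>Collect (open_normal G). S N)"
    using open_normal_carrier closedin_coset_pred unfolding S_def by (intro closedin_Inter) auto
  ultimately show ?thesis by simp
qed

text \<open>The possible generators above a given \<open>d\<close> form a closed set
  \<open>F d\<close>, and a finite part of the chain is bounded by its largest member. Compactness
  then yields a generator above the whole chain.\<close>

lemma procyclic_chain_upper_bound:
  assumes D: "D \<subseteq> carrier G" and chain: "\<And>x y. \<lbrakk>x \<in> D; y \<in> D\<rbrakk> \<Longrightarrow> procyclic G x \<subseteq> procyclic G y \<or> procyclic G y \<subseteq> procyclic G x"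
  obtains u where "u \<in> carrier G" "\<And>x. x \<in> D \<Longrightarrow> procyclic G x \<subseteq> procyclic G u"
proof -
  define F where "F d = {g \<in> carrier G. d \<in> procyclic G g}" for d
  \<comment> \<open>The bound is kept inside \<open>E\<close>, since the chain hypothesis compares
    members of \<open>D\<close> only.\<close>
  have fin: "\<exists>u\<in>carrier G. \<forall>x\<in>E. x \<in> procyclic G u \<and> (E = {} \<or> u \<in> E)" if "finite E" "E \<subseteq> D" for E
    using that
  proof (induction E)
    case empty
    then show ?case using one_closed by blast
  next
    case (insert x E)
    then obtain u where u: "u \<in> carrier G" "\<forall>x\<in>E. x \<in> procyclic G u \<and> (E = {} \<or> u \<in> E)" by auto
    have x: "x \<in> carrier G" "x \<in> D" using insert D by auto
    show ?case
    proof (cases "E = {}")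
      case True
      then show ?thesis using x procyclic_self[OF x(1)] by auto
    next
      case False
      then have "u \<in> E" using u by blast
      then have "u \<in> D" using insert by blast
      show ?thesis
      proof (cases "procyclic G x \<subseteq> procyclic G u")
        case True
        then show ?thesis using u \<open>u \<in> E\<close> procyclic_self[OF x(1)] by (intro bexI[of _ u]) auto
      next
        case False
        then have "procyclic G u \<subseteq> procyclic G x" using chain[OF x(2) \<open>u \<in> D\<close>] by blast
        then show ?thesis using u x procyclic_self[OF x(1)] by (intro bexI[of _ x]) auto
      qed
    qed
  qed
  \<comment> \<open>Adding \<open>carrier G\<close> keeps the intersection inside the group even for
    empty \<open>D\<close>.\<close>
  have "\<Inter> (insert (carrier G) (F ` D)) \<noteq> {}"
  proof (rule compact[unfolded compact_space_fip, rule_format], intro conjI ballI allI impI)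
    show "closedin T C" if "C \<in> insert (carrier G) (F ` D)" for C
      using that closedin_procyclic_containing D closedin_topspace[of T] by (auto simp: F_def)
    fix \<F> assume \<F>: "finite \<F> \<and> \<F> \<subseteq> insert (carrier G) (F ` D)"
    then have "finite (\<F> - {carrier G})" "\<F> - {carrier G} \<subseteq> F ` D" by auto
    from finite_subset_image[OF this] obtain E where E: "E \<subseteq> D" "finite E" "\<F> - {carrier G} = F ` E" by blast
    from fin[OF E(2,1)] obtain u where u: "u \<in> carrier G" "\<forall>x\<in>E. x \<in> procyclic G u" by blast
    have "u \<in> A" if "A \<in> \<F>" for A
    proof (cases "A = carrier G")
      case False
      then have "A \<in> F ` E" using that E(3) by blast
      then show ?thesis using u by (auto simp: F_def)
    qed (use u in simp)
    then show "\<Inter>\<F> \<noteq> {}" by blast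
  qed
  then obtain u where "u \<in> carrier G" "\<And>x. x \<in> D \<Longrightarrow> x \<in> procyclic G u" by (auto simp: F_def)
  then show thesis using that[of u] procyclic_mono by blast
qed

lemma maximal_procyclic:
  assumes "x \<in> carrier G"
  obtains m where "m \<in> carrier G" "x \<in> procyclic G m"
    "\<And>y. \<lbrakk>y \<in> carrier G; procyclic G m \<subseteq> procyclic G y\<rbrakk> \<Longrightarrow> procyclic G y = procyclic G m"
proof -
  define A where "A = procyclic G ` {h \<in> carrier G. procyclic G x \<subseteq> procyclic G h}"
  have "\<exists>M\<in>A. \<forall>X'\<in>A. M \<subseteq> X' \<longrightarrow> X' = M"
  proof (rule subset_Zorn)
    fix C assume C: "subset.chain A C"
    show "\<exists>U\<in>A. \<forall>X'\<in>C. X' \<subseteq> U"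
    proof (cases "C = {}")
      case True
      then show ?thesis using assms by (auto simp: A_def)
    next
      case False
      define D where "D = {h \<in> carrier G. procyclic G h \<in> C}"
      have D: "\<And>c. c \<in> C \<Longrightarrow> \<exists>h\<in>D. c = procyclic G h \<and> procyclic G x \<subseteq> c"
        using C by (auto simp: D_def A_def subset.chain_def)
      obtain u where u: "u \<in> carrier G" "\<And>x. x \<in> D \<Longrightarrow> procyclic G x \<subseteq> procyclic G u"
      proof (rule procyclic_chain_upper_bound[of D])
        show "procyclic G a \<subseteq> procyclic G b \<or> procyclic G b \<subseteq> procyclic G a" if "a \<in> D" "b \<in> D" for a b
          using that C unfolding D_def subset_chain_def by blast
      qed (auto simp: D_def)
      obtain c where "c \<in> C" using False by blast
      then have "procyclic G x \<subseteq> procyclic G u" using D[of c] u(2) by blast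
      then have "procyclic G u \<in> A" using u(1) by (auto simp: A_def)
      moreover have "\<forall>c\<in>C. c \<subseteq> procyclic G u" using D u(2) by blast
      ultimately show ?thesis by blast
    qed
  qed
  then obtain M where M: "M \<in> A" "\<forall>X'\<in>A. M \<subseteq> X' \<longrightarrow> X' = M" by blast
  then obtain m where m: "m \<in> carrier G" "procyclic G x \<subseteq> procyclic G m" "M = procyclic G m" by (auto simp: A_def)
  show thesis
  proof (rule that[OF m(1)])
    show "x \<in> procyclic G m" using m(2) procyclic_self[OF assms] by blast
    fix y assume y: "y \<in> carrier G" "procyclic G m \<subseteq> procyclic G y"
    then have "procyclic G y \<in> A" using m(2) by (auto simp: A_def)
    then show "procyclic G y = procyclic G m" using M(2) m(3) y(2) by blast
  qed
qed

text \<open>Unless \<open>C\<close> contains \<open>U\<close>, the nonempty open set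
  \<open>U - C\<close> is covered by one closed set fewer.\<close>

lemma finite_closed_cover_interior:
  assumes "finite M" "\<And>C. C \<in> M \<Longrightarrow> closedin T C" "openin T U" "U \<noteq> {}" "U \<subseteq> \<Union>M"
  shows "\<exists>C\<in>M. \<exists>V. openin T V \<and> V \<noteq> {} \<and> V \<subseteq> C"
  using assms
proof (induction M arbitrary: U)
  case empty
  then show ?case by simp
next
  case (insert C M)
  show ?case
  proof (cases "U \<subseteq> C")
    case True
    then show ?thesis using insert.prems by blast
  next
    case False
    have "openin T (U - C)" using insert.prems by (intro openin_diff) auto
    then have "\<exists>C\<in>M. \<exists>V. openin T V \<and> V \<noteq> {} \<and> V \<subseteq> C"
      using insert.IH[of "U - C"] insert.prems False by auto
    then show ?thesis by auto
  qed
qed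

text \<open>The maximal procyclic subgroups form an antichain, so finitely many of them cover \<open>G\<close> and
  one of them has an interior point.\<close>

lemma open_procyclic_exists:
  assumes w: "width_at_most (Collect (closed_subgroup G)) w"
  obtains c where "c \<in> carrier G" "openin T (procyclic G c)"
proof -
  define M where "M = {procyclic G m |m. m \<in> carrier G \<and>
     (\<forall>y\<in>carrier G. procyclic G m \<subseteq> procyclic G y \<longrightarrow> procyclic G y = procyclic G m)}"
  have finM: "finite M"
  proof (rule ccontr)
    assume "infinite M"
    then obtain F where F: "finite F" "card F = Suc w" "F \<subseteq> M"
      using infinite_arbitrarily_large by blast
    have "card F \<le> w"
    proof (rule w[unfolded width_at_most_def, rule_format])
      show "F \<subseteq> Collect (closed_subgroup G)" using F(3) procyclic_closed_subgroup by (auto simp: M_def)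
      show "H = K" if HK: "H \<in> F" "K \<in> F" "H \<subseteq> K" for H K
      proof -
        obtain k where "k \<in> carrier G" "K = procyclic G k" using HK F(3) by (auto simp: M_def)
        then show "H = K" using HK F(3) unfolding M_def by blast
      qed
    qed (rule F)
    then show False using F by simp
  qed
  have clM: "closedin T C" if "C \<in> M" for C using that procyclic_closedin by (auto simp: M_def)
  have cover: "carrier G \<subseteq> \<Union>M"
  proof
    fix x assume x: "x \<in> carrier G"
    obtain m where m: "m \<in> carrier G" "x \<in> procyclic G m"
      "\<And>y. \<lbrakk>y \<in> carrier G; procyclic G m \<subseteq> procyclic G y\<rbrakk> \<Longrightarrow> procyclic G y = procyclic G m"
      using maximal_procyclic[OF x] by metis
    then have "procyclic G m \<in> M" unfolding M_def by blast
    then show "x \<in> \<Union>M" using m(2) by blast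
  qed
  have "openin T (carrier G)" using openin_topspace[of T] by simp
  then obtain C V where CV: "C \<in> M" "openin T V" "V \<noteq> {}" "V \<subseteq> C"
    using finite_closed_cover_interior[OF finM clM _ _ cover] one_closed by blast
  obtain c where c: "c \<in> carrier G" "C = procyclic G c" using CV(1) by (auto simp: M_def)
  interpret C: subgroup C G using c procyclic_subgroup by simp
  have "openin T C"
  proof (subst openin_subopen, intro ballI)
    fix h assume h: "h \<in> C"
    \<comment> \<open>Translation by \<open>h \<otimes> inv v\<close> carries the interior point
      \<open>v\<close> to \<open>h\<close>, so one interior point makes the subgroup open.\<close>
    obtain v where v: "v \<in> V" using CV(3) by blast
    have vC: "v \<in> C" using v CV(4) by blast
    define d where "d = h \<otimes> inv v"
    have d: "d \<in> C" using h vC by (simp add: d_def)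
    have "openin T {x \<in> carrier G. inv d \<otimes> x \<in> V}" using openin_lcoset[OF CV(2)] d by simp
    moreover have "inv d \<otimes> h = v" using h vC by (simp add: d_def inv_mult_group m_assoc)
    then have "h \<in> {x \<in> carrier G. inv d \<otimes> x \<in> V}" using h v by simp
    moreover have "{x \<in> carrier G. inv d \<otimes> x \<in> V} \<subseteq> C"
    proof clarify
      fix x assume x: "x \<in> carrier G" "inv d \<otimes> x \<in> V"
      then have "d \<otimes> (inv d \<otimes> x) \<in> C" using d CV(4) by blast
      then show "x \<in> C" using x(1) C.mem_carrier[OF d] by simp
    qed
    ultimately show "\<exists>S. openin T S \<and> h \<in> S \<and> S \<subseteq> C" by blast
  qed
  then show thesis using that c by blast
qed

section \<open>Powers of a topological generator\<close>

lemma procyclic_contains_closed: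
  assumes "x \<in> carrier G" "closedin T K" "\<And>i::int. x [^] i \<in> K"
  shows "procyclic G x \<subseteq> K"
  unfolding procyclic_def using assms generate_pow[OF assms(1)]
  by (intro closure_of_minimal) auto

lemma procyclic_pow_map:
  assumes x: "x \<in> carrier G" and y: "y \<in> procyclic G x"
  shows "y [^] (e::nat) \<in> procyclic G (x [^] e)"
proof -
  have "closedin T {y \<in> topspace T. y [^] e \<in> procyclic G (x [^] e)}"
    using procyclic_closedin[of "x [^] e"] x
    by (intro closedin_continuous_map_preimage[where Y = T] continuous_pow2) auto
  then have "procyclic G x \<subseteq> {y \<in> topspace T. y [^] e \<in> procyclic G (x [^] e)}"
  proof (rule procyclic_contains_closed[OF x])
    fix i :: int
    have "(x [^] i) [^] e = (x [^] e) [^] i"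
      using x by (metis int_pow_int int_pow_pow mult.commute)
    then show "x [^] i \<in> {y \<in> topspace T. y [^] e \<in> procyclic G (x [^] e)}"
      using x procyclic_pow[of "x [^] e" i] by simp
  qed
  then show ?thesis using y by blast
qed

text \<open>Division with remainder puts every integer power of \<open>x\<close> into a finite union
  of closed translates, and this union then contains the closure.\<close>

lemma procyclic_cosets:
  assumes x: "x \<in> carrier G" and y: "y \<in> procyclic G x" and n: "n > 0"
  obtains i :: nat where "i < n" "inv (x [^] i) \<otimes> y \<in> procyclic G (x [^] n)"
proof -
  let ?K = "\<Union>i<n. {y \<in> carrier G. inv (x [^] i) \<otimes> y \<in> procyclic G (x [^] n)}"
  have "closedin T ?K"
    using x procyclic_closedin[of "x [^] n"] by (intro closedin_Union) (auto intro!: closedin_lcoset)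
  then have "procyclic G x \<subseteq> ?K"
  proof (rule procyclic_contains_closed[OF x])
    fix j :: int
    define i where "i = nat (j mod int n)"
    have i: "i < n" "int i = j mod int n" using n by (auto simp: i_def nat_less_iff)
    have "inv (x [^] i) \<otimes> x [^] j = x [^] (- int i) \<otimes> x [^] j"
      using x by (simp add: int_pow_neg_int)
    also have "\<dots> = x [^] (int n * (j div int n))"
      using x i(2) by (simp add: int_pow_mult[symmetric]) (metis add.commute add_diff_cancel_right' mult_div_mod_eq uminus_add_conv_diff)
    also have "\<dots> = (x [^] n) [^] (j div int n)" using x by (metis int_pow_int int_pow_pow)
    also have "\<dots> \<in> procyclic G (x [^] n)" using x procyclic_pow by simp
    finally show "x [^] j \<in> ?K" using i(1) x by auto
  qed
  then show thesis using y that by auto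
qed

lemma openin_procyclic_pow:
  assumes x: "x \<in> carrier G" "openin T (procyclic G x)" and n: "n > 0"
  shows "openin T (procyclic G (x [^] (n::nat)))"
proof (rule openin_closed_finite_index[where F = "(\<lambda>i. x [^] i) ` {..<n}" and U = "procyclic G x"])
  show "\<exists>g\<in>(\<lambda>i. x [^] i) ` {..<n}. inv g \<otimes> y \<in> procyclic G (x [^] n)" if "y \<in> procyclic G x" for y
    using procyclic_cosets[OF x(1) that n] by blast
  show "procyclic G (x [^] n) \<subseteq> procyclic G x"
    using procyclic_mono[OF x(1) procyclic_nat_pow[OF x(1)]] .
qed (use x procyclic_subgroup procyclic_closedin in auto)

lemma open_normal_pow:
  assumes "open_normal G N"
  obtains n :: nat where "n > 0" "n = card (rcosets N)" "\<And>x. x \<in> carrier G \<Longrightarrow> x [^] n \<in> N"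
proof
  interpret Q: group "G Mod N" using quotient_group[OF assms] .
  have o: "order (G Mod N) = card (rcosets N)" by (simp add: Coset.order_def FactGroup_def)
  show "card (rcosets N) > 0"
    using Q.order_gt_0_iff_finite quotient_finite[OF assms] o by simp
  show "x [^] card (rcosets N) \<in> N" if "x \<in> carrier G" for x
    using Q.pow_order_eq_1[OF quotient_carrier[OF assms that]] o quotient_nat_pow[OF assms that]
      quotient_one[OF assms, of "x [^] card (rcosets N)"] that by simp
qed simp

lemma procyclic_open_normal: "\<lbrakk>open_normal G N; x \<in> N\<rbrakk> \<Longrightarrow> procyclic G x \<subseteq> N"
  using open_normal_subgroup open_normal_closedin by (intro procyclic_minimal) (auto simp: closed_subgroup_def)

lemma finite_carrier_if_trivial_open:
  assumes "openin T {\<one>}"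
  shows "finite (carrier G)"
proof -
  obtain F where F: "finite F" "F \<subseteq> carrier G" "\<And>x. x \<in> carrier G \<Longrightarrow> \<exists>g\<in>F. inv g \<otimes> x \<in> {\<one>}"
    using open_subgroup_transversal[OF triv_subgroup assms] by blast
  have "carrier G \<subseteq> F"
  proof
    fix x assume x: "x \<in> carrier G"
    then obtain g where g: "g \<in> F" "inv g \<otimes> x = \<one>" using F(3) by auto
    have gc: "g \<in> carrier G" using g F(2) by auto
    have "g \<otimes> (inv g \<otimes> x) = g" using g(2) gc by simp
    then show "x \<in> F" using g(1) gc x by simp
  qed
  then show ?thesis using F(1) finite_subset by blast
qed

text \<open>With \<open>c\<close> an open procyclic generator, an index \<open>n\<close> is normalized to the least exponent \<open>s\<close>
  with \<open>c [^] s\<close> in the closed subgroup generated by \<open>c [^] n\<close>; inclusion of these subgroups is then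
  divisibility of the normalized exponents.\<close>

lemma padic_generator_exists:
  assumes w: "width_at_most (Collect (closed_subgroup G)) w" and inf: "infinite (carrier G)"
  obtains p a where "padic_generator G p a"
proof -
  obtain c where c: "c \<in> carrier G" "openin T (procyclic G c)" using open_procyclic_exists[OF w] .
  define A where "A n = procyclic G (c [^] n)" for n :: nat
  have cA: "c [^] n \<in> A n" for n :: nat using c procyclic_self by (simp add: A_def)
  have A_sub: "A m \<subseteq> A n" if "c [^] m \<in> A n" for m n :: nat
    using procyclic_mono[of "c [^] n"] that c by (simp add: A_def)
  have A_grp: "subgroup (A n) G" for n using c procyclic_subgroup by (simp add: A_def)
  have A_dvd: "c [^] i \<in> A n" if dvd: "int n dvd i" for n :: nat and i :: int
  proof -
    obtain k where "i = int n * k" using dvd by auto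
    then have "c [^] i = (c [^] n) [^] k" using c by (metis int_pow_int int_pow_pow)
    then show ?thesis using procyclic_pow[of "c [^] n" k] c by (simp add: A_def)
  qed
  \<comment> \<open>These are the exact exponents: for \<open>n\<close> in \<open>S\<close> only
    multiples of \<open>n\<close> occur as exponents of \<open>c\<close> in
    \<open>A n\<close>.\<close>
  define S where "S = {n. n > 0 \<and> (\<forall>i::int. c [^] i \<in> A n \<longrightarrow> int n dvd i)}"
  have norm: "\<exists>s\<in>S. A s = A n" if "n > 0" for n
  proof -
    define s :: nat where "s = (LEAST s::nat. s > 0 \<and> c [^] s \<in> A n)"
    have s: "s > 0" "c [^] s \<in> A n" using LeastI[of "\<lambda>s::nat. s > 0 \<and> c [^] s \<in> A n" n] that cA by (auto simp: s_def)
    have dv: "int s dvd i" if i: "c [^] (i::int) \<in> A n" for i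
    proof (rule ccontr)
      assume nd: "\<not> int s dvd i"
      define r where "r = nat (i mod int s)"
      have r: "int r = i mod int s" "r < s" using s(1) by (auto simp: r_def nat_less_iff)
      have "r > 0" using nd r(1) by (metis dvd_eq_mod_eq_0 gr0I of_nat_0)
      have "c [^] int r = c [^] i \<otimes> c [^] (- (int s * (i div int s)))"
        using c r(1) by (simp add: int_pow_mult[symmetric]) (metis minus_mult_div_eq_mod)
      also have "c [^] (- (int s * (i div int s))) = (c [^] s) [^] (- (i div int s))"
        using c by (metis int_pow_int int_pow_pow mult_minus_right)
      also have "c [^] i \<otimes> (c [^] s) [^] (- (i div int s)) \<in> A n"
        using i subgroup_int_pow_closed[OF A_grp s(2)] subgroup.m_closed[OF A_grp] by blast
      finally have "c [^] r \<in> A n" by (simp add: int_pow_int)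
      then have "s \<le> r" unfolding s_def using \<open>r > 0\<close> by (intro Least_le) simp
      then show False using r(2) by simp
    qed
    have "int s dvd int n" using dv[of "int n"] cA by (simp add: int_pow_int)
    then have "c [^] n \<in> A s" using A_dvd[of s "int n"] by (simp add: int_pow_int)
    then have "A s = A n" using A_sub s(2) by blast
    then show ?thesis using s(1) dv unfolding S_def by (intro bexI[of _ s]) auto
  qed
  have A_iff: "m dvd n" if "m \<in> S" "A n \<subseteq> A m" for m n
  proof -
    have "c [^] int n \<in> A m" using that(2) cA by (auto simp: int_pow_int)
    then show ?thesis using that(1) unfolding S_def by fastforce
  qed
  have infS: "infinite S"
  proof
    assume finS: "finite S"
    \<comment> \<open>If \<open>S\<close> were finite, \<open>A l\<close> would lie in every open
      normal subgroup and be trivial; being open, it would make the group finite.\<close>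
    define l where "l = Lcm S"
    have l0: "l > 0" unfolding l_def using finS by (intro Nat.gr0I) (auto simp: Lcm_0_iff S_def)
    have small: "A l \<subseteq> N" if N: "open_normal G N" for N
    proof -
      obtain n :: nat where n: "n > 0" "c [^] n \<in> N" using open_normal_pow[OF N] c by metis
      then obtain s where s: "s \<in> S" "A s = A n" using norm by blast
      have "s dvd l" using s(1) by (simp add: l_def)
      then have ls: "A l \<subseteq> A s" using A_dvd[of s "int l"] by (intro A_sub) (simp add: int_pow_int)
      have "A n \<subseteq> N" unfolding A_def using procyclic_open_normal[OF N n(2)] .
      then have "A s \<subseteq> N" using s(2) by simp
      then show ?thesis using ls by blast
    qed
    have "A l \<subseteq> {\<one>}"
      using open_normal_trivial subgroup.mem_carrier[OF A_grp[of l]] small by blast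
    then have "A l = {\<one>}" using subgroup.one_closed[OF A_grp] by blast
    moreover have "openin T (A l)" unfolding A_def using openin_procyclic_pow[OF c l0] .
    ultimately show False using finite_carrier_if_trivial_open inf by simp
  qed
  obtain p m where pm: "prime p" "\<And>k. m * p ^ k \<in> S" "\<And>s. s \<in> S \<Longrightarrow> \<exists>k. s dvd m * p ^ k"
  proof (rule divisor_closed_prime_direction[of S w])
    show "n > 0" if "n \<in> S" for n using that by (simp add: S_def)
    show "infinite S" by fact
    show "d \<in> S" if n: "n \<in> S" and d: "d dvd n" for n d
    proof -
      obtain e where e: "n = d * e" using d by auto
      have "int d dvd i" if "c [^] (i::int) \<in> A d" for i
      proof -
        \<comment> \<open>Taking \<open>e\<close>-th powers leads from \<open>A d\<close> into
          \<open>A n\<close>, where exactness of \<open>n = d * e\<close> gives that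
          \<open>d * e\<close> divides \<open>i * e\<close>.\<close>
        have "(c [^] i) [^] e \<in> procyclic G ((c [^] d) [^] e)"
          using procyclic_pow_map[of "c [^] d"] that c unfolding A_def by simp
        also have "(c [^] d) [^] e = c [^] n" using c e by (simp add: nat_pow_pow)
        also have "(c [^] i) [^] e = c [^] (i * int e)" using c by (metis int_pow_int int_pow_pow)
        finally have "int n dvd i * int e" using n by (simp add: S_def A_def)
        then show ?thesis using e n by (simp add: S_def)
      qed
      then show ?thesis using n e by (auto simp: S_def)
    qed
    show "lcm a b \<in> S" if ab: "a \<in> S" "b \<in> S" for a b
    proof -
      have "int (lcm a b) dvd i" if "c [^] (i::int) \<in> A (lcm a b)" for i
      proof -
        have "A (lcm a b) \<subseteq> A a" "A (lcm a b) \<subseteq> A b"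
          using A_dvd[of a "int (lcm a b)"] A_dvd[of b "int (lcm a b)"] by (auto intro!: A_sub simp: int_pow_int)
        then have "int a dvd i" "int b dvd i" using that ab by (auto simp: S_def)
        then have "lcm (int a) (int b) dvd i" by (rule lcm_least)
        then show ?thesis by (simp add: lcm_int_int_eq)
      qed
      then show ?thesis using ab by (auto simp: S_def lcm_pos_nat)
    qed
    show "card F \<le> w" if F: "finite F" "F \<subseteq> S" "\<And>a b. \<lbrakk>a \<in> F; b \<in> F; a dvd b\<rbrakk> \<Longrightarrow> a = b" for F
    proof -
      have "card (A ` F) \<le> w"
      proof (rule w[unfolded width_at_most_def, rule_format])
        show "A ` F \<subseteq> Collect (closed_subgroup G)" using c procyclic_closed_subgroup by (auto simp: A_def)
        show "H = K" if HK: "H \<in> A ` F" "K \<in> A ` F" "H \<subseteq> K" for H K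
        proof -
          obtain a b where ab: "a \<in> F" "b \<in> F" "H = A a" "K = A b" using HK by auto
          then have "b = a" using A_iff[of b a] F(2) F(3)[of b a] HK(3) by auto
          then show ?thesis using ab by simp
        qed
      qed (use F in simp)
      moreover have "inj_on A F"
      proof (rule inj_onI)
        fix a b assume ab: "a \<in> F" "b \<in> F" "A a = A b"
        then show "a = b" using A_iff[of a b] F(2) F(3)[of a b] by auto
      qed
      ultimately show ?thesis by (simp add: card_image)
    qed
  qed blast
  \<comment> \<open>All \<open>m * p ^ k\<close> are exact, and every exact exponent divides one of
    them, so the subgroups \<open>A (m * p ^ k)\<close> shrink into every open normal
    subgroup.\<close>
  have "padic_generator G p (c [^] m)"
    unfolding padic_generator_def
  proof (intro conjI allI impI)
    have m0: "m > 0" using pm(2)[of 0] by (simp add: S_def)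
    show "openin T (procyclic G (c [^] m))" using openin_procyclic_pow[OF c m0] .
    show "int (p ^ k) dvd i" if "(c [^] m) [^] (i::int) \<in> procyclic G ((c [^] m) [^] (p ^ k))" for i k
    proof -
      have "c [^] (int m * i) \<in> A (m * p ^ k)"
        using that c unfolding A_def by (metis int_pow_int int_pow_pow nat_pow_pow)
      then have "int (m * p ^ k) dvd int m * i" using pm(2)[of k] unfolding S_def by blast
      then have "int m * int (p ^ k) dvd int m * i" by (simp only: of_nat_mult)
      then show ?thesis using m0 by (simp only: dvd_mult_cancel_left) simp
    qed
    show "\<exists>k. (c [^] m) [^] (p ^ k) \<in> N" if N: "open_normal G N" for N
    proof -
      obtain n :: nat where n: "n > 0" "c [^] n \<in> N" using open_normal_pow[OF N] c by metis
      then obtain s where s: "s \<in> S" "A s = A n" using norm by blast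
      then obtain k where k: "s dvd m * p ^ k" using pm(3) by blast
      have "c [^] int (m * p ^ k) \<in> A s" using k by (intro A_dvd) (simp only: int_dvd_int_iff)
      moreover have "A s \<subseteq> N" using procyclic_open_normal[OF N n(2)] s(2) by (simp add: A_def)
      ultimately have "c [^] (m * p ^ k) \<in> N" by (metis int_pow_int subsetD)
      then have "(c [^] m) [^] (p ^ k) \<in> N" using c by (simp add: nat_pow_pow)
      then show ?thesis by blast
    qed
  qed (use pm(1) c in auto)
  then show thesis by (rule that)
qed

end


section \<open>Open copies of the p-adic integers\<close>

context profinite_group
begin

lemma padicD:
  assumes "padic_generator G p a"
  shows "prime p" "a \<in> carrier G" "openin T (procyclic G a)"
    "\<And>(i::int) k. a [^] i \<in> procyclic G (a [^] (p ^ k)) \<Longrightarrow> int (p ^ k) dvd i"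
    "\<And>N. open_normal G N \<Longrightarrow> \<exists>k. a [^] (p ^ k) \<in> N"
  using assms unfolding padic_generator_def by blast+

lemma procyclic_one_mem: "x \<in> carrier G \<Longrightarrow> \<one> \<in> procyclic G x"
  using subgroup.one_closed procyclic_subgroup by blast

text \<open>The identity lies in every procyclic subgroup, so the exponent clause at
  \<open>k = n\<close> would make \<open>p ^ n\<close> divide \<open>n\<close>, although
  \<open>n < p ^ n\<close>.\<close>

lemma padic_torsion_free:
  assumes "padic_generator G p a" "a [^] (n::nat) = \<one>"
  shows "n = 0"
proof (rule ccontr)
  assume n: "n \<noteq> 0"
  have "int (p ^ n) dvd int n"
    using padicD(4)[OF assms(1), of "int n" n] assms(2) procyclic_one_mem padicD(2)[OF assms(1)] by (simp add: int_pow_int)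
  then have "p ^ n dvd n" by (simp only: int_dvd_int_iff)
  then have "p ^ n \<le> n" using n by (simp add: dvd_imp_le)
  moreover have "n < p ^ n" using padicD(1)[OF assms(1)] prime_gt_1_nat by (simp add: power_gt_expt)
  ultimately show False by simp
qed

lemma padic_pow:
  assumes a: "padic_generator G p a"
  shows "padic_generator G p (a [^] (p ^ k))"
  unfolding padic_generator_def
proof (intro conjI allI impI)
  note D = padicD[OF a]
  have p0: "p > 0" using D(1) prime_gt_0_nat by blast
  show "openin T (procyclic G (a [^] (p ^ k)))" using openin_procyclic_pow[OF D(2,3)] p0 by simp
  show "int (p ^ l) dvd i" if "(a [^] (p ^ k)) [^] (i::int) \<in> procyclic G ((a [^] (p ^ k)) [^] (p ^ l))" for i l
  proof -
    have "(a [^] (p ^ k)) [^] (p ^ l) = a [^] (p ^ (k + l))" using D(2) by (simp add: nat_pow_pow power_add)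
    moreover have "(a [^] (p ^ k)) [^] i = a [^] (int (p ^ k) * i)" using D(2) by (metis int_pow_int int_pow_pow)
    ultimately have "int (p ^ (k + l)) dvd int (p ^ k) * i" using that D(4) by metis
    then have "int (p ^ k) * int (p ^ l) dvd int (p ^ k) * i" by (simp add: power_add)
    then show ?thesis using p0 by (simp only: dvd_mult_cancel_left) simp
  qed
  show "\<exists>l. (a [^] (p ^ k)) [^] (p ^ l) \<in> N" if N: "open_normal G N" for N
  proof -
    obtain l where l: "a [^] (p ^ l) \<in> N" using D(5)[OF N] by blast
    have "(a [^] (p ^ k)) [^] (p ^ l) = (a [^] (p ^ l)) [^] int (p ^ k)"
      using D(2) by (simp add: int_pow_int nat_pow_pow mult.commute del: of_nat_power)
    then show ?thesis using subgroup_int_pow_closed[OF open_normal_subgroup[OF N] l] by (intro exI[of _ l]) simp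
  qed
qed (use padicD[OF a] in auto)

text \<open>A p-adic integer outside the multiples of \<open>p\<close> is a unit. Concretely, modulo
  \<open>N\<close> the element \<open>h\<close> is a power of \<open>a\<close> with exponent prime
  to \<open>p\<close>, and inverting this exponent modulo \<open>p ^ j\<close> recovers
  \<open>a\<close>.\<close>

lemma padic_unit_step:
  assumes a: "padic_generator G p a" and h: "h \<in> procyclic G a" "h \<notin> procyclic G (a [^] p)"
  shows "procyclic G h = procyclic G a"
proof
  note D = padicD[OF a]
  have hc: "h \<in> carrier G" using h procyclic_carrier[OF D(2)] by blast
  show "procyclic G h \<subseteq> procyclic G a" using procyclic_mono[OF D(2) h(1)] .
  have "a \<in> procyclic G h"
  proof (rule procyclicI[OF hc D(2)])
    fix N assume N: "open_normal G N"
    obtain j where j: "a [^] (p ^ j) \<in> N" using D(5)[OF N] by blast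
    \<comment> \<open>\<open>Suc j\<close> instead of \<open>j\<close> puts \<open>U\<close> inside
      the subgroup generated by \<open>a [^] p\<close> as well as inside \<open>N\<close>; the
      former excludes exponents divisible by \<open>p\<close>.\<close>
    define U where "U = procyclic G (a [^] (p ^ Suc j))"
    have U: "openin T U" "\<one> \<in> U"
      unfolding U_def using openin_procyclic_pow[OF D(2,3)] prime_gt_0_nat[OF D(1)] procyclic_one_mem D(2) by simp_all
    obtain i :: int where i: "inv h \<otimes> a [^] i \<in> U" using procyclic_approx[OF D(2) h(1) U] .
    have U1: "U \<subseteq> procyclic G (a [^] p)"
    proof -
      have "a [^] (p ^ Suc j) = (a [^] p) [^] (p ^ j)" using D(2) by (simp add: nat_pow_pow)
      then show ?thesis unfolding U_def using procyclic_mono[of "a [^] p"] procyclic_nat_pow[of "a [^] p"] D(2) by simp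
    qed
    have UN: "U \<subseteq> N"
    proof -
      have "a [^] (p ^ Suc j) = (a [^] (p ^ j)) [^] int p" using D(2) by (simp add: int_pow_int nat_pow_pow mult.commute)
      then have "a [^] (p ^ Suc j) \<in> N" using subgroup_int_pow_closed[OF open_normal_subgroup[OF N] j] by simp
      then show ?thesis unfolding U_def by (rule procyclic_open_normal[OF N])
    qed
    have "\<not> int p dvd i"
    proof
      assume "int p dvd i"
      then obtain k where "i = int p * k" by blast
      then have "a [^] i = (a [^] p) [^] k" using D(2) by (metis int_pow_int int_pow_pow)
      then have ai: "a [^] i \<in> procyclic G (a [^] p)" using procyclic_pow D(2) by simp
      interpret P: subgroup "procyclic G (a [^] p)" G using procyclic_subgroup D(2) by simp
      have "a [^] i \<otimes> inv (inv h \<otimes> a [^] i) \<in> procyclic G (a [^] p)" using ai i U1 by blast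
      moreover have "a [^] i \<otimes> inv (inv h \<otimes> a [^] i) = h" using hc D(2) by (simp add: inv_mult_group)
      ultimately show False using h(2) by simp
    qed
    then have "coprime (int p) i" using D(1) by (intro prime_imp_coprime) auto
    then have "coprime i (int (p ^ j))" by (simp add: coprime_commute)
    then obtain e where "[i * e = 1] (mod int (p ^ j))" using cong_solve_coprime_int by blast
    then obtain t where t: "i * e = 1 + int (p ^ j) * t" by (metis cong_iff_lin mult.commute cong_sym)
    have "N #> h = N #> a [^] i" using quotient_eq[OF N hc, of "a [^] i"] i UN D(2) by auto
    then have "N #> h [^] e = N #> (a [^] i) [^] e"
      using quotient_int_pow[OF N hc, of e] quotient_int_pow[OF N, of "a [^] i" e] D(2) by simp
    also have "(a [^] i) [^] e = a \<otimes> (a [^] (p ^ j)) [^] t"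
      using D(2) t by (simp add: int_pow_pow int_pow_mult) (metis int_pow_int int_pow_pow of_nat_power)
    finally have "inv (h [^] e) \<otimes> (a \<otimes> (a [^] (p ^ j)) [^] t) \<in> N"
      using quotient_eq[OF N, of "h [^] e" "a \<otimes> (a [^] (p ^ j)) [^] t"] hc D(2) by simp
    have "N #> a = N #> (a \<otimes> (a [^] (p ^ j)) [^] t)"
      using quotient_eq[OF N D(2), of "a \<otimes> (a [^] (p ^ j)) [^] t"] D(2) subgroup_int_pow_closed[OF open_normal_subgroup[OF N] j]
      by simp
    then have "N #> a = N #> h [^] e" using \<open>N #> h [^] e = N #> (a [^] i) [^] e\<close> \<open>(a [^] i) [^] e = _\<close> by simp
    then have "inv a \<otimes> h [^] e \<in> N" using quotient_eq[OF N D(2), of "h [^] e"] hc by simp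
    then show "\<exists>z\<in>procyclic G h. inv a \<otimes> z \<in> N" using procyclic_pow[OF hc] by blast
  qed
  then show "procyclic G a \<subseteq> procyclic G h" using procyclic_mono[OF hc] by blast
qed

lemma procyclic_inv_pow_mem:
  assumes "x \<in> carrier G" "subgroup H G"
  shows "x [^] (i::int) \<in> H \<longleftrightarrow> x [^] nat \<bar>i\<bar> \<in> H"
proof (cases "i \<ge> 0")
  case True
  then show ?thesis by (metis abs_of_nonneg int_pow_int nat_0_le)
next
  case False
  then have "i = - int (nat \<bar>i\<bar>)" by simp
  then have "x [^] i = inv (x [^] nat \<bar>i\<bar>)" using assms(1) by (metis int_pow_neg_int)
  then show ?thesis using assms by (metis inv_inv nat_pow_closed subgroup.m_inv_closed)
qed

lemma padic_same_procyclic: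
  assumes a: "padic_generator G p a" and h: "h \<in> carrier G" "procyclic G h = procyclic G a"
  shows "padic_generator G p h"
  unfolding padic_generator_def
proof (intro conjI allI impI)
  note D = padicD[OF a]
  have ah: "a \<in> procyclic G h" "h \<in> procyclic G a" using h procyclic_self D(2) by auto
  show "int (p ^ k) dvd i" if i: "h [^] (i::int) \<in> procyclic G (h [^] (p ^ k))" for i k
  proof -
    let ?P = "procyclic G (a [^] (p ^ k))"
    have P: "subgroup ?P G" using procyclic_subgroup D(2) by simp
    have "procyclic G (h [^] (p ^ k)) \<subseteq> ?P"
      using procyclic_mono[of "a [^] (p ^ k)"] procyclic_pow_map[OF D(2) ah(2)] D(2) by simp
    \<comment> \<open>Powers are mapped for natural exponents only; passing to the absolute value
      does not change membership in a subgroup.\<close>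
    then have "h [^] nat \<bar>i\<bar> \<in> ?P" using i procyclic_inv_pow_mem[OF h(1) P, of i] by blast
    then have "procyclic G (h [^] nat \<bar>i\<bar>) \<subseteq> ?P" using procyclic_mono D(2) by simp
    then have "a [^] nat \<bar>i\<bar> \<in> ?P" using procyclic_pow_map[OF h(1) ah(1), of "nat \<bar>i\<bar>"] by blast
    then have "a [^] i \<in> ?P" using procyclic_inv_pow_mem[OF D(2) P, of i] by blast
    then show ?thesis by (rule D(4))
  qed
  show "\<exists>k. h [^] (p ^ k) \<in> N" if N: "open_normal G N" for N
  proof -
    obtain k where k: "a [^] (p ^ k) \<in> N" using D(5)[OF N] by blast
    then have "h [^] (p ^ k) \<in> N" using procyclic_pow_map[OF D(2) ah(2)] procyclic_open_normal[OF N k] by blast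
    then show ?thesis by blast
  qed
qed (use padicD[OF a] h in auto)

lemma padic_layer:
  assumes a: "padic_generator G p a" and h: "h \<in> procyclic G (a [^] (p ^ k))" "h \<notin> procyclic G (a [^] (p ^ Suc k))"
  shows "procyclic G h = procyclic G (a [^] (p ^ k))" "padic_generator G p h"
proof -
  note D = padicD[OF a]
  have "(a [^] (p ^ k)) [^] p = a [^] (p ^ Suc k)" using D(2) by (simp add: nat_pow_pow mult.commute)
  then show eq: "procyclic G h = procyclic G (a [^] (p ^ k))"
    using padic_unit_step[OF padic_pow[OF a] h(1)] h(2) by simp
  have "h \<in> carrier G" using h(1) procyclic_carrier D(2) by blast
  then show "padic_generator G p h" using padic_same_procyclic[OF padic_pow[OF a] _ eq] by blast
qed

text \<open>\<open>k\<close> is the p-adic valuation of \<open>h\<close>. It exists because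
  \<open>h\<close> is missed by some open normal subgroup, into which high powers
  \<open>a [^] (p ^ j)\<close> fall.\<close>

lemma padic_element_layer:
  assumes a: "padic_generator G p a" and h: "h \<in> procyclic G a" "h \<noteq> \<one>"
  obtains k where "h \<in> procyclic G (a [^] (p ^ k))" "h \<notin> procyclic G (a [^] (p ^ Suc k))"
    "procyclic G h = procyclic G (a [^] (p ^ k))" "padic_generator G p h"
proof -
  note D = padicD[OF a]
  have hc: "h \<in> carrier G" using h(1) procyclic_carrier D(2) by blast
  then obtain N where N: "open_normal G N" "h \<notin> N" using open_normal_trivial h(2) by blast
  obtain j where "a [^] (p ^ j) \<in> N" using D(5)[OF N(1)] by blast
  then have j: "h \<notin> procyclic G (a [^] (p ^ j))" using procyclic_open_normal[OF N(1)] N(2) by blast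
  define l where "l = (LEAST l. h \<notin> procyclic G (a [^] (p ^ l)))"
  have l: "h \<notin> procyclic G (a [^] (p ^ l))" unfolding l_def by (rule LeastI[of _ j]) (rule j)
  have "l \<noteq> 0" using l h(1) D(2) by (metis nat_pow_eone power_0)
  then obtain k where k: "l = Suc k" using not0_implies_Suc by blast
  have "h \<in> procyclic G (a [^] (p ^ k))" using not_less_Least[of k "\<lambda>l. h \<notin> procyclic G (a [^] (p ^ l))"] k l_def by auto
  then show thesis using that[of k] padic_layer[OF a, of h k] l k by simp
qed

text \<open>A nontrivial \<open>z\<close> would itself be a p-adic generator, and those have
  infinite order.\<close>

lemma padic_torsion_trivial:
  assumes "padic_generator G p a" "z \<in> procyclic G a" "z [^] (n::nat) = \<one>" "n > 0"
  shows "z = \<one>"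
  using padic_element_layer[OF assms(1,2)] padic_torsion_free[of p z n] assms(3,4) by blast

text \<open>An open normal subgroup inside the p-adic copy consists of all elements of valuation at
  least \<open>j\<close>, where \<open>j\<close> is the least exponent with
  \<open>a [^] (p ^ j)\<close> in it; so it is generated by that power.\<close>

lemma padic_normal_generator:
  assumes a: "padic_generator G p a"
  obtains b where "padic_generator G p b" "open_normal G (procyclic G b)"
proof -
  note D = padicD[OF a]
  obtain N where N: "open_normal G N" "N \<subseteq> procyclic G a"
    using open_normal_nbhd_one[OF D(3)] procyclic_one_mem[OF D(2)] by blast
  define j where "j = (LEAST j. a [^] (p ^ j) \<in> N)"
  obtain j' where "a [^] (p ^ j') \<in> N" using D(5)[OF N(1)] by blast
  then have j: "a [^] (p ^ j) \<in> N" unfolding j_def by (rule LeastI)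
  have "N = procyclic G (a [^] (p ^ j))"
  proof
    show "procyclic G (a [^] (p ^ j)) \<subseteq> N" by (rule procyclic_open_normal[OF N(1) j])
    show "N \<subseteq> procyclic G (a [^] (p ^ j))"
    proof
      fix h assume h: "h \<in> N"
      show "h \<in> procyclic G (a [^] (p ^ j))"
      proof (cases "h = \<one>")
        case True
        then show ?thesis using procyclic_one_mem D(2) by simp
      next
        case False
        obtain k where k: "h \<in> procyclic G (a [^] (p ^ k))" "procyclic G h = procyclic G (a [^] (p ^ k))"
          using padic_element_layer[OF a _ False] h N(2) by blast
        have "a [^] (p ^ k) \<in> procyclic G h" using k(2) procyclic_self D(2) by simp
        then have "a [^] (p ^ k) \<in> N" using procyclic_open_normal[OF N(1) h] by blast
        then have "j \<le> k" unfolding j_def by (rule Least_le)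
        then have "a [^] (p ^ k) = (a [^] (p ^ j)) [^] (p ^ (k - j))"
          using D(2) by (simp add: nat_pow_pow power_add[symmetric])
        then have "procyclic G (a [^] (p ^ k)) \<subseteq> procyclic G (a [^] (p ^ j))"
          using procyclic_mono[of "a [^] (p ^ j)"] procyclic_nat_pow[of "a [^] (p ^ j)"] D(2) by simp
        then show ?thesis using k(1) by blast
      qed
    qed
  qed
  then show thesis using that[OF padic_pow[OF a]] N(1) by simp
qed

lemma finite_subgroup_closed: "\<lbrakk>subgroup H G; finite H\<rbrakk> \<Longrightarrow> closed_subgroup G H"
  using Hausdorff subgroup.subset unfolding closed_subgroup_def
  by (metis closedin_Hausdorff_finite topspace_T)

text \<open>The conjugate \<open>b\<close> of \<open>a\<close> by \<open>g\<close> stays in the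
  commutative procyclic group, and the m-th powers of \<open>a\<close> and \<open>b\<close> agree.
  So \<open>b \<otimes> inv a\<close> is torsion in a torsion-free group.\<close>

lemma padic_central_if_power_commutes:
  assumes a: "padic_generator G p a" and n: "open_normal G (procyclic G a)"
    and g: "g \<in> carrier G" and m: "m > 0" "a [^] (m::nat) \<otimes> g = g \<otimes> a [^] m"
  shows "a \<otimes> g = g \<otimes> a"
proof -
  note D = padicD[OF a]
  define b where "b = g \<otimes> a \<otimes> inv g"
  have b: "b \<in> procyclic G a" unfolding b_def
    using normal_conj[OF open_normal_normal[OF n] g procyclic_self[OF D(2)]] .
  have bc: "b \<in> carrier G" using g D(2) by (simp add: b_def)
  have bpow: "b [^] k = g \<otimes> a [^] k \<otimes> inv g" for k :: nat
    using g D(2) by (induction k) (simp_all add: b_def m_assoc)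
  have "b [^] m = (a [^] m \<otimes> g) \<otimes> inv g" using bpow[of m] m(2) by simp
  then have bm: "b [^] m = a [^] m" using g D(2) by (simp add: m_assoc)
  have com: "b \<otimes> a = a \<otimes> b" using procyclic_commute[OF D(2) D(2) refl b] .
  interpret A: subgroup "procyclic G a" G using procyclic_subgroup[OF D(2)] .
  have com': "b \<otimes> inv a = inv a \<otimes> b"
    using procyclic_commute[OF D(2) inv_closed[OF D(2)] _ b] D(2) by simp
  have "(b \<otimes> inv a) [^] m = b [^] m \<otimes> inv a [^] m"
    using pow_mult_distrib[OF com' bc inv_closed[OF D(2)]] .
  also have "\<dots> = \<one>" using bm nat_pow_inv[OF D(2)] D(2) by simp
  finally have "b \<otimes> inv a = \<one>"
    using padic_torsion_trivial[OF a, of "b \<otimes> inv a" m] m(1) b procyclic_self[OF D(2)] by blast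
  then have "b = a" using bc D(2) by (metis inv_closed inv_equality inv_inv)
  then have "g \<otimes> a \<otimes> inv g \<otimes> g = a \<otimes> g" by (simp add: b_def)
  then show ?thesis using g D(2) by (simp add: m_assoc)
qed

text \<open>It suffices that some power of \<open>a\<close> commutes with \<open>g\<close>. If
  \<open>g [^] m\<close> is nontrivial, it generates a layer containing a power of \<open>a\<close>.
  If it is trivial, the conjugates of the finite group generated by \<open>g\<close> form an
  antichain, so a power \<open>b\<close> of \<open>a\<close> conjugates \<open>g\<close> into that
  group; the commutator of \<open>b\<close> and \<open>g\<close> is then torsion inside the p-adic
  copy, hence trivial.\<close>

lemma padic_central:
  assumes w: "width_at_most (Collect (closed_subgroup G)) w"
    and a: "padic_generator G p a" and n: "open_normal G (procyclic G a)" and g: "g \<in> carrier G"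
  shows "a \<otimes> g = g \<otimes> a"
proof -
  note D = padicD[OF a]
  obtain m :: nat where m: "m > 0" "\<And>x. x \<in> carrier G \<Longrightarrow> x [^] m \<in> procyclic G a"
    using open_normal_pow[OF n] by metis
  have "\<exists>l>0. a [^] (l::nat) \<otimes> g = g \<otimes> a [^] l"
  proof (cases "g [^] m = \<one>")
    case False
    obtain k where "procyclic G (g [^] m) = procyclic G (a [^] (p ^ k))"
      using padic_element_layer[OF a m(2)[OF g] False] by metis
    then have "a [^] (p ^ k) \<in> procyclic G (g [^] m)" using procyclic_self D(2) by simp
    moreover have "g [^] m \<otimes> g = g \<otimes> g [^] m" using g nat_pow_comm[of g m 1] by simp
    ultimately have "a [^] (p ^ k) \<otimes> g = g \<otimes> a [^] (p ^ k)" using procyclic_commute[of "g [^] m" g] g by simp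
    then show ?thesis using prime_gt_0_nat[OF D(1)] by (intro exI[of _ "p ^ k"]) simp
  next
    case True
    let ?H = "generate G {g}"
    have H: "subgroup ?H G" using g by (simp add: generate_is_subgroup)
    interpret H: subgroup ?H G by fact
    have gH: "g \<in> ?H" by (auto intro: generate.incl)
    have "?H \<subseteq> (\<lambda>i. g [^] i) ` {..<m}"
    proof
      fix y assume "y \<in> ?H"
      then obtain i :: nat where "y = g [^] i" using generate_nat_pow[OF g True m(1)] by blast
      then have "y = g [^] (i mod m)" using pow_mod_order[OF g True, of i "i mod m"] by simp
      then show "y \<in> (\<lambda>i. g [^] i) ` {..<m}" using m(1) by auto
    qed
    then have finH: "finite ?H" using finite_subset by blast
    define c where "c i = conj_set (a [^] i) ?H" for i :: nat
    have cfin: "finite (c i)" for i using finH by (simp add: c_def conj_set_def)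
    have ccard: "card (c i) = card ?H" for i using card_conj_set[OF H.subset] D(2) by (simp add: c_def)
    have "card (c ` {..w}) \<le> w"
    proof (rule w[unfolded width_at_most_def, rule_format])
      show "A = B" if "A \<in> c ` {..w}" "B \<in> c ` {..w}" "A \<subseteq> B" for A B
        using that ccard cfin by (intro card_subset_eq) auto
      show "c ` {..w} \<subseteq> Collect (closed_subgroup G)"
      proof clarify
        fix i
        have "subgroup (c i) G" unfolding c_def using conj_set_subgroup[OF H] D(2) by simp
        then show "closed_subgroup G (c i)" using cfin finite_subgroup_closed by blast
      qed
    qed simp
    then have "\<not> inj_on c {..w}" using card_image[of c "{..w}"] by auto
    then have "\<exists>i j. i < j \<and> c i = c j"
      unfolding inj_on_def by (metis linorder_neqE_nat)
    then obtain i j where ij: "i < j" "c i = c j" by blast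
    define b where "b = a [^] (j - i)"
    have bc: "b \<in> carrier G" using D(2) by (simp add: b_def)
    have aj: "a [^] j = a [^] i \<otimes> b" using D(2) ij(1) by (simp add: b_def nat_pow_mult)
    have "a [^] j \<otimes> g \<otimes> inv (a [^] j) \<in> c i" using gH ij(2) by (simp add: c_def conj_set_def)
    then obtain h where h: "h \<in> ?H" "a [^] j \<otimes> g \<otimes> inv (a [^] j) = a [^] i \<otimes> h \<otimes> inv (a [^] i)"
      by (auto simp: c_def conj_set_def)
    have "a [^] i \<otimes> (b \<otimes> g \<otimes> inv b) \<otimes> inv (a [^] i) = a [^] i \<otimes> h \<otimes> inv (a [^] i)"
      using h(2) D(2) bc g unfolding aj by (simp add: inv_mult_group m_assoc)
    then have bgb: "b \<otimes> g \<otimes> inv b = h"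
      using D(2) bc g H.mem_carrier[OF h(1)] by (metis inv_closed l_cancel m_closed nat_pow_closed r_cancel)
    define d where "d = b \<otimes> g \<otimes> inv b \<otimes> inv g"
    have dH: "d \<in> ?H" unfolding d_def bgb using h(1) gH by blast
    have bA: "b \<in> procyclic G a" unfolding b_def using procyclic_nat_pow[OF D(2)] .
    interpret A: subgroup "procyclic G a" G using procyclic_subgroup[OF D(2)] .
    have "d = b \<otimes> (g \<otimes> inv b \<otimes> inv g)" using bc g by (simp add: d_def m_assoc)
    moreover have "g \<otimes> inv b \<otimes> inv g \<in> procyclic G a"
      using normal_conj[OF open_normal_normal[OF n] g A.m_inv_closed[OF bA]] .
    ultimately have dA: "d \<in> procyclic G a" using bA by blast
    obtain e :: nat where e: "d = g [^] e" using generate_nat_pow[OF g True m(1) dH] .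
    have "d [^] m = (g [^] m) [^] e" unfolding e using g by (simp add: nat_pow_pow mult.commute)
    then have "d = \<one>" using padic_torsion_trivial[OF a dA, of m] m(1) True by simp
    then have "(b \<otimes> g) \<otimes> inv (g \<otimes> b) = \<one>" using bc g by (simp add: d_def inv_mult_group m_assoc)
    then have "b \<otimes> g = g \<otimes> b" using bc g by (metis inv_closed inv_equality inv_inv m_closed)
    then show ?thesis using ij(1) by (intro exI[of _ "j - i"]) (simp add: b_def)
  qed
  then show ?thesis using padic_central_if_power_commutes[OF a n g] by blast
qed

end

text \<open>\<open>G\<close> is the semidirect product of the finite \<open>S\<close> with the
  p-adic copy generated by \<open>x\<close>. The central power in the last clause makes deep layers
  of the copy normal, so that they can serve as a filtration of \<open>G\<close>.\<close>

definition padic_split :: "'a topgroup \<Rightarrow> nat \<Rightarrow> 'a \<Rightarrow> 'a set \<Rightarrow> nat \<Rightarrow> bool" where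
  "padic_split G p x S v \<longleftrightarrow> padic_generator G p x \<and> S \<lhd> G \<and> finite S \<and> S \<inter> procyclic G x = {\<one>\<^bsub>G\<^esub>} \<and>
     (\<forall>g\<in>carrier G. \<exists>t\<in>S. \<exists>c\<in>procyclic G x. g = t \<otimes>\<^bsub>G\<^esub> c) \<and>
     (\<forall>g\<in>carrier G. x [^]\<^bsub>G\<^esub> (p ^ v) \<otimes>\<^bsub>G\<^esub> g = g \<otimes>\<^bsub>G\<^esub> x [^]\<^bsub>G\<^esub> (p ^ v))"

context profinite_group
begin

text \<open>The generator \<open>x\<close> is chosen so that its transfer generates the image of the transfer.\<close>

lemma padic_split_exists:
  assumes w: "width_at_most (Collect (closed_subgroup G)) w" and inf: "infinite (carrier G)"
  obtains p x S v where "padic_split G p x S v"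
proof -
  obtain p a0 where "padic_generator G p a0" using padic_generator_exists[OF w inf] .
  then obtain a where a: "padic_generator G p a" and N: "open_normal G (procyclic G a)"
    using padic_normal_generator by metis
  note D = padicD[OF a]
  define A where "A = procyclic G a"
  have A: "subgroup A G" using procyclic_subgroup D(2) by (simp add: A_def)
  interpret A: subgroup A G by fact
  have p1: "p > 1" using D(1) prime_gt_1_nat by blast
  have central: "z \<otimes> g = g \<otimes> z" if "z \<in> A" "g \<in> carrier G" for z g
    using procyclic_commute[OF D(2) that(2) padic_central[OF w a N that(2)]] that(1) by (simp add: A_def)
  obtain m :: nat where m: "m > 0" "m = card (rcosets A)" "\<And>x. x \<in> carrier G \<Longrightarrow> x [^] m \<in> A"
    using open_normal_pow[OF N] unfolding A_def by metis
  obtain V where V: "\<And>g. g \<in> carrier G \<Longrightarrow> V g \<in> A"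
    "\<And>g h. \<lbrakk>g \<in> carrier G; h \<in> carrier G\<rbrakk> \<Longrightarrow> V (g \<otimes> h) = V g \<otimes> V h"
    "\<And>z. z \<in> A \<Longrightarrow> V z = z [^] m"
    using central_transfer[OF A central] finite_rcosets_open[OF N] m(2) unfolding A_def by metis
  have Vc: "V g \<in> carrier G" if "g \<in> carrier G" for g using V(1)[OF that] by (rule A.mem_carrier)
  interpret V: group_hom G G V
    by (unfold_locales) (use V(2) Vc in \<open>auto simp: hom_def\<close>)
  \<comment> \<open>Near the identity the transfer is the m-th power map on \<open>A\<close>, which
    maps each small open subgroup \<open>B\<close> into itself; continuity elsewhere follows by
    translation.\<close>
  have contV: "continuous_map T T V"
    unfolding continuous_map_def
  proof (intro conjI allI impI)
    show "V \<in> topspace T \<rightarrow> topspace T" using Vc by auto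
    fix W assume W: "openin T W"
    show "openin T {g \<in> topspace T. V g \<in> W}"
    proof (subst openin_subopen, intro ballI)
      fix g assume g: "g \<in> {g \<in> topspace T. V g \<in> W}"
      then have gc: "g \<in> carrier G" and gW: "V g \<in> W" by auto
      have "openin T {x \<in> carrier G. V g \<otimes> x \<in> W}"
        using openin_lcoset[OF W, of "inv (V g)"] Vc[OF gc] by simp
      moreover have "\<one> \<in> {x \<in> carrier G. V g \<otimes> x \<in> W}" using gW Vc[OF gc] by simp
      ultimately obtain U where U: "open_normal G U" "U \<subseteq> {x \<in> carrier G. V g \<otimes> x \<in> W}"
        using open_normal_nbhd_one by blast
      obtain k where k: "a [^] (p ^ k) \<in> U" using D(5)[OF U(1)] by blast
      define B where "B = procyclic G (a [^] (p ^ k))"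
      have B: "subgroup B G" "B \<subseteq> A" "B \<subseteq> U" "openin T B"
        unfolding B_def A_def
        using procyclic_subgroup procyclic_mono[OF D(2) procyclic_nat_pow[OF D(2)]] procyclic_open_normal[OF U(1) k]
          openin_procyclic_pow[OF D(2,3)] p1 D(2) by simp_all
      have "{x \<in> carrier G. inv g \<otimes> x \<in> B} \<subseteq> {g \<in> topspace T. V g \<in> W}"
      proof
        fix x assume x: "x \<in> {x \<in> carrier G. inv g \<otimes> x \<in> B}"
        define z where "z = inv g \<otimes> x"
        have z: "z \<in> B" "x = g \<otimes> z" "z \<in> carrier G" using x gc by (auto simp: z_def)
        then have "V z = z [^] int m" using V(3) B(2) by (auto simp: int_pow_int)
        also have "\<dots> \<in> B" using subgroup_int_pow_closed[OF B(1) z(1)] .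
        finally have "V z \<in> U" using B(3) by blast
        then have "V g \<otimes> V z \<in> W" using U(2) by blast
        then have "V x \<in> W" using V(2)[OF gc z(3)] z(2) by simp
        then show "x \<in> {g \<in> topspace T. V g \<in> W}" using x by simp
      qed
      moreover have "openin T {x \<in> carrier G. inv g \<otimes> x \<in> B}" using openin_lcoset[OF B(4) gc] .
      moreover have "g \<in> {x \<in> carrier G. inv g \<otimes> x \<in> B}" using gc subgroup.one_closed[OF B(1)] by simp
      ultimately show "\<exists>S. openin T S \<and> g \<in> S \<and> S \<subseteq> {g \<in> topspace T. V g \<in> W}" by blast
    qed
  qed
  have Vpow: "V (y [^] (i::int)) = V y [^] i" if "y \<in> carrier G" for y i
    using V.hom_int_pow[OF that] .
  have Vnpow: "V (y [^] (i::nat)) = V y [^] i" if "y \<in> carrier G" for y i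
    using V.hom_nat_pow[OF that] .
  have Vprocyclic: "V ` procyclic G y = procyclic G (V y)" if y: "y \<in> carrier G" for y
  proof
    have "compactin T (procyclic G y)"
      using closedin_compact_space[OF compact procyclic_closedin[OF y]] .
    then have "compactin T (V ` procyclic G y)" using image_compactin contV by blast
    then have "closedin T (V ` procyclic G y)" using compactin_imp_closedin[OF Hausdorff] by blast
    then show "procyclic G (V y) \<subseteq> V ` procyclic G y"
      using procyclic_contains_closed[OF Vc[OF y]] Vpow[OF y, symmetric] procyclic_pow[OF y] by auto
    have "closedin T {g \<in> topspace T. V g \<in> procyclic G (V y)}"
      using closedin_continuous_map_preimage[OF contV procyclic_closedin[OF Vc[OF y]]] .
    then have "procyclic G y \<subseteq> {g \<in> topspace T. V g \<in> procyclic G (V y)}"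
      using procyclic_contains_closed[OF y] Vpow[OF y] procyclic_pow[OF Vc[OF y]] y by auto
    then show "V ` procyclic G y \<subseteq> procyclic G (V y)" by blast
  qed
  have VA: "z = \<one>" if "z \<in> A" "V z = \<one>" for z
    using padic_torsion_trivial[OF a, of z m] V(3)[OF that(1)] that m(1) by (simp add: A_def)
  \<comment> \<open>The transfer is injective on the torsion-free \<open>A\<close>, so its kernel
    meets \<open>A\<close> trivially and embeds into the finitely many cosets of
    \<open>A\<close>.\<close>
  define S where "S = {g \<in> carrier G. V g = \<one>}"
  have S: "S \<lhd> G"
    using V.normal_kernel by (simp add: S_def kernel_def)
  have SA: "S \<inter> A \<subseteq> {\<one>}" using VA by (auto simp: S_def)
  have finS: "finite S"
  proof (rule inj_on_finite)
    show "inj_on (\<lambda>s. A #> s) S"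
    proof (rule inj_onI)
      fix s t assume st: "s \<in> S" "t \<in> S" "A #> s = A #> t"
      interpret S: subgroup S G by (rule normal_imp_subgroup[OF S])
      have "inv s \<otimes> t \<in> A"
        using quotient_eq[OF N S.mem_carrier[OF st(1)] S.mem_carrier[OF st(2)]] st(3) by (simp add: A_def)
      moreover have "inv s \<otimes> t \<in> S" using st(1,2) by simp
      ultimately have "inv s \<otimes> t = \<one>" using SA by blast
      then show "s = t" using st(1,2) S.mem_carrier by (metis inv_closed inv_equality inv_inv)
    qed
    show "(\<lambda>s. A #> s) ` S \<subseteq> rcosets A" by (auto simp: S_def RCOSETS_def)
    show "finite (rcosets A)" using finite_rcosets_open[OF N] by (simp add: A_def)
  qed
  have "V a \<noteq> \<one>" using padic_torsion_free[OF a, of m] V(3)[of a] m(1) procyclic_self[OF D(2)] by (auto simp: A_def)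
  \<comment> \<open>\<open>L k\<close> says that \<open>k\<close> is the valuation of some value of
    the transfer; an element attaining the least such \<open>k\<close> generates the image.\<close>
  define L where "L k \<longleftrightarrow> (\<exists>g\<in>carrier G. V g \<noteq> \<one> \<and> V g \<in> procyclic G (a [^] (p ^ k)) \<and> V g \<notin> procyclic G (a [^] (p ^ Suc k)))" for k
  have layer: "\<exists>k. L k \<and> V g \<in> procyclic G (a [^] (p ^ k))" if "g \<in> carrier G" "V g \<noteq> \<one>" for g
    using padic_element_layer[OF a, of "V g"] V(1)[OF that(1)] that unfolding L_def A_def by metis
  define k where "k = (LEAST k. L k)"
  obtain k' where "L k'" using layer[OF D(2) \<open>V a \<noteq> \<one>\<close>] by blast
  then have "L k" unfolding k_def by (rule LeastI)
  then obtain x0 where x0: "x0 \<in> carrier G" "V x0 \<noteq> \<one>" "V x0 \<in> procyclic G (a [^] (p ^ k))" "V x0 \<notin> procyclic G (a [^] (p ^ Suc k))"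
    unfolding L_def by blast
  define b where "b = V x0"
  have b: "procyclic G b = procyclic G (a [^] (p ^ k))" "padic_generator G p b"
    using padic_layer[OF a] x0 by (simp_all add: b_def)
  have Vb: "V g \<in> procyclic G b" if g: "g \<in> carrier G" for g
  proof (cases "V g = \<one>")
    case True
    then show ?thesis using procyclic_one_mem padicD(2)[OF b(2)] by simp
  next
    case False
    then obtain l where l: "L l" "V g \<in> procyclic G (a [^] (p ^ l))" using layer g by blast
    then have "k \<le> l" unfolding k_def by (intro Least_le)
    then have "a [^] (p ^ l) = (a [^] (p ^ k)) [^] (p ^ (l - k))"
      using D(2) by (simp add: nat_pow_pow power_add[symmetric])
    then have "procyclic G (a [^] (p ^ l)) \<subseteq> procyclic G (a [^] (p ^ k))"
      using procyclic_mono[of "a [^] (p ^ k)"] procyclic_nat_pow[of "a [^] (p ^ k)"] D(2) by simp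
    then show ?thesis using l(2) b(1) by blast
  qed
  \<comment> \<open>\<open>m'\<close> is a p-adic unit, so passing from \<open>x0\<close> to
    \<open>x0 [^] m'\<close> does not change the closed subgroup generated by the transfer value,
    while \<open>x [^] (p ^ v) = x0 [^] m\<close> falls into the central \<open>A\<close>.\<close>
  obtain v m' where m': "m = p ^ v * m'" "\<not> p dvd m'"
    using multiplicity_decompose'[of m p] m(1) D(1) by (metis not_prime_unit neq0_conv)
  define x where "x = x0 [^] m'"
  have xc: "x \<in> carrier G" using x0(1) by (simp add: x_def)
  have Vx: "V x = b [^] m'" using Vnpow[OF x0(1)] by (simp add: x_def b_def)
  have bc: "b \<in> carrier G" using padicD(2)[OF b(2)] .
  have Vx_gen: "procyclic G (V x) = procyclic G b"
  proof (rule padic_unit_step[OF b(2)])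
    show "V x \<in> procyclic G b" using Vb[OF xc] .
    show "V x \<notin> procyclic G (b [^] p)"
    proof
      assume "V x \<in> procyclic G (b [^] p)"
      then have "b [^] int m' \<in> procyclic G (b [^] (p ^ 1))" using Vx by (simp add: int_pow_int)
      then have "int (p ^ 1) dvd int m'" by (rule padicD(4)[OF b(2)])
      then show False using m'(2) by (simp only: int_dvd_int_iff power_one_right)
    qed
  qed
  have Vx_padic: "padic_generator G p (V x)" using padic_same_procyclic[OF b(2) Vc[OF xc] Vx_gen] .
  have xm: "x [^] (p ^ v) = x0 [^] m" using x0(1) m'(1) by (simp add: x_def nat_pow_pow mult.commute)
  have xA: "x [^] (p ^ v) \<in> A" using xm m(3)[OF x0(1)] by simp
  have "x [^] (p ^ v) \<noteq> \<one>"
  proof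
    assume "x [^] (p ^ v) = \<one>"
    then have "V x [^] (p ^ v) = \<one>" using Vnpow[OF xc, of "p ^ v"] V.hom_one by simp
    then show False using padic_torsion_free[OF Vx_padic] p1 by fastforce
  qed
  then have xp: "padic_generator G p (x [^] (p ^ v))"
    using padic_element_layer[OF a] xA unfolding A_def by metis
  have x: "padic_generator G p x"
    unfolding padic_generator_def
  proof (intro conjI allI impI)
    have "procyclic G (x [^] (p ^ v)) \<subseteq> procyclic G x"
      using procyclic_mono[OF xc procyclic_nat_pow[OF xc]] .
    then show "openin T (procyclic G x)"
      using openin_subgroup_superset[OF procyclic_subgroup[OF xc] procyclic_subgroup padicD(3)[OF xp]] xc by simp
    show "int (p ^ k) dvd i" if "x [^] (i::int) \<in> procyclic G (x [^] (p ^ k))" for i k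
    proof (rule padicD(4)[OF Vx_padic])
      have "V (x [^] i) \<in> procyclic G (V (x [^] (p ^ k)))" using that Vprocyclic[of "x [^] (p ^ k)"] xc by auto
      then show "V x [^] i \<in> procyclic G (V x [^] (p ^ k))" using Vpow[OF xc] Vnpow[OF xc] by simp
    qed
    show "\<exists>k. x [^] (p ^ k) \<in> N" if "open_normal G N" for N
    proof -
      obtain k where "(x [^] (p ^ v)) [^] (p ^ k) \<in> N" using padicD(5)[OF xp \<open>open_normal G N\<close>] by blast
      then have "x [^] (p ^ (v + k)) \<in> N" using xc by (simp add: nat_pow_pow power_add)
      then show ?thesis by blast
    qed
  qed (use D(1) xc in auto)
  \<comment> \<open>Write a common element as \<open>x [^] i\<close>, \<open>i < p ^ v\<close>,
    times a member of the subgroup generated by \<open>x [^] (p ^ v)\<close>. Its trivial transfer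
    forces \<open>p ^ v\<close> to divide \<open>i\<close>; so \<open>i = 0\<close>, and the element
    lies in \<open>S\<close> and in \<open>A\<close>.\<close>
  have disj: "S \<inter> procyclic G x = {\<one>}"
  proof
    show "S \<inter> procyclic G x \<subseteq> {\<one>}"
    proof
      fix y assume y: "y \<in> S \<inter> procyclic G x"
      have pv: "p ^ v > 0" using p1 by simp
      obtain i :: nat where i: "i < p ^ v" "inv (x [^] i) \<otimes> y \<in> procyclic G (x [^] (p ^ v))"
        using procyclic_cosets[OF xc _ pv] y by blast
      define z where "z = inv (x [^] i) \<otimes> y"
      have yc: "y \<in> carrier G" "V y = \<one>" using y by (auto simp: S_def)
      have zc: "z \<in> carrier G" using yc xc by (simp add: z_def)
      have "V z = inv (V x [^] i) \<otimes> V y" using V(2) yc xc Vnpow[OF xc] by (simp add: z_def)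
      then have Vz: "V z = inv (V x [^] i)" using yc xc Vc by simp
      have "V z \<in> procyclic G (V x [^] (p ^ v))"
        using i(2) Vprocyclic[of "x [^] (p ^ v)"] xc Vnpow[OF xc] unfolding z_def by (metis imageI nat_pow_closed)
      then have "inv (V z) \<in> procyclic G (V x [^] (p ^ v))"
        using subgroup.m_inv_closed[OF procyclic_subgroup] Vc[OF xc] by simp
      then have "V x [^] int i \<in> procyclic G (V x [^] (p ^ v))" using Vz Vc[OF xc] by (simp add: int_pow_int)
      then have "int (p ^ v) dvd int i" by (rule padicD(4)[OF Vx_padic])
      then have "p ^ v dvd i" by (simp only: int_dvd_int_iff)
      then have "i = 0" using i(1) by (auto dest: nat_dvd_not_less)
      then have "y \<in> procyclic G (x [^] (p ^ v))" using i(2) yc by simp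
      also have "\<dots> \<subseteq> A" using xA procyclic_mono[OF D(2)] by (simp add: A_def)
      finally show "y \<in> {\<one>}" using y SA by blast
    qed
  qed (use procyclic_one_mem[OF xc] V.hom_one in \<open>auto simp: S_def\<close>)
  have fact: "\<exists>t\<in>S. \<exists>c\<in>procyclic G x. g = t \<otimes> c" if g: "g \<in> carrier G" for g
  proof -
    have "V g \<in> V ` procyclic G x" using Vb[OF g] Vx_gen Vprocyclic[OF xc] by simp
    then obtain c where c: "c \<in> procyclic G x" "V g = V c" by blast
    have cc: "c \<in> carrier G" using c(1) procyclic_carrier[OF xc] by blast
    have "V (g \<otimes> inv c) = \<one>" using V(2)[OF g inv_closed[OF cc]] V.hom_inv[OF cc] c(2) Vc[OF cc] by simp
    then have "g \<otimes> inv c \<in> S" using g cc by (simp add: S_def)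
    moreover have "g = (g \<otimes> inv c) \<otimes> c" using g cc by (simp add: m_assoc)
    ultimately show ?thesis using c(1) by blast
  qed
  show thesis
    by (rule that[of p x S v]) (use x S finS disj fact central xA in \<open>auto simp: padic_split_def\<close>)
qed

end


section \<open>Isomorphisms from dense subgroups\<close>

text \<open>\<open>\<Delta>\<close> is the graph of an isomorphism between dense subgroups that matches the filtrations
  \<open>U\<close> and \<open>W\<close>; the isomorphism is the extension to the completions.\<close>

locale filtered_correspondence = G: profinite_group G + H: profinite_group H
  for G :: "'a topgroup" and H :: "'b topgroup" +
  fixes \<Delta> :: "('a \<times> 'b) set" and U :: "nat \<Rightarrow> 'a set" and W :: "nat \<Rightarrow> 'b set"
  assumes graph_carrier: "\<Delta> \<subseteq> carrier G \<times> carrier H"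
    and graph_mult: "\<lbrakk>(d, e) \<in> \<Delta>; (d', e') \<in> \<Delta>\<rbrakk> \<Longrightarrow> (d \<otimes>\<^bsub>G\<^esub> d', e \<otimes>\<^bsub>H\<^esub> e') \<in> \<Delta>"
    and graph_inv: "(d, e) \<in> \<Delta> \<Longrightarrow> (inv\<^bsub>G\<^esub> d, inv\<^bsub>H\<^esub> e) \<in> \<Delta>"
    and U_normal: "open_normal G (U k)" and W_normal: "open_normal H (W k)"
    and U_mono: "U (Suc k) \<subseteq> U k" and W_mono: "W (Suc k) \<subseteq> W k"
    and U_base: "open_normal G N \<Longrightarrow> \<exists>k. U k \<subseteq> N"
    and W_base: "open_normal H M \<Longrightarrow> \<exists>k. W k \<subseteq> M"
    and compatible: "(d, e) \<in> \<Delta> \<Longrightarrow> d \<in> U k \<longleftrightarrow> e \<in> W k"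
    and U_dense: "g \<in> carrier G \<Longrightarrow> \<exists>(d, e)\<in>\<Delta>. U k #>\<^bsub>G\<^esub> d = U k #>\<^bsub>G\<^esub> g"
    and W_dense: "h \<in> carrier H \<Longrightarrow> \<exists>(d, e)\<in>\<Delta>. W k #>\<^bsub>H\<^esub> e = W k #>\<^bsub>H\<^esub> h"
begin

text \<open>The graph \<open>\<Delta>\<close> seen at level \<open>k\<close>. A point related to
  \<open>g\<close> at all levels is the value at \<open>g\<close> of the extended
  isomorphism.\<close>

definition rel :: "nat \<Rightarrow> 'a \<Rightarrow> 'b \<Rightarrow> bool" where
  "rel k g h \<longleftrightarrow> (\<exists>(d, e)\<in>\<Delta>. U k #>\<^bsub>G\<^esub> d = U k #>\<^bsub>G\<^esub> g \<and> W k #>\<^bsub>H\<^esub> e = W k #>\<^bsub>H\<^esub> h)"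

text \<open>Compatibility is applied to the quotient of two pairs of \<open>\<Delta>\<close>. One
  direction yields uniqueness of the limit value and continuity; the other yields
  injectivity.\<close>

lemma rel_coset_iff:
  assumes "g \<in> carrier G" "g' \<in> carrier G" "h \<in> carrier H" "h' \<in> carrier H" "rel k g h" "rel k g' h'"
  shows "U k #>\<^bsub>G\<^esub> g = U k #>\<^bsub>G\<^esub> g' \<longleftrightarrow> W k #>\<^bsub>H\<^esub> h = W k #>\<^bsub>H\<^esub> h'"
proof -
  obtain d e where de: "(d, e) \<in> \<Delta>" "U k #>\<^bsub>G\<^esub> d = U k #>\<^bsub>G\<^esub> g" "W k #>\<^bsub>H\<^esub> e = W k #>\<^bsub>H\<^esub> h"
    using assms(5) by (auto simp: rel_def)
  obtain d' e' where de': "(d', e') \<in> \<Delta>" "U k #>\<^bsub>G\<^esub> d' = U k #>\<^bsub>G\<^esub> g'" "W k #>\<^bsub>H\<^esub> e' = W k #>\<^bsub>H\<^esub> h'"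
    using assms(6) by (auto simp: rel_def)
  have c: "d \<in> carrier G" "d' \<in> carrier G" "e \<in> carrier H" "e' \<in> carrier H"
    using de(1) de'(1) graph_carrier by auto
  have "(inv\<^bsub>G\<^esub> d \<otimes>\<^bsub>G\<^esub> d', inv\<^bsub>H\<^esub> e \<otimes>\<^bsub>H\<^esub> e') \<in> \<Delta>"
    using graph_mult[OF graph_inv[OF de(1)] de'(1)] .
  then have "inv\<^bsub>G\<^esub> d \<otimes>\<^bsub>G\<^esub> d' \<in> U k \<longleftrightarrow> inv\<^bsub>H\<^esub> e \<otimes>\<^bsub>H\<^esub> e' \<in> W k" by (rule compatible)
  then have "U k #>\<^bsub>G\<^esub> d = U k #>\<^bsub>G\<^esub> d' \<longleftrightarrow> W k #>\<^bsub>H\<^esub> e = W k #>\<^bsub>H\<^esub> e'"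
    using G.quotient_eq[OF U_normal c(1,2)] H.quotient_eq[OF W_normal c(3,4)] by simp
  then show ?thesis using de de' by simp
qed

lemma rel_mono:
  assumes "g \<in> carrier G" "h \<in> carrier H" "rel (Suc k) g h"
  shows "rel k g h"
proof -
  obtain d e where de: "(d, e) \<in> \<Delta>" "U (Suc k) #>\<^bsub>G\<^esub> d = U (Suc k) #>\<^bsub>G\<^esub> g"
    "W (Suc k) #>\<^bsub>H\<^esub> e = W (Suc k) #>\<^bsub>H\<^esub> h"
    using assms(3) by (auto simp: rel_def)
  have c: "d \<in> carrier G" "e \<in> carrier H" using de(1) graph_carrier by auto
  show ?thesis unfolding rel_def
    using de(1) G.quotient_subset[OF U_normal U_normal U_mono c(1) assms(1) de(2)]
      H.quotient_subset[OF W_normal W_normal W_mono c(2) assms(2) de(3)] by blast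
qed

text \<open>The candidates at level \<open>k\<close> form closed sets, nonempty by density and
  decreasing in \<open>k\<close>, so compactness of the target provides a common one.\<close>

lemma rel_limit:
  assumes g: "g \<in> carrier G"
  obtains h where "h \<in> carrier H" "\<And>k. rel k g h"
proof -
  define R where "R k = {h \<in> carrier H. rel k g h}" for k
  have "(\<Inter>k. R k) \<noteq> {}"
  proof (rule compact_space_imp_nest[OF H.compact])
    show "closedin (grp_topology H) (R k)" for k
      unfolding R_def rel_def
      using H.closedin_coset_pred[OF W_normal[of k], of "\<lambda>c. \<exists>(d, e)\<in>\<Delta>. U k #>\<^bsub>G\<^esub> d = U k #>\<^bsub>G\<^esub> g \<and> W k #>\<^bsub>H\<^esub> e = c"] .
    show "R k \<noteq> {}" for k
    proof -
      obtain d e where "(d, e) \<in> \<Delta>" "U k #>\<^bsub>G\<^esub> d = U k #>\<^bsub>G\<^esub> g" using U_dense[OF g] by blast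
      then have "e \<in> R k" using graph_carrier by (auto simp: R_def rel_def)
      then show ?thesis by blast
    qed
    show "decseq R" unfolding decseq_Suc_iff R_def using rel_mono[OF g] by blast
  qed
  then obtain h where "\<And>k. h \<in> R k" by blast
  then show thesis using that by (auto simp: R_def)
qed

lemma rel_limit_unique:
  assumes "g \<in> carrier G" "h \<in> carrier H" "h' \<in> carrier H" "\<And>k. rel k g h" "\<And>k. rel k g h'"
  shows "h = h'"
proof -
  have "inv\<^bsub>H\<^esub> h \<otimes>\<^bsub>H\<^esub> h' = \<one>\<^bsub>H\<^esub>"
  proof (rule H.open_normal_trivial)
    fix M assume "open_normal H M"
    then obtain k where "W k \<subseteq> M" using W_base by blast
    moreover have "inv\<^bsub>H\<^esub> h \<otimes>\<^bsub>H\<^esub> h' \<in> W k"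
      using rel_coset_iff[OF assms(1,1,2,3) assms(4,5)] H.quotient_eq[OF W_normal assms(2,3)] by blast
    ultimately show "inv\<^bsub>H\<^esub> h \<otimes>\<^bsub>H\<^esub> h' \<in> M" by blast
  qed (use assms in simp)
  then show ?thesis using assms(2,3) by (metis H.inv_closed H.inv_equality H.inv_inv)
qed

lemma rel_mult:
  assumes "g \<in> carrier G" "g' \<in> carrier G" "h \<in> carrier H" "h' \<in> carrier H" "rel k g h" "rel k g' h'"
  shows "rel k (g \<otimes>\<^bsub>G\<^esub> g') (h \<otimes>\<^bsub>H\<^esub> h')"
proof -
  obtain d e where de: "(d, e) \<in> \<Delta>" "U k #>\<^bsub>G\<^esub> d = U k #>\<^bsub>G\<^esub> g" "W k #>\<^bsub>H\<^esub> e = W k #>\<^bsub>H\<^esub> h"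
    using assms(5) by (auto simp: rel_def)
  obtain d' e' where de': "(d', e') \<in> \<Delta>" "U k #>\<^bsub>G\<^esub> d' = U k #>\<^bsub>G\<^esub> g'" "W k #>\<^bsub>H\<^esub> e' = W k #>\<^bsub>H\<^esub> h'"
    using assms(6) by (auto simp: rel_def)
  have c: "d \<in> carrier G" "d' \<in> carrier G" "e \<in> carrier H" "e' \<in> carrier H"
    using de(1) de'(1) graph_carrier by auto
  have "U k #>\<^bsub>G\<^esub> (d \<otimes>\<^bsub>G\<^esub> d') = U k #>\<^bsub>G\<^esub> (g \<otimes>\<^bsub>G\<^esub> g')"
    using G.quotient_mult[OF U_normal[of k] c(1,2)] G.quotient_mult[OF U_normal[of k] assms(1,2)] de(2) de'(2) by simp
  moreover have "W k #>\<^bsub>H\<^esub> (e \<otimes>\<^bsub>H\<^esub> e') = W k #>\<^bsub>H\<^esub> (h \<otimes>\<^bsub>H\<^esub> h')"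
    using H.quotient_mult[OF W_normal[of k] c(3,4)] H.quotient_mult[OF W_normal[of k] assms(3,4)] de(3) de'(3) by simp
  ultimately show ?thesis unfolding rel_def using graph_mult[OF de(1) de'(1)] by blast
qed

text \<open>The hypotheses are symmetric in the two groups, so existence and uniqueness of limits in
  the other direction give surjectivity and injectivity.\<close>

lemma swapped: "filtered_correspondence H G (prod.swap ` \<Delta>) W U"
proof
  show "prod.swap ` \<Delta> \<subseteq> carrier H \<times> carrier G" using graph_carrier by auto
  show "(d \<otimes>\<^bsub>H\<^esub> d', e \<otimes>\<^bsub>G\<^esub> e') \<in> prod.swap ` \<Delta>"
    if "(d, e) \<in> prod.swap ` \<Delta>" "(d', e') \<in> prod.swap ` \<Delta>" for d e d' e'
    using that graph_mult by (auto simp: image_iff Bex_def)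
  show "(inv\<^bsub>H\<^esub> d, inv\<^bsub>G\<^esub> e) \<in> prod.swap ` \<Delta>" if "(d, e) \<in> prod.swap ` \<Delta>" for d e
    using that graph_inv by (auto simp: image_iff Bex_def)
  show "\<exists>(d, e)\<in>prod.swap ` \<Delta>. W k #>\<^bsub>H\<^esub> d = W k #>\<^bsub>H\<^esub> h" if h: "h \<in> carrier H" for h k
  proof -
    obtain d e where "(d, e) \<in> \<Delta>" "W k #>\<^bsub>H\<^esub> e = W k #>\<^bsub>H\<^esub> h" using W_dense[OF h, of k] by auto
    then show ?thesis by (intro bexI[of _ "(e, d)"]) auto
  qed
  show "\<exists>(d, e)\<in>prod.swap ` \<Delta>. U k #>\<^bsub>G\<^esub> e = U k #>\<^bsub>G\<^esub> g" if g: "g \<in> carrier G" for g k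
  proof -
    obtain d e where "(d, e) \<in> \<Delta>" "U k #>\<^bsub>G\<^esub> d = U k #>\<^bsub>G\<^esub> g" using U_dense[OF g, of k] by auto
    then show ?thesis by (intro bexI[of _ "(e, d)"]) auto
  qed
qed (use U_normal W_normal U_mono W_mono U_base W_base compatible in auto)

lemma isomorphism:
  "\<exists>f\<in>iso G H. homeomorphic_map (grp_topology G) (grp_topology H) f"
proof -
  interpret S: filtered_correspondence H G "prod.swap ` \<Delta>" W U by (rule swapped)
  have Srel: "S.rel k h g \<longleftrightarrow> rel k g h" for k g h unfolding S.rel_def rel_def bex_simps(7) by auto
  define f where "f g = (SOME h. h \<in> carrier H \<and> (\<forall>k. rel k g h))" for g
  have f: "f g \<in> carrier H" "rel k g (f g)" if "g \<in> carrier G" for g k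
  proof -
    have "\<exists>h. h \<in> carrier H \<and> (\<forall>k. rel k g h)" using rel_limit[OF that] by metis
    from someI_ex[OF this] show "f g \<in> carrier H" "rel k g (f g)" unfolding f_def by blast+
  qed
  have inj: "inj_on f (carrier G)"
  proof (rule inj_onI)
    fix x y assume xy: "x \<in> carrier G" "y \<in> carrier G" "f x = f y"
    show "x = y"
      using S.rel_limit_unique[of "f x" x y] f xy unfolding Srel by metis
  qed
  have surj: "f ` carrier G = carrier H"
  proof
    show "carrier H \<subseteq> f ` carrier G"
    proof
      fix h assume h: "h \<in> carrier H"
      obtain g where g: "g \<in> carrier G" "\<And>k. S.rel k h g" using S.rel_limit[OF h] by metis
      then have "f g = h" using rel_limit_unique[OF g(1) f(1)[OF g(1)] h] f(2)[OF g(1)] unfolding Srel by blast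
      then show "h \<in> f ` carrier G" using g(1) by blast
    qed
  qed (use f in auto)
  have hom: "f \<in> hom G H"
  proof (rule homI)
    fix x y assume xy: "x \<in> carrier G" "y \<in> carrier G"
    show "f (x \<otimes>\<^bsub>G\<^esub> y) = f x \<otimes>\<^bsub>H\<^esub> f y"
    proof (rule rel_limit_unique[of "x \<otimes>\<^bsub>G\<^esub> y"])
      show "rel k (x \<otimes>\<^bsub>G\<^esub> y) (f x \<otimes>\<^bsub>H\<^esub> f y)" for k
        using rel_mult[OF xy f(1)[OF xy(1)] f(1)[OF xy(2)] f(2)[OF xy(1)] f(2)[OF xy(2)]] .
    qed (use xy f in auto)
  qed (rule f)
  have cont: "continuous_map (grp_topology G) (grp_topology H) f"
    unfolding continuous_map_def
  proof (intro conjI allI impI)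
    show "f \<in> topspace (grp_topology G) \<rightarrow> topspace (grp_topology H)" using f by auto
    fix Y assume Y: "openin (grp_topology H) Y"
    show "openin (grp_topology G) {x \<in> topspace (grp_topology G). f x \<in> Y}"
    proof (subst openin_subopen, intro ballI)
      fix g assume g: "g \<in> {x \<in> topspace (grp_topology G). f x \<in> Y}"
      then have gc: "g \<in> carrier G" "f g \<in> carrier H" using f by auto
      have "openin (grp_topology H) {x \<in> carrier H. f g \<otimes>\<^bsub>H\<^esub> x \<in> Y}"
        using H.openin_lcoset[OF Y, of "inv\<^bsub>H\<^esub> (f g)"] gc by simp
      moreover have "\<one>\<^bsub>H\<^esub> \<in> {x \<in> carrier H. f g \<otimes>\<^bsub>H\<^esub> x \<in> Y}" using g gc by simp
      ultimately obtain M where M: "open_normal H M" "M \<subseteq> {x \<in> carrier H. f g \<otimes>\<^bsub>H\<^esub> x \<in> Y}"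
        using H.open_normal_nbhd_one by blast
      obtain k where k: "W k \<subseteq> M" using W_base[OF M(1)] by blast
      have "{x \<in> carrier G. U k #>\<^bsub>G\<^esub> g = U k #>\<^bsub>G\<^esub> x} \<subseteq> {x \<in> topspace (grp_topology G). f x \<in> Y}"
      proof
        fix x assume x: "x \<in> {x \<in> carrier G. U k #>\<^bsub>G\<^esub> g = U k #>\<^bsub>G\<^esub> x}"
        then have xc: "x \<in> carrier G" "f x \<in> carrier H" using f by auto
        have "W k #>\<^bsub>H\<^esub> f g = W k #>\<^bsub>H\<^esub> f x"
          using rel_coset_iff[OF gc(1) xc(1) gc(2) xc(2) f(2)[OF gc(1)] f(2)[OF xc(1)]] x by blast
        then have "inv\<^bsub>H\<^esub> f g \<otimes>\<^bsub>H\<^esub> f x \<in> W k" using H.quotient_eq[OF W_normal gc(2) xc(2)] by blast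
        then have "f g \<otimes>\<^bsub>H\<^esub> (inv\<^bsub>H\<^esub> f g \<otimes>\<^bsub>H\<^esub> f x) \<in> Y" using k M(2) by blast
        then show "x \<in> {x \<in> topspace (grp_topology G). f x \<in> Y}" using gc xc by simp
      qed
      then show "\<exists>S. openin (grp_topology G) S \<and> g \<in> S \<and> S \<subseteq> {x \<in> topspace (grp_topology G). f x \<in> Y}"
        using G.openin_coset_pred[OF U_normal[of k], of "\<lambda>c. U k #>\<^bsub>G\<^esub> g = c"] gc(1)
        by (intro exI[of _ "{x \<in> carrier G. U k #>\<^bsub>G\<^esub> g = U k #>\<^bsub>G\<^esub> x}"]) blast
    qed
  qed
  have "homeomorphic_map (grp_topology G) (grp_topology H) f"
    using continuous_imp_homeomorphic_map[OF cont G.compact H.Hausdorff] surj inj by simp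
  moreover have "f \<in> iso G H" using hom inj surj by (simp add: iso_def bij_betw_def)
  ultimately show ?thesis by blast
qed

end


section \<open>Finite codes\<close>

text \<open>A code records the multiplication table of \<open>S\<close> and the conjugation action of \<open>x\<close> on it.\<close>

definition has_code :: "('a, 'b) monoid_scheme \<Rightarrow> 'a \<Rightarrow> 'a set \<Rightarrow> nat list list \<Rightarrow> nat list \<Rightarrow> bool" where
  "has_code G x S M s \<longleftrightarrow> (\<exists>e. bij_betw e {..<length s} S \<and> length M = length s \<and>
     (\<forall>i<length s. length (M ! i) = length s \<and> s ! i < length s \<and>
        x \<otimes>\<^bsub>G\<^esub> e i \<otimes>\<^bsub>G\<^esub> inv\<^bsub>G\<^esub> x = e (s ! i) \<and>
        (\<forall>j<length s. M ! i ! j < length s \<and> e i \<otimes>\<^bsub>G\<^esub> e j = e (M ! i ! j))))"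

lemma has_code_exists:
  assumes fin: "finite S" and mult: "\<And>a b. \<lbrakk>a \<in> S; b \<in> S\<rbrakk> \<Longrightarrow> a \<otimes>\<^bsub>G\<^esub> b \<in> S"
    and conj: "\<And>a. a \<in> S \<Longrightarrow> x \<otimes>\<^bsub>G\<^esub> a \<otimes>\<^bsub>G\<^esub> inv\<^bsub>G\<^esub> x \<in> S"
  obtains M s where "has_code G x S M s"
proof -
  define n where "n = card S"
  obtain e where e: "bij_betw e {..<n} S"
    using ex_bij_betw_nat_finite[OF fin] by (auto simp: n_def atLeast0LessThan)
  define d where "d = the_inv_into {..<n} e"
  have d: "d a < n" "e (d a) = a" if "a \<in> S" for a
    using that f_the_inv_into_f_bij_betw[OF e] bij_betw_the_inv_into[OF e] by (auto simp: d_def bij_betw_def)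
  have eS: "e i \<in> S" if "i < n" for i using e that by (auto simp: bij_betw_def)
  have "has_code G x S (map (\<lambda>i. map (\<lambda>j. d (e i \<otimes>\<^bsub>G\<^esub> e j)) [0..<n]) [0..<n])
     (map (\<lambda>i. d (x \<otimes>\<^bsub>G\<^esub> e i \<otimes>\<^bsub>G\<^esub> inv\<^bsub>G\<^esub> x)) [0..<n])"
    unfolding has_code_def using e d mult conj eS by (intro exI[of _ e]) auto
  then show thesis by (rule that)
qed

lemma has_code_bounded:
  assumes "has_code G x S M s"
  shows "length s = card S" "set s \<subseteq> {..<card S}" "length M = card S"
    "set M \<subseteq> {r. set r \<subseteq> {..<card S} \<and> length r \<le> card S}"
proof -
  obtain e where e: "bij_betw e {..<length s} S" "length M = length s"
     "\<And>i. i < length s \<Longrightarrow> length (M ! i) = length s \<and> s ! i < length s \<and> (\<forall>j<length s. M ! i ! j < length s)"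
    using assms unfolding has_code_def by blast
  show l: "length s = card S" using bij_betw_same_card[OF e(1)] by simp
  show "length M = card S" using e(2) l by simp
  show "set s \<subseteq> {..<card S}" using e(3) l by (auto simp: in_set_conv_nth)
  show "set M \<subseteq> {r. set r \<subseteq> {..<card S} \<and> length r \<le> card S}"
    using e(2,3) l by (auto simp: in_set_conv_nth)
qed

lemma has_code_bij:
  assumes G: "has_code G x S M s" and H: "has_code H y R M s"
  obtains \<psi> where "bij_betw \<psi> S R"
    "\<And>a b. \<lbrakk>a \<in> S; b \<in> S\<rbrakk> \<Longrightarrow> \<psi> (a \<otimes>\<^bsub>G\<^esub> b) = \<psi> a \<otimes>\<^bsub>H\<^esub> \<psi> b"
    "\<And>a. a \<in> S \<Longrightarrow> \<psi> (x \<otimes>\<^bsub>G\<^esub> a \<otimes>\<^bsub>G\<^esub> inv\<^bsub>G\<^esub> x) = y \<otimes>\<^bsub>H\<^esub> \<psi> a \<otimes>\<^bsub>H\<^esub> inv\<^bsub>H\<^esub> y"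
proof -
  obtain e where e: "bij_betw e {..<length s} S"
     "\<And>i. i < length s \<Longrightarrow> s ! i < length s \<and> x \<otimes>\<^bsub>G\<^esub> e i \<otimes>\<^bsub>G\<^esub> inv\<^bsub>G\<^esub> x = e (s ! i)"
     "\<And>i j. \<lbrakk>i < length s; j < length s\<rbrakk> \<Longrightarrow> M ! i ! j < length s \<and> e i \<otimes>\<^bsub>G\<^esub> e j = e (M ! i ! j)"
    using G unfolding has_code_def by blast
  obtain f where f: "bij_betw f {..<length s} R"
     "\<And>i. i < length s \<Longrightarrow> y \<otimes>\<^bsub>H\<^esub> f i \<otimes>\<^bsub>H\<^esub> inv\<^bsub>H\<^esub> y = f (s ! i)"
     "\<And>i j. \<lbrakk>i < length s; j < length s\<rbrakk> \<Longrightarrow> f i \<otimes>\<^bsub>H\<^esub> f j = f (M ! i ! j)"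
    using H unfolding has_code_def by blast
  define d where "d = the_inv_into {..<length s} e"
  have d: "d a < length s" "e (d a) = a" if "a \<in> S" for a
    using that f_the_inv_into_f_bij_betw[OF e(1)] bij_betw_the_inv_into[OF e(1)] by (auto simp: d_def bij_betw_def)
  have de: "d (e i) = i" if "i < length s" for i
    using that e(1) by (simp add: d_def the_inv_into_f_f bij_betw_def)
  show thesis
  proof (rule that[of "f \<circ> d"])
    show "bij_betw (f \<circ> d) S R"
      using bij_betw_trans[OF bij_betw_the_inv_into[OF e(1)] f(1)] by (simp add: d_def)
    show "(f \<circ> d) (a \<otimes>\<^bsub>G\<^esub> b) = (f \<circ> d) a \<otimes>\<^bsub>H\<^esub> (f \<circ> d) b" if ab: "a \<in> S" "b \<in> S" for a b
    proof -
      have "a \<otimes>\<^bsub>G\<^esub> b = e (M ! d a ! d b)" using e(3)[OF d(1)[OF ab(1)] d(1)[OF ab(2)]] d(2) ab by simp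
      then show ?thesis using de e(3) f(3) d ab by simp
    qed
    show "(f \<circ> d) (x \<otimes>\<^bsub>G\<^esub> a \<otimes>\<^bsub>G\<^esub> inv\<^bsub>G\<^esub> x) = y \<otimes>\<^bsub>H\<^esub> (f \<circ> d) a \<otimes>\<^bsub>H\<^esub> inv\<^bsub>H\<^esub> y" if a: "a \<in> S" for a
    proof -
      have "x \<otimes>\<^bsub>G\<^esub> a \<otimes>\<^bsub>G\<^esub> inv\<^bsub>G\<^esub> x = e (s ! d a)" using e(2)[OF d(1)[OF a]] d(2)[OF a] by simp
      then show ?thesis using de e(2) f(2) d a by simp
    qed
  qed
qed

text \<open>\<open>0\<close> is not prime and so is free to mark finite groups, where
  \<open>s\<close> records conjugation by the identity. The level \<open>v\<close> is left to each
  group: equal codes are compared beyond the larger of the two levels.\<close>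

definition profinite_code :: "'a topgroup \<Rightarrow> nat \<times> nat list list \<times> nat list \<Rightarrow> bool" where
  "profinite_code G c \<longleftrightarrow> (case c of (p, M, s) \<Rightarrow>
     if p = 0 then finite (carrier G) \<and> has_code G \<one>\<^bsub>G\<^esub> (carrier G) M s
     else \<exists>x S v. padic_split G p x S v \<and> has_code G x S M s)"

section \<open>Groups with equal codes are isomorphic\<close>

context profinite_group
begin

lemma open_normal_one:
  assumes "finite (carrier G)"
  shows "open_normal G {\<one>}"
proof -
  have "closedin T (carrier G - {\<one>})"
    using closedin_Hausdorff_finite[OF Hausdorff, of "carrier G - {\<one>}"] assms by simp
  then have "openin T (topspace T - (carrier G - {\<one>}))" by blast
  moreover have "topspace T - (carrier G - {\<one>}) = {\<one>}" by auto
  ultimately show ?thesis using one_is_normal by (simp add: open_normal_def)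
qed

lemma open_normal_central_procyclic:
  assumes x: "x \<in> carrier G" "openin T (procyclic G x)" and c: "\<And>g. g \<in> carrier G \<Longrightarrow> x \<otimes> g = g \<otimes> x"
  shows "open_normal G (procyclic G x)"
  unfolding open_normal_def normal_inv_iff
proof (intro conjI ballI)
  fix g h assume g: "g \<in> carrier G" and h: "h \<in> procyclic G x"
  have "h \<otimes> g = g \<otimes> h" using procyclic_commute[OF x(1) g c[OF g] h] .
  moreover have "h \<in> carrier G" using h procyclic_carrier[OF x(1)] by blast
  ultimately have "g \<otimes> h \<otimes> inv g = h" using g by (metis inv_closed m_assoc r_inv r_one)
  then show "g \<otimes> h \<otimes> inv g \<in> procyclic G x" using h by simp
qed (use x procyclic_subgroup in auto)

text \<open>Supplies what \<open>filtered_correspondence\<close> asks of one side. Starting the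
  layers at some \<open>w \<ge> v\<close> makes them central, hence normal, and leaves room to use a
  common \<open>w\<close> for two groups.\<close>

lemma padic_filtration:
  assumes "padic_split G p x S v" "v \<le> w"
  shows "open_normal G (procyclic G (x [^] (p ^ (w + k))))"
    "procyclic G (x [^] (p ^ (w + Suc k))) \<subseteq> procyclic G (x [^] (p ^ (w + k)))"
    "open_normal G N \<Longrightarrow> \<exists>k. procyclic G (x [^] (p ^ (w + k))) \<subseteq> N"
    "\<lbrakk>t \<in> S; t \<otimes> x [^] (i::int) \<in> procyclic G (x [^] (p ^ (w + k)))\<rbrakk> \<Longrightarrow> t = \<one> \<and> int (p ^ (w + k)) dvd i"
    "int (p ^ (w + k)) dvd i \<Longrightarrow> x [^] (i::int) \<in> procyclic G (x [^] (p ^ (w + k)))"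
    "g \<in> carrier G \<Longrightarrow> \<exists>t\<in>S. \<exists>i::int. procyclic G (x [^] (p ^ (w + k))) #> (t \<otimes> x [^] i) = procyclic G (x [^] (p ^ (w + k))) #> g"
proof -
  have x: "padic_generator G p x" and S: "S \<lhd> G" "S \<inter> procyclic G x = {\<one>}"
    and fact: "\<And>g. g \<in> carrier G \<Longrightarrow> \<exists>t\<in>S. \<exists>c\<in>procyclic G x. g = t \<otimes> c"
    and cen: "\<And>g. g \<in> carrier G \<Longrightarrow> x [^] (p ^ v) \<otimes> g = g \<otimes> x [^] (p ^ v)"
    using assms(1) by (auto simp: padic_split_def)
  note D = padicD[OF x]
  have p0: "p > 0" using D(1) prime_gt_0_nat by blast
  have sub: "procyclic G (x [^] (p ^ (i + j))) \<subseteq> procyclic G (x [^] (p ^ i))" for i j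
  proof -
    have "x [^] (p ^ (i + j)) = (x [^] (p ^ i)) [^] (p ^ j)" using D(2) by (simp add: nat_pow_pow power_add)
    then show ?thesis using procyclic_mono[of "x [^] (p ^ i)"] procyclic_nat_pow[of "x [^] (p ^ i)"] D(2) by simp
  qed
  have xsub: "procyclic G (x [^] (p ^ i)) \<subseteq> procyclic G x" for i
    using procyclic_mono[OF D(2) procyclic_nat_pow[OF D(2)]] .
  define U where "U = procyclic G (x [^] (p ^ (w + k)))"
  show N: "open_normal G (procyclic G (x [^] (p ^ (w + k))))"
  proof (rule open_normal_central_procyclic)
    show "openin T (procyclic G (x [^] (p ^ (w + k))))" using openin_procyclic_pow[OF D(2,3)] p0 by simp
    have "procyclic G (x [^] (p ^ (w + k))) \<subseteq> procyclic G (x [^] (p ^ v))"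
      using sub[of v "w + k - v"] assms(2) by simp
    then have "x [^] (p ^ (w + k)) \<in> procyclic G (x [^] (p ^ v))" using procyclic_self D(2) by blast
    then show "x [^] (p ^ (w + k)) \<otimes> g = g \<otimes> x [^] (p ^ (w + k))" if "g \<in> carrier G" for g
      using procyclic_commute[OF _ that cen[OF that]] D(2) by simp
  qed (use D(2) in simp)
  show "procyclic G (x [^] (p ^ (w + Suc k))) \<subseteq> procyclic G (x [^] (p ^ (w + k)))"
    using sub[of "w + k" 1] by simp
  show "\<exists>k. procyclic G (x [^] (p ^ (w + k))) \<subseteq> N" if N: "open_normal G N"
  proof -
    obtain k where "x [^] (p ^ k) \<in> N" using D(5)[OF N] by blast
    then have "procyclic G (x [^] (p ^ k)) \<subseteq> N" by (rule procyclic_open_normal[OF N])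
    then have "procyclic G (x [^] (p ^ (w + k))) \<subseteq> N" using sub[of k w] by (simp add: add.commute)
    then show ?thesis by blast
  qed
  show "t = \<one> \<and> int (p ^ (w + k)) dvd i"
    if t: "t \<in> S" and tx: "t \<otimes> x [^] (i::int) \<in> procyclic G (x [^] (p ^ (w + k)))"
  proof -
    interpret P: subgroup "procyclic G x" G using procyclic_subgroup[OF D(2)] .
    have tc: "t \<in> carrier G" using subgroup.mem_carrier[OF normal_imp_subgroup[OF S(1)] t] .
    have "t \<otimes> x [^] i \<in> procyclic G x" using tx xsub by blast
    then have "(t \<otimes> x [^] i) \<otimes> inv (x [^] i) \<in> procyclic G x" using procyclic_pow[OF D(2)] by blast
    then have "t \<in> procyclic G x" using tc D(2) by (simp add: m_assoc)
    then have t1: "t = \<one>" using S(2) t by blast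
    then have "x [^] i \<in> procyclic G (x [^] (p ^ (w + k)))" using tx D(2) by simp
    then show ?thesis using D(4) t1 by blast
  qed
  show "x [^] i \<in> procyclic G (x [^] (p ^ (w + k)))" if dv: "int (p ^ (w + k)) dvd i" for i :: int
  proof -
    obtain j where "i = int (p ^ (w + k)) * j" using dv by blast
    then have "x [^] i = (x [^] (p ^ (w + k))) [^] j" using D(2) by (metis int_pow_int int_pow_pow)
    then show ?thesis using procyclic_pow D(2) by simp
  qed
  show "\<exists>t\<in>S. \<exists>i::int. procyclic G (x [^] (p ^ (w + k))) #> (t \<otimes> x [^] i) = procyclic G (x [^] (p ^ (w + k))) #> g"
    if g: "g \<in> carrier G"
  proof -
    obtain t c where tc: "t \<in> S" "c \<in> procyclic G x" "g = t \<otimes> c" using fact[OF g] by blast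
    have car: "t \<in> carrier G" "c \<in> carrier G"
      using subgroup.mem_carrier[OF normal_imp_subgroup[OF S(1)] tc(1)] procyclic_carrier[OF D(2)] tc(2) by auto
    have U: "openin T U" "\<one> \<in> U"
      using N procyclic_one_mem D(2) by (auto simp: U_def open_normal_def)
    obtain i :: int where i: "inv c \<otimes> x [^] i \<in> U" using procyclic_approx[OF D(2) tc(2) U] .
    have "inv g \<otimes> (t \<otimes> x [^] i) = inv c \<otimes> x [^] i"
      using tc(3) car D(2) by (simp add: inv_mult_group m_assoc)
    then have "U #> g = U #> (t \<otimes> x [^] i)"
      using quotient_eq[OF N g, of "t \<otimes> x [^] i"] i car D(2) by (simp add: U_def)
    then show ?thesis using tc(1) unfolding U_def by metis
  qed
qed

end

text \<open>A finite profinite group is discrete, so the constant filtration by the trivial subgroup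
  and the full graph of the bijection fit the general extension.\<close>

lemma finite_code_iso:
  assumes G: "profinite_group G" "finite (carrier G)" "has_code G x (carrier G) M s"
    and H: "profinite_group H" "finite (carrier H)" "has_code H y (carrier H) M s"
  shows "\<exists>f\<in>iso G H. homeomorphic_map (grp_topology G) (grp_topology H) f"
proof -
  interpret G: profinite_group G by fact
  interpret H: profinite_group H by fact
  obtain \<psi> where \<psi>: "bij_betw \<psi> (carrier G) (carrier H)"
    "\<And>a b. \<lbrakk>a \<in> carrier G; b \<in> carrier G\<rbrakk> \<Longrightarrow> \<psi> (a \<otimes>\<^bsub>G\<^esub> b) = \<psi> a \<otimes>\<^bsub>H\<^esub> \<psi> b"
    using has_code_bij[OF G(3) H(3)] by metis
  have \<psi>c: "\<psi> a \<in> carrier H" if "a \<in> carrier G" for a using \<psi>(1) that by (auto simp: bij_betw_def)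
  interpret P: group_hom G H \<psi>
    by unfold_locales (use \<psi> \<psi>c in \<open>auto simp: hom_def\<close>)
  interpret F: filtered_correspondence G H "(\<lambda>g. (g, \<psi> g)) ` carrier G" "\<lambda>_. {\<one>\<^bsub>G\<^esub>}" "\<lambda>_. {\<one>\<^bsub>H\<^esub>}"
  proof
    show "open_normal G {\<one>\<^bsub>G\<^esub>}" using G.open_normal_one[OF G(2)] .
    show "open_normal H {\<one>\<^bsub>H\<^esub>}" using H.open_normal_one[OF H(2)] .
    show "\<exists>k::nat. {\<one>\<^bsub>G\<^esub>} \<subseteq> N" if "open_normal G N" for N
      using subgroup.one_closed[OF G.open_normal_subgroup[OF that]] by simp
    show "\<exists>k::nat. {\<one>\<^bsub>H\<^esub>} \<subseteq> N" if "open_normal H N" for N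
      using subgroup.one_closed[OF H.open_normal_subgroup[OF that]] by simp
    show "d \<in> {\<one>\<^bsub>G\<^esub>} \<longleftrightarrow> e \<in> {\<one>\<^bsub>H\<^esub>}" if "(d, e) \<in> (\<lambda>g. (g, \<psi> g)) ` carrier G" for d e
    proof -
      have de: "d \<in> carrier G" "e = \<psi> d" using that by auto
      have "\<psi> d = \<one>\<^bsub>H\<^esub> \<Longrightarrow> d = \<one>\<^bsub>G\<^esub>"
        using \<psi>(1) de(1) P.hom_one by (metis G.one_closed bij_betw_def inj_onD)
      then show ?thesis using de by auto
    qed
    show "\<exists>(d, e)\<in>(\<lambda>g. (g, \<psi> g)) ` carrier G. {\<one>\<^bsub>G\<^esub>} #>\<^bsub>G\<^esub> d = {\<one>\<^bsub>G\<^esub>} #>\<^bsub>G\<^esub> g" if "g \<in> carrier G" for g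
      using that by auto
    show "\<exists>(d, e)\<in>(\<lambda>g. (g, \<psi> g)) ` carrier G. {\<one>\<^bsub>H\<^esub>} #>\<^bsub>H\<^esub> e = {\<one>\<^bsub>H\<^esub>} #>\<^bsub>H\<^esub> h" if "h \<in> carrier H" for h
    proof -
      obtain g where "g \<in> carrier G" "h = \<psi> g" using \<psi>(1) \<open>h \<in> carrier H\<close> by (auto simp: bij_betw_def)
      then show ?thesis by auto
    qed
  qed (use \<psi>(2) \<psi>c in auto)
  show ?thesis by (rule F.isomorphism)
qed

text \<open>The correspondence sends \<open>t\<close> times the i-th power of \<open>x\<close> to
  \<open>\<psi> t\<close> times the i-th power of \<open>y\<close>. It is multiplicative because
  \<open>\<psi>\<close> intertwines conjugation by all integer powers, and it respects the layers
  because membership in them means trivial \<open>t\<close> and divisibility of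
  \<open>i\<close>.\<close>

lemma padic_code_iso:
  assumes G: "profinite_group G" "padic_split G p x S v" "has_code G x S M s"
    and H: "profinite_group H" "padic_split H p y R u" "has_code H y R M s"
  shows "\<exists>f\<in>iso G H. homeomorphic_map (grp_topology G) (grp_topology H) f"
proof -
  interpret G: profinite_group G by fact
  interpret H: profinite_group H by fact
  obtain \<psi> where \<psi>: "bij_betw \<psi> S R"
    "\<And>a b. \<lbrakk>a \<in> S; b \<in> S\<rbrakk> \<Longrightarrow> \<psi> (a \<otimes>\<^bsub>G\<^esub> b) = \<psi> a \<otimes>\<^bsub>H\<^esub> \<psi> b"
    "\<And>a. a \<in> S \<Longrightarrow> \<psi> (x \<otimes>\<^bsub>G\<^esub> a \<otimes>\<^bsub>G\<^esub> inv\<^bsub>G\<^esub> x) = y \<otimes>\<^bsub>H\<^esub> \<psi> a \<otimes>\<^bsub>H\<^esub> inv\<^bsub>H\<^esub> y"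
    using has_code_bij[OF G(3) H(3)] by metis
  have xc: "x \<in> carrier G" and yc: "y \<in> carrier H"
    using G(2) H(2) by (auto simp: padic_split_def padic_generator_def)
  have nS: "S \<lhd> G" and nR: "R \<lhd> H" using G(2) H(2) by (auto simp: padic_split_def)
  interpret S: normal S G by fact
  interpret R: normal R H by fact
  have \<psi>R: "\<psi> a \<in> R" if "a \<in> S" for a using \<psi>(1) that by (auto simp: bij_betw_def)
  have SC: "a \<in> carrier G" if "a \<in> S" for a using that by (rule S.mem_carrier)
  have RC: "\<psi> a \<in> carrier H" if "a \<in> S" for a using R.mem_carrier[OF \<psi>R[OF that]] .
  have \<psi>1: "\<psi> \<one>\<^bsub>G\<^esub> = \<one>\<^bsub>H\<^esub>"
  proof -
    have "\<psi> \<one>\<^bsub>G\<^esub> \<otimes>\<^bsub>H\<^esub> \<psi> \<one>\<^bsub>G\<^esub> = \<psi> \<one>\<^bsub>G\<^esub>" using \<psi>(2)[OF S.one_closed S.one_closed] by simp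
    then show ?thesis using RC[OF S.one_closed] by (metis H.l_cancel_one)
  qed
  have \<psi>inv: "\<psi> (inv\<^bsub>G\<^esub> a) = inv\<^bsub>H\<^esub> (\<psi> a)" if a: "a \<in> S" for a
  proof -
    have "\<psi> (inv\<^bsub>G\<^esub> a) \<otimes>\<^bsub>H\<^esub> \<psi> a = \<one>\<^bsub>H\<^esub>"
      using \<psi>(2)[OF S.m_inv_closed[OF a] a] SC[OF a] \<psi>1 by simp
    then show ?thesis using RC[OF a] RC[OF S.m_inv_closed[OF a]] by (metis H.inv_equality)
  qed
  define cx where "cx i a = x [^]\<^bsub>G\<^esub> i \<otimes>\<^bsub>G\<^esub> a \<otimes>\<^bsub>G\<^esub> inv\<^bsub>G\<^esub> (x [^]\<^bsub>G\<^esub> i)" for i :: int and a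
  define cy where "cy i a = y [^]\<^bsub>H\<^esub> i \<otimes>\<^bsub>H\<^esub> a \<otimes>\<^bsub>H\<^esub> inv\<^bsub>H\<^esub> (y [^]\<^bsub>H\<^esub> i)" for i :: int and a
  have cxS: "cx i a \<in> S" if "a \<in> S" for i a unfolding cx_def using S.inv_op_closed2[of "x [^]\<^bsub>G\<^esub> i" a] that xc by simp
  have cx_add: "cx (i + j) a = cx i (cx j a)" if "a \<in> S" for i j a
    using that xc SC by (simp add: cx_def G.int_pow_mult G.inv_mult_group G.m_assoc)
  have cy_add: "cy (i + j) a = cy i (cy j a)" if "a \<in> carrier H" for i j a
    using that yc by (simp add: cy_def H.int_pow_mult H.inv_mult_group H.m_assoc)
  have \<psi>c1: "\<psi> (cx 1 a) = cy 1 (\<psi> a)" if "a \<in> S" for a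
    using \<psi>(3)[OF that] xc yc by (simp add: cx_def cy_def)
  have cx0: "cx 0 a = a" if "a \<in> S" for a using SC[OF that] by (simp add: cx_def)
  have cy0: "cy 0 a = a" if "a \<in> carrier H" for a using that by (simp add: cy_def)
  \<comment> \<open>The code only describes conjugation by the generator itself; inverting it
    supplies the downward step of the induction over the integers.\<close>
  have \<psi>cm1: "\<psi> (cx (-1) a) = cy (-1) (\<psi> a)" if a: "a \<in> S" for a
  proof -
    have "cx 1 (cx (-1) a) = a" using cx_add[OF a, of 1 "-1"] cx0[OF a] by simp
    then have "\<psi> a = cy 1 (\<psi> (cx (-1) a))" using \<psi>c1[OF cxS[OF a]] by metis
    then have "cy (-1) (\<psi> a) = cy (-1) (cy 1 (\<psi> (cx (-1) a)))" by simp
    also have "\<dots> = \<psi> (cx (-1) a)"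
      using cy_add[OF RC[OF cxS[OF a]], of "-1" 1 "-1"] cy0[OF RC[OF cxS[OF a]]] by simp
    finally show ?thesis by simp
  qed
  have \<psi>c: "\<psi> (cx i a) = cy i (\<psi> a)" if a: "a \<in> S" for i a
  proof (induction i rule: int_induct[of _ 0])
    case base
    then show ?case using cx0[OF a] cy0[OF RC[OF a]] by simp
  next
    case (step1 i)
    have "\<psi> (cx (i + 1) a) = \<psi> (cx 1 (cx i a))" using cx_add[OF a, of 1 i] by (simp add: add.commute)
    also have "\<dots> = cy 1 (cy i (\<psi> a))" using \<psi>c1[OF cxS[OF a]] step1 by simp
    also have "\<dots> = cy (i + 1) (\<psi> a)" using cy_add[OF RC[OF a], of 1 i] by (simp add: add.commute)
    finally show ?case .
  next
    case (step2 i)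
    have "\<psi> (cx (i - 1) a) = \<psi> (cx (-1) (cx i a))" using cx_add[OF a, of "-1" i] by simp
    also have "\<dots> = cy (-1) (cy i (\<psi> a))" using \<psi>cm1[OF cxS[OF a]] step2 by simp
    also have "\<dots> = cy (i - 1) (\<psi> a)" using cy_add[OF RC[OF a], of "-1" i] by simp
    finally show ?case .
  qed
  define \<Delta> where "\<Delta> = {(t \<otimes>\<^bsub>G\<^esub> x [^]\<^bsub>G\<^esub> (i::int), \<psi> t \<otimes>\<^bsub>H\<^esub> y [^]\<^bsub>H\<^esub> i) |t i. t \<in> S}"
  have \<Delta>I: "(t \<otimes>\<^bsub>G\<^esub> x [^]\<^bsub>G\<^esub> (i::int), \<psi> t \<otimes>\<^bsub>H\<^esub> y [^]\<^bsub>H\<^esub> i) \<in> \<Delta>" if "t \<in> S" for t i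
    using that by (auto simp: \<Delta>_def)
  have \<Delta>E: "\<exists>t\<in>S. \<exists>i::int. d = t \<otimes>\<^bsub>G\<^esub> x [^]\<^bsub>G\<^esub> i \<and> e = \<psi> t \<otimes>\<^bsub>H\<^esub> y [^]\<^bsub>H\<^esub> i" if "(d, e) \<in> \<Delta>" for d e
    using that by (auto simp: \<Delta>_def)
  \<comment> \<open>Beyond both levels the layers are central in the respective group, so the two
    filtrations can share their indices.\<close>
  define w where "w = max u v"
  have uw: "u \<le> w" and vw: "v \<le> w" by (auto simp: w_def)
  note FG = G.padic_filtration[OF G(2) vw]
  note FH = H.padic_filtration[OF H(2) uw]
  interpret F: filtered_correspondence G H \<Delta> "\<lambda>k. procyclic G (x [^]\<^bsub>G\<^esub> (p ^ (w + k)))" "\<lambda>k. procyclic H (y [^]\<^bsub>H\<^esub> (p ^ (w + k)))"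
  proof
    show "\<Delta> \<subseteq> carrier G \<times> carrier H" using xc yc SC RC by (auto simp: \<Delta>_def)
    show "(d \<otimes>\<^bsub>G\<^esub> d', e \<otimes>\<^bsub>H\<^esub> e') \<in> \<Delta>" if de: "(d, e) \<in> \<Delta>" "(d', e') \<in> \<Delta>" for d e d' e'
    proof -
      obtain t i where t: "t \<in> S" "d = t \<otimes>\<^bsub>G\<^esub> x [^]\<^bsub>G\<^esub> (i::int)" "e = \<psi> t \<otimes>\<^bsub>H\<^esub> y [^]\<^bsub>H\<^esub> i" using \<Delta>E[OF de(1)] by blast
      obtain t' j where t': "t' \<in> S" "d' = t' \<otimes>\<^bsub>G\<^esub> x [^]\<^bsub>G\<^esub> (j::int)" "e' = \<psi> t' \<otimes>\<^bsub>H\<^esub> y [^]\<^bsub>H\<^esub> j" using \<Delta>E[OF de(2)] by blast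
      have "d \<otimes>\<^bsub>G\<^esub> d' = (t \<otimes>\<^bsub>G\<^esub> cx i t') \<otimes>\<^bsub>G\<^esub> x [^]\<^bsub>G\<^esub> (i + j)"
        using t t' SC xc by (simp add: cx_def G.int_pow_mult G.m_assoc)
      moreover have "e \<otimes>\<^bsub>H\<^esub> e' = (\<psi> t \<otimes>\<^bsub>H\<^esub> cy i (\<psi> t')) \<otimes>\<^bsub>H\<^esub> y [^]\<^bsub>H\<^esub> (i + j)"
        using t t' RC yc by (simp add: cy_def H.int_pow_mult H.m_assoc)
      moreover have "\<psi> t \<otimes>\<^bsub>H\<^esub> cy i (\<psi> t') = \<psi> (t \<otimes>\<^bsub>G\<^esub> cx i t')"
        using \<psi>(2)[OF t(1) cxS[OF t'(1)]] \<psi>c[OF t'(1)] by simp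
      ultimately show ?thesis using \<Delta>I[OF S.m_closed[OF t(1) cxS[OF t'(1)]]] by simp
    qed
    show "(inv\<^bsub>G\<^esub> d, inv\<^bsub>H\<^esub> e) \<in> \<Delta>" if de: "(d, e) \<in> \<Delta>" for d e
    proof -
      obtain t i where t: "t \<in> S" "d = t \<otimes>\<^bsub>G\<^esub> x [^]\<^bsub>G\<^esub> (i::int)" "e = \<psi> t \<otimes>\<^bsub>H\<^esub> y [^]\<^bsub>H\<^esub> i" using \<Delta>E[OF de] by blast
      have it: "inv\<^bsub>G\<^esub> t \<in> S" using t(1) by simp
      have "inv\<^bsub>G\<^esub> d = cx (- i) (inv\<^bsub>G\<^esub> t) \<otimes>\<^bsub>G\<^esub> x [^]\<^bsub>G\<^esub> (- i)"
        using t SC[OF t(1)] xc by (simp add: cx_def G.int_pow_neg G.inv_mult_group G.m_assoc)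
      moreover have "inv\<^bsub>H\<^esub> e = cy (- i) (inv\<^bsub>H\<^esub> (\<psi> t)) \<otimes>\<^bsub>H\<^esub> y [^]\<^bsub>H\<^esub> (- i)"
        using t RC[OF t(1)] yc by (simp add: cy_def H.int_pow_neg H.inv_mult_group H.m_assoc)
      moreover have "cy (- i) (inv\<^bsub>H\<^esub> (\<psi> t)) = \<psi> (cx (- i) (inv\<^bsub>G\<^esub> t))"
        using \<psi>c[OF it] \<psi>inv[OF t(1)] by simp
      ultimately show ?thesis using \<Delta>I[OF cxS[OF it]] by simp
    qed
    show "d \<in> procyclic G (x [^]\<^bsub>G\<^esub> (p ^ (w + k))) \<longleftrightarrow> e \<in> procyclic H (y [^]\<^bsub>H\<^esub> (p ^ (w + k)))"
      if de: "(d, e) \<in> \<Delta>" for d e k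
    proof -
      obtain t i where t: "t \<in> S" "d = t \<otimes>\<^bsub>G\<^esub> x [^]\<^bsub>G\<^esub> (i::int)" "e = \<psi> t \<otimes>\<^bsub>H\<^esub> y [^]\<^bsub>H\<^esub> i" using \<Delta>E[OF de] by blast
      have t1: "t = \<one>\<^bsub>G\<^esub> \<longleftrightarrow> \<psi> t = \<one>\<^bsub>H\<^esub>"
        using \<psi>1 \<psi>(1) t(1) S.one_closed by (metis bij_betw_def inj_onD)
      show ?thesis
      proof
        assume "d \<in> procyclic G (x [^]\<^bsub>G\<^esub> (p ^ (w + k)))"
        then have "t = \<one>\<^bsub>G\<^esub>" "int (p ^ (w + k)) dvd i" using FG(4)[of t i k] t by auto
        then show "e \<in> procyclic H (y [^]\<^bsub>H\<^esub> (p ^ (w + k)))" using FH(5)[of k i] t t1 yc \<psi>1 by simp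
      next
        assume "e \<in> procyclic H (y [^]\<^bsub>H\<^esub> (p ^ (w + k)))"
        then have "\<psi> t = \<one>\<^bsub>H\<^esub>" "int (p ^ (w + k)) dvd i" using FH(4)[of "\<psi> t" i k] t \<psi>R by auto
        then show "d \<in> procyclic G (x [^]\<^bsub>G\<^esub> (p ^ (w + k)))" using FG(5)[of k i] t t1 xc by simp
      qed
    qed
    show "\<exists>(d, e)\<in>\<Delta>. procyclic G (x [^]\<^bsub>G\<^esub> (p ^ (w + k))) #>\<^bsub>G\<^esub> d = procyclic G (x [^]\<^bsub>G\<^esub> (p ^ (w + k))) #>\<^bsub>G\<^esub> g"
      if g: "g \<in> carrier G" for g k
    proof -
      obtain t i where t: "t \<in> S" "procyclic G (x [^]\<^bsub>G\<^esub> (p ^ (w + k))) #>\<^bsub>G\<^esub> (t \<otimes>\<^bsub>G\<^esub> x [^]\<^bsub>G\<^esub> (i::int)) = procyclic G (x [^]\<^bsub>G\<^esub> (p ^ (w + k))) #>\<^bsub>G\<^esub> g"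
        using FG(6)[OF g, of k] by blast
      show ?thesis by (rule bexI[OF _ \<Delta>I[OF t(1), of i]]) (simp add: t(2))
    qed
    show "\<exists>(d, e)\<in>\<Delta>. procyclic H (y [^]\<^bsub>H\<^esub> (p ^ (w + k))) #>\<^bsub>H\<^esub> e = procyclic H (y [^]\<^bsub>H\<^esub> (p ^ (w + k))) #>\<^bsub>H\<^esub> h"
      if h: "h \<in> carrier H" for h k
    proof -
      obtain r i where r: "r \<in> R" "procyclic H (y [^]\<^bsub>H\<^esub> (p ^ (w + k))) #>\<^bsub>H\<^esub> (r \<otimes>\<^bsub>H\<^esub> y [^]\<^bsub>H\<^esub> (i::int)) = procyclic H (y [^]\<^bsub>H\<^esub> (p ^ (w + k))) #>\<^bsub>H\<^esub> h"
        using FH(6)[OF h, of k] by blast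
      obtain t where t: "t \<in> S" "r = \<psi> t" using r(1) \<psi>(1) by (auto simp: bij_betw_def)
      show ?thesis by (rule bexI[OF _ \<Delta>I[OF t(1), of i]]) (use r(2) t(2) in simp)
    qed
  qed (use FG(1-3) FH(1-3) in auto)
  show ?thesis by (rule F.isomorphism)
qed

lemma profinite_code_iso:
  assumes "profinite_group G" "profinite_group H" "profinite_code G c" "profinite_code H c"
  shows "(G, H) \<in> profinite_iso"
proof -
  obtain p M s where c: "c = (p, M, s)" by (cases c)
  have "\<exists>f\<in>iso G H. homeomorphic_map (grp_topology G) (grp_topology H) f"
  proof (cases "p = 0")
    case True
    then show ?thesis using assms c finite_code_iso[of G _ M s H] by (auto simp: profinite_code_def)
  next
    case False
    then show ?thesis using assms c padic_code_iso[of G p _ _ _ M s H] by (auto simp: profinite_code_def)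
  qed
  then show ?thesis using assms by (simp add: profinite_iso_def)
qed


section \<open>Bounds on the codes\<close>

context group
begin

text \<open>Raise the supposed relation to the power \<open>q ^ (f - 1 - i)\<close>: the left side
  becomes the nontrivial \<open>u [^] (q ^ (f - 1))\<close>, the right side a power of
  \<open>u [^] (q ^ f)\<close>.\<close>

lemma exact_prime_power_order:
  assumes u: "u \<in> carrier G" "u [^] (q ^ f) = \<one>" "u [^] (q ^ (f - 1)) \<noteq> \<one>" and ij: "i < j" "j \<le> f"
  shows "u [^] (q ^ i) \<notin> generate G {u [^] (q ^ j :: nat)}"
proof
  assume "u [^] (q ^ i) \<in> generate G {u [^] (q ^ j)}"
  then obtain k :: int where k: "u [^] (q ^ i) = (u [^] (q ^ j)) [^] k"
    using generate_pow[of "u [^] (q ^ j)"] u(1) by auto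
  have "q ^ i * q ^ (f - 1 - i) = q ^ (f - 1)" using ij by (simp add: power_add[symmetric])
  then have "u [^] (q ^ (f - 1)) = (u [^] (q ^ i)) [^] (q ^ (f - 1 - i))" using u(1) by (simp add: nat_pow_pow)
  also have "\<dots> = (u [^] (q ^ j)) [^] (k * int (q ^ (f - 1 - i)))"
    unfolding k using u(1) by (metis int_pow_int int_pow_pow nat_pow_closed)
  also have "\<dots> = ((u [^] (q ^ j)) [^] (q ^ (f - 1 - i))) [^] k"
    using u(1) by (metis int_pow_int int_pow_pow mult.commute nat_pow_closed)
  also have "(u [^] (q ^ j)) [^] (q ^ (f - 1 - i)) = (u [^] (q ^ f)) [^] (q ^ (j - 1 - i))"
  proof -
    have "j + (f - 1 - i) = f + (j - 1 - i)" using ij by simp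
    then have "q ^ j * q ^ (f - 1 - i) = q ^ f * q ^ (j - 1 - i)" by (simp only: power_add[symmetric])
    then show ?thesis using u(1) by (simp only: nat_pow_pow)
  qed
  also have "((u [^] (q ^ f)) [^] (q ^ (j - 1 - i))) [^] k = \<one>" using u(2) by simp
  finally show False using u(3) by simp
qed

text \<open>\<open>k\<close> is the cofactor of \<open>q ^ f\<close> in \<open>ord t\<close>; a
  smaller exponent would contradict minimality of the order.\<close>

lemma prime_power_order_element:
  assumes t: "t \<in> carrier G" "ord t > 0" and q: "prime q" "q ^ f dvd ord t" "f > 0"
  obtains k :: nat where "(t [^] k) [^] (q ^ f) = \<one>" "(t [^] k) [^] (q ^ (f - 1)) \<noteq> \<one>"
proof -
  obtain k where k: "ord t = q ^ f * k" using q(2) by blast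
  have q1: "q > 1" using q(1) prime_gt_1_nat by blast
  have "(t [^] k) [^] (q ^ f) = t [^] (ord t)" using t(1) k by (simp add: nat_pow_pow mult.commute)
  then have 1: "(t [^] k) [^] (q ^ f) = \<one>" using t(1) by simp
  have "(t [^] k) [^] (q ^ (f - 1)) \<noteq> \<one>"
  proof
    assume "(t [^] k) [^] (q ^ (f - 1)) = \<one>"
    then have "t [^] (k * q ^ (f - 1)) = \<one>" using t(1) by (simp add: nat_pow_pow)
    then have "ord t dvd k * q ^ (f - 1)" using pow_eq_id t(1) by blast
    moreover have "k > 0" using k t(2) by (simp add: zero_less_mult_iff)
    ultimately have "ord t \<le> k * q ^ (f - 1)" using q1 by (intro dvd_imp_le) auto
    moreover have "q ^ f = q * q ^ (f - 1)" using q(3) by (metis power_minus_mult mult.commute)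
    ultimately have "q * (q ^ (f - 1) * k) \<le> q ^ (f - 1) * k" using k by (simp add: ac_simps)
    then show False using q1 \<open>k > 0\<close> by simp
  qed
  with 1 show thesis by (rule that)
qed

end

context profinite_group
begin

lemma p_element_pro_p: "\<lbrakk>u \<in> carrier G; u [^] (q ^ f :: nat) = \<one>\<rbrakk> \<Longrightarrow> u \<in> pro_p G q"
  using quotient_carrier quotient_nat_pow[of _ u "q ^ f"] quotient_one[of _ \<one>] subgroup.one_closed[OF open_normal_subgroup]
  unfolding pro_p_def p_elements_def by (auto intro!: exI[of _ f])

text \<open>Lets the prime \<open>p\<close> be bounded through chain factors in the same way as the
  primes of torsion elements.\<close>

lemma padic_generator_pro_p:
  assumes "padic_generator G p x"
  shows "x \<in> pro_p G p" "x \<noteq> \<one>"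
proof -
  note D = padicD[OF assms]
  show "x \<in> pro_p G p"
    unfolding pro_p_def p_elements_def
  proof (intro CollectI conjI allI impI)
    fix N assume N: "open_normal G N"
    show "N #> x \<in> carrier (G Mod N)" using quotient_carrier[OF N D(2)] .
    obtain k where "x [^] (p ^ k) \<in> N" using D(5)[OF N] by blast
    then show "\<exists>k::nat. (N #> x) [^]\<^bsub>G Mod N\<^esub> (p ^ k) = \<one>\<^bsub>G Mod N\<^esub>"
      using quotient_nat_pow[OF N D(2)] quotient_one[OF N, of "x [^] (p ^ k)"] D(2) by (intro exI[of _ k]) simp
  qed (rule D(2))
  show "x \<noteq> \<one>" using padic_torsion_free[OF assms, of 1] D(2) by auto
qed

text \<open>\<open>S\<close> is the union of its cyclic subgroups. Those of one order form an
  antichain, so there are at most \<open>w\<close> for each order in \<open>{..B}\<close>, which has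
  \<open>Suc B\<close> members, and each has at most \<open>B\<close> elements.\<close>

lemma finite_subgroup_card_bound:
  assumes w: "width_at_most (Collect (closed_subgroup G)) w" and S: "subgroup S G" "finite S"
    and ord: "\<And>t. t \<in> S \<Longrightarrow> 0 < ord t \<and> ord t \<le> B"
  shows "card S \<le> Suc B * w * B"
proof -
  interpret S: subgroup S G by fact
  define C where "C = (\<lambda>t. generate G {t}) ` S"
  have Csub: "subgroup c G \<and> c \<subseteq> S \<and> card c \<le> B" if c: "c \<in> C" for c
  proof -
    obtain t where t: "t \<in> S" "c = generate G {t}" using c by (auto simp: C_def)
    have "c \<subseteq> (\<lambda>i. t [^] i) ` {..<ord t}"
    proof
      fix y assume "y \<in> c"
      then obtain i :: nat where "y = t [^] i"
        using generate_nat_pow[of t "ord t" y] t ord[OF t(1)] by auto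
      then have "y = t [^] (i mod ord t)"
        using pow_mod_order[of t "ord t" i "i mod ord t"] t by simp
      then show "y \<in> (\<lambda>i. t [^] i) ` {..<ord t}" using ord[OF t(1)] by auto
    qed
    then have "card c \<le> card ((\<lambda>i. t [^] i) ` {..<ord t})" by (intro card_mono) auto
    also have "\<dots> \<le> ord t" using card_image_le[of "{..<ord t}"] by simp
    finally have "card c \<le> B" using ord[OF t(1)] by simp
    moreover have "c \<subseteq> S" using generate_subgroup_incl[of "{t}" S] S(1) t by simp
    ultimately show ?thesis using t generate_is_subgroup[of "{t}"] by simp
  qed
  have finC: "finite C" using S(2) by (simp add: C_def)
  have "card {c \<in> C. card c = j} \<le> w" for j
  proof (rule w[unfolded width_at_most_def, rule_format])
    show "{c \<in> C. card c = j} \<subseteq> Collect (closed_subgroup G)"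
    proof clarify
      fix c assume "c \<in> C"
      then show "closed_subgroup G c"
        using Csub[of c] S(2) finite_subset finite_subgroup_closed by blast
    qed
    show "H = K" if "H \<in> {c \<in> C. card c = j}" "K \<in> {c \<in> C. card c = j}" "H \<subseteq> K" for H K
    proof (rule card_subset_eq)
      show "finite K" using that Csub[of K] S(2) finite_subset by auto
    qed (use that in auto)
  qed (use finC in simp)
  then have "card (\<Union>j\<in>{..B}. {c \<in> C. card c = j}) \<le> (\<Sum>j\<in>{..B}. w)"
    using card_UN_le[of "{..B}" "\<lambda>j. {c \<in> C. card c = j}"] sum_mono[of "{..B}" "\<lambda>j. card {c \<in> C. card c = j}" "\<lambda>_. w"]
    by simp
  moreover have "(\<Union>j\<in>{..B}. {c \<in> C. card c = j}) = C" using Csub by auto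
  ultimately have cardC: "card C \<le> Suc B * w" by simp
  have "S \<subseteq> \<Union>C" by (auto simp: C_def intro: generate.incl)
  moreover have "finite (\<Union>C)" using finC Csub S(2) finite_subset by blast
  ultimately have "card S \<le> card (\<Union>C)" by (intro card_mono)
  also have "\<dots> \<le> (\<Sum>c\<in>C. card c)" by (rule card_Union_le_sum_card)
  also have "\<dots> \<le> (\<Sum>c\<in>C. B)" using Csub by (intro sum_mono) auto
  also have "\<dots> \<le> Suc B * w * B" using cardC by simp
  finally show ?thesis .
qed

text \<open>A prime power dividing \<open>ord t\<close> is the exact order of a power of
  \<open>t\<close>. The hypothesis at \<open>f = 1\<close> bounds the primes, and at
  \<open>f = Suc E\<close> it fails, so \<open>q ^ Suc E\<close> never divides the order.\<close>

lemma ord_bound: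
  assumes S: "subgroup S G" "finite S" and t: "t \<in> S"
    and bound: "\<And>u q f. \<lbrakk>u \<in> S; prime q; f > 0; u [^] (q ^ f) = \<one>; u [^] (q ^ (f - 1)) \<noteq> \<one>\<rbrakk> \<Longrightarrow> q \<le> w \<and> f \<le> E"
  shows "0 < ord t" "ord t \<le> (\<Prod>q\<in>{q. prime q \<and> q \<le> w}. q ^ Suc E)"
proof -
  interpret S: subgroup S G by fact
  have tc: "t \<in> carrier G" using t by simp
  have "\<not> inj_on (\<lambda>i. t [^] i) (UNIV :: nat set)"
  proof
    assume inj: "inj_on (\<lambda>i. t [^] i) (UNIV :: nat set)"
    have "t [^] int i \<in> S" for i using subgroup_int_pow_closed[OF S(1) t] .
    then have "range (\<lambda>i::nat. t [^] i) \<subseteq> S" by (auto simp: int_pow_int)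
    then have "finite (UNIV :: nat set)" using inj S(2) finite_imageD finite_subset by blast
    then show False by simp
  qed
  then obtain i j :: nat where "i < j" "t [^] i = t [^] j"
    unfolding inj_on_def by (metis linorder_neqE_nat)
  then have "t [^] (j - i) = \<one>" using tc pow_eq_div2[of t j i] by simp
  then have "ord t dvd j - i" using tc pow_eq_id by blast
  then show pos: "0 < ord t" using \<open>i < j\<close> by (auto intro: Nat.gr0I)
  define P where "P = {q. prime q \<and> q \<le> w}"
  have finP: "finite P" by (rule finite_subset[of _ "{..w}"]) (auto simp: P_def)
  have "ord t dvd (\<Prod>q\<in>P. q ^ Suc E)"
  proof (rule dvd_prod_prime_powers[OF pos finP])
    show "prime q" if "q \<in> P" for q using that by (simp add: P_def)
    have key: "q \<le> w \<and> f \<le> E" if q: "prime q" "q ^ f dvd ord t" "f > 0" for q f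
    proof -
      obtain k :: nat where k: "(t [^] k) [^] (q ^ f) = \<one>" "(t [^] k) [^] (q ^ (f - 1)) \<noteq> \<one>"
        using prime_power_order_element[OF tc pos q] .
      have "t [^] int k \<in> S" using subgroup_int_pow_closed[OF S(1) t] .
      then show ?thesis using bound[OF _ q(1,3) k] by (simp add: int_pow_int)
    qed
    show "q \<in> P \<and> \<not> q ^ Suc E dvd ord t" if q: "prime q" "q dvd ord t" for q
      using key[OF q(1), of 1] key[OF q(1), of "Suc E"] q by (auto simp: P_def)
  qed
  moreover have "(\<Prod>q\<in>P. q ^ Suc E) > 0" by (rule prod_pos) (auto simp: P_def prime_gt_0_nat)
  ultimately show "ord t \<le> (\<Prod>q\<in>{q. prime q \<and> q \<le> w}. q ^ Suc E)" unfolding P_def by (rule dvd_imp_le)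
qed

text \<open>In the product of a cyclic group of order \<open>q ^ f\<close> with the \<open>p\<close>-adic integers, the subgroups
  of the same total depth \<open>f\<close> form an antichain.\<close>

lemma padic_split_exponent_bound:
  fixes q f :: nat
  assumes w: "width_at_most (Collect (closed_subgroup G)) w" and sp: "padic_split G p x S v"
    and u: "u \<in> S" "u [^] (q ^ f) = \<one>" "u [^] (q ^ (f - 1)) \<noteq> \<one>"
  shows "f \<le> w"
proof -
  have x: "padic_generator G p x" and S: "S \<lhd> G" "finite S" "S \<inter> procyclic G x = {\<one>}"
    and cen: "\<And>g. g \<in> carrier G \<Longrightarrow> x [^] (p ^ v) \<otimes> g = g \<otimes> x [^] (p ^ v)"
    using sp by (auto simp: padic_split_def)
  have Ssg: "subgroup S G" using S(1) by (rule normal_imp_subgroup)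
  note D = padicD[OF x]
  have uc: "u \<in> carrier G" using subgroup.mem_carrier[OF Ssg u(1)] .
  \<comment> \<open>The central power replaces \<open>x\<close>, so that the products
    \<open>K i\<close> below are subgroups.\<close>
  define z where "z = x [^] (p ^ v)"
  have z: "padic_generator G p z" unfolding z_def by (rule padic_pow[OF x])
  note Z = padicD[OF z]
  have p1: "p > 1" using D(1) prime_gt_1_nat by blast
  have zx: "procyclic G z \<subseteq> procyclic G x" unfolding z_def using procyclic_mono[OF D(2) procyclic_nat_pow[OF D(2)]] .
  define A where "A i = generate G {u [^] (q ^ i)}" for i
  define B where "B i = procyclic G (z [^] (p ^ i))" for i
  have A: "subgroup (A i) G" "A i \<subseteq> S" "u [^] (q ^ i) \<in> A i" for i
  proof -
    show "subgroup (A i) G" unfolding A_def using uc by (intro generate_is_subgroup) simp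
    have "u [^] int (q ^ i) \<in> S" using subgroup_int_pow_closed[OF Ssg u(1)] .
    then have "u [^] (q ^ i) \<in> S" by (metis int_pow_int)
    then show "A i \<subseteq> S" unfolding A_def by (intro generate_subgroup_incl[OF _ Ssg]) simp
    show "u [^] (q ^ i) \<in> A i" unfolding A_def by (auto intro: generate.incl)
  qed
  have B: "subgroup (B i) G" "B i \<subseteq> procyclic G z" "z [^] (p ^ i) \<in> B i" "closedin T (B i)" for i
    unfolding B_def using Z(2) procyclic_subgroup procyclic_mono[OF Z(2) procyclic_nat_pow[OF Z(2)]] procyclic_self procyclic_closedin
    by simp_all
  have Bcen: "b \<otimes> g = g \<otimes> b" if "b \<in> procyclic G z" "g \<in> carrier G" for b g
    using procyclic_commute[OF Z(2) that(2) _ that(1)] cen[OF that(2)] by (simp add: z_def)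
  have unique: "a = a' \<and> b = b'"
    if "a \<in> S" "a' \<in> S" "b \<in> procyclic G z" "b' \<in> procyclic G z" "a \<otimes> b = a' \<otimes> b'" for a a' b b'
  proof -
    interpret S: subgroup S G by (rule Ssg)
    interpret P: subgroup "procyclic G z" G using procyclic_subgroup[OF Z(2)] .
    note car = S.mem_carrier[OF that(1)] S.mem_carrier[OF that(2)] P.mem_carrier[OF that(3)] P.mem_carrier[OF that(4)]
    have "inv a' \<otimes> a = inv a' \<otimes> (a \<otimes> b) \<otimes> inv b" using car by (simp add: m_assoc)
    also have "\<dots> = b' \<otimes> inv b" using that(5) car by simp
    finally have e: "inv a' \<otimes> a = b' \<otimes> inv b" .
    have "inv a' \<otimes> a \<in> S" using that by simp
    moreover have "b' \<otimes> inv b \<in> procyclic G x" using that zx P.m_closed P.m_inv_closed by blast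
    ultimately have "inv a' \<otimes> a = \<one>" using S(3) e by auto
    then have "a = a'" using car by (metis inv_closed inv_equality inv_inv)
    then show ?thesis using that(5) car by simp
  qed
  define K where "K i = A i <#> B (f - i)" for i
  have KI: "a \<otimes> b \<in> K i" if "a \<in> A i" "b \<in> B (f - i)" for a b i
    using that unfolding K_def set_mult_def by blast
  have KE: "\<exists>a\<in>A i. \<exists>b\<in>B (f - i). y = a \<otimes> b" if "y \<in> K i" for y i
    using that unfolding K_def set_mult_def by blast
  have Kcl: "closed_subgroup G (K i)" for i
  proof -
    have "subgroup (K i) G" unfolding K_def
      using Bcen[OF subsetD[OF B(2)] subgroup.mem_carrier[OF A(1)]]
      by (intro commuting_product_subgroup[OF A(1) B(1)]) simp
    moreover have "closedin T (A i)"
      using finite_subgroup_closed[OF A(1)] finite_subset[OF A(2) S(2)] by (simp add: closed_subgroup_def)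
    then have "closedin T (K i)" unfolding K_def using compact_set_mult_closed B(4) by blast
    ultimately show ?thesis by (simp add: closed_subgroup_def)
  qed
  \<comment> \<open>By uniqueness of the factorization the two factors can be compared separately:
    the one in \<open>S\<close> forces \<open>j \<le> i\<close>, the p-adic one forces
    \<open>i \<le> j\<close>.\<close>
  have anti: "i = j" if ij: "i \<le> f" "j \<le> f" "K i \<subseteq> K j" for i j
  proof -
    have one: "\<one> \<in> A l" "\<one> \<in> B l" for l using subgroup.one_closed[OF A(1)] subgroup.one_closed[OF B(1)] by simp_all
    have oz: "\<one> \<in> procyclic G z" "\<one> \<in> S" using procyclic_one_mem[OF Z(2)] subgroup.one_closed[OF Ssg] by auto
    have "u [^] (q ^ i) \<otimes> \<one> \<in> K j" using KI[OF A(3) one(2)] ij(3) by blast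
    then obtain a b where ab: "a \<in> A j" "b \<in> B (f - j)" "u [^] (q ^ i) \<otimes> \<one> = a \<otimes> b" using KE by blast
    then have "u [^] (q ^ i) = a"
      using unique[OF subsetD[OF A(2) A(3)] subsetD[OF A(2) ab(1)] oz(1) subsetD[OF B(2) ab(2)] ab(3)] by simp
    then have "u [^] (q ^ i) \<in> generate G {u [^] (q ^ j)}" using ab(1) by (simp add: A_def)
    then have ji: "j \<le> i" using exact_prime_power_order[OF uc u(2,3), of i j] ij(2) by (meson not_le)
    have "\<one> \<otimes> z [^] (p ^ (f - i)) \<in> K j" using KI[OF one(1) B(3)] ij(3) by blast
    then obtain a' b' where ab': "a' \<in> A j" "b' \<in> B (f - j)" "\<one> \<otimes> z [^] (p ^ (f - i)) = a' \<otimes> b'" using KE by blast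
    then have "z [^] (p ^ (f - i)) = b'"
      using unique[OF oz(2) subsetD[OF A(2) ab'(1)] subsetD[OF B(2) B(3)] subsetD[OF B(2) ab'(2)] ab'(3)] by simp
    then have "z [^] int (p ^ (f - i)) \<in> procyclic G (z [^] (p ^ (f - j)))"
      using ab'(2) unfolding B_def by (metis int_pow_int)
    then have "int (p ^ (f - j)) dvd int (p ^ (f - i))" by (rule Z(4))
    then have "p ^ (f - j) dvd p ^ (f - i)" by (simp only: int_dvd_int_iff)
    then have "f - j \<le> f - i" using p1 power_dvd_imp_le by blast
    then show ?thesis using ji ij by simp
  qed
  have "card (K ` {..f}) \<le> w"
    by (rule w[unfolded width_at_most_def, rule_format]) (use Kcl anti in auto)
  moreover have "inj_on K {..f}" using anti by (intro inj_onI) auto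
  ultimately show ?thesis by (simp add: card_image)
qed

text \<open>In a finite group all subgroups are open and closed, so both lattices are the full
  subgroup lattice. The powers \<open>u [^] (q ^ i)\<close> generate \<open>f + 1\<close> distinct
  subgroups, which bounds \<open>f\<close> by the size of \<open>L\<close>.\<close>

lemma finite_exponent_bound:
  fixes q f :: nat
  assumes fin: "finite (carrier G)" and u: "u \<in> carrier G" "u [^] (q ^ f) = \<one>" "u [^] (q ^ (f - 1)) \<noteq> \<one>"
    and iso: "lattice_isomorphic (closed_subgroup_lattice G) L \<or> lattice_isomorphic (open_subgroup_lattice G) L"
  shows "f \<le> card (carrier L)"
proof -
  let ?S = "{H. subgroup H G}"
  have op: "openin T H" if "subgroup H G" for H
    using openin_subgroup_superset[OF that triv_subgroup] open_normal_one[OF fin] subgroup.one_closed[OF that]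
    by (simp add: open_normal_def)
  have eq: "Collect (closed_subgroup G) = ?S" "{H. subgroup H G \<and> openin T H} = ?S"
  proof -
    have cl: "closed_subgroup G H" if "subgroup H G" for H
      using finite_subgroup_closed[OF that finite_subset[OF subgroup.subset[OF that] fin]] .
    show "Collect (closed_subgroup G) = ?S" using cl closed_subgroup_def by (intro Collect_cong) blast
    show "{H. subgroup H G \<and> openin T H} = ?S" using op by (intro Collect_cong) blast
  qed
  have "lattice_isomorphic (inclusion_order ?S) L"
    using iso unfolding closed_subgroup_lattice_eq open_subgroup_lattice_eq eq by blast
  then obtain g where "bij_betw g (carrier (inclusion_order ?S)) (carrier L)" 
    by (rule lattice_isomorphic_order_iso)
  then have card: "card ?S = card (carrier L)" by (simp add: bij_betw_same_card inclusion_order_def)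
  define A where "A i = generate G {u [^] (q ^ i)}" for i
  have "inj_on A {..f}"
  proof (rule inj_onI)
    fix i j assume ij: "i \<in> {..f}" "j \<in> {..f}" "A i = A j"
    have mem: "u [^] (q ^ k) \<in> A k" for k unfolding A_def by (auto intro: generate.incl)
    show "i = j"
    proof (rule linorder_cases[of i j])
      assume "i < j"
      then show ?thesis using exact_prime_power_order[OF u, of i j] mem[of i] ij by (simp add: A_def)
    next
      assume "j < i"
      then show ?thesis using exact_prime_power_order[OF u, of j i] mem[of j] ij by (simp add: A_def)
    qed
  qed
  moreover have "A ` {..f} \<subseteq> ?S" using u(1) by (auto simp: A_def intro!: generate_is_subgroup)
  moreover have "finite ?S" 
    by (rule finite_subset[of _ "Pow (carrier G)"]) (use fin subgroup.subset in auto)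
  ultimately have "card {..f} \<le> card ?S" by (meson card_inj_on_le)
  then show ?thesis using card by simp
qed

lemma lattice_iso_width:
  assumes "has_width L w"
    and "lattice_isomorphic (closed_subgroup_lattice G) L \<or> lattice_isomorphic (open_subgroup_lattice G) L"
  shows "width_at_most (Collect (closed_subgroup G)) w"
  using assms width_of_isomorphic width_closed_of_width_open
  unfolding closed_subgroup_lattice_eq open_subgroup_lattice_eq by blast

lemma profinite_code_exists:
  assumes w: "width_at_most (Collect (closed_subgroup G)) w"
  obtains c where "profinite_code G c"
proof (cases "finite (carrier G)")
  case True
  obtain M s where "has_code G \<one> (carrier G) M s"
    using has_code_exists[of "carrier G" G \<one>] True by (metis inv_closed m_closed one_closed)
  then show ?thesis using that[of "(0, M, s)"] True by (simp add: profinite_code_def)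
next
  case False
  obtain p x S v where sp: "padic_split G p x S v" using padic_split_exists[OF w False] .
  then have S: "S \<lhd> G" "finite S" "prime p" "x \<in> carrier G" by (auto simp: padic_split_def padic_generator_def)
  obtain M s where "has_code G x S M s"
    using has_code_exists[of S G x] S(2) normal_conj[OF S(1,4)] subgroup.m_closed[OF normal_imp_subgroup[OF S(1)]] by metis
  then have "profinite_code G (p, M, s)" using sp S(3) by (auto simp: profinite_code_def)
  then show ?thesis by (rule that)
qed

text \<open>The maximum covers both cases: \<open>w\<close> bounds the exponents of torsion beside a
  p-adic factor, and \<open>n\<close>, later the cardinality of the lattice, those of a finite
  group. \<open>card\<close> of an infinite lattice is \<open>0\<close>.\<close>

definition (in -) order_bound :: "nat \<Rightarrow> nat \<Rightarrow> nat" where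
  "order_bound w n = (\<Prod>q\<in>{q. prime q \<and> q \<le> w}. q ^ Suc (max w n))"

definition (in -) group_bound :: "nat \<Rightarrow> nat \<Rightarrow> nat" where
  "group_bound w n = Suc (order_bound w n) * w * order_bound w n"

text \<open>A nontrivial pro-q element for a prime \<open>q > w\<close> would produce a chain
  factor. Applied to the generator this bounds \<open>p\<close>; applied to torsion elements it
  bounds the primes dividing orders in \<open>S\<close>, whose exponents are bounded
  separately.\<close>

lemma profinite_code_bounded:
  assumes hw: "has_width L w"
    and iso: "lattice_isomorphic (closed_subgroup_lattice G) L \<or> lattice_isomorphic (open_subgroup_lattice G) L"
    and nc: "\<not> has_nontrivial_chain_factor L" and code: "profinite_code G (p, M, s)"
  shows "p \<le> w" "length s \<le> group_bound w (card (carrier L))"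
proof -
  have w: "width_at_most (Collect (closed_subgroup G)) w" using lattice_iso_width[OF hw iso] .
  have prime_bound: "q \<le> w" if "prime q" "y \<in> pro_p G q" "y \<noteq> \<one>" for q y
  proof (rule ccontr)
    assume "\<not> q \<le> w"
    moreover have "pro_p G q \<noteq> {\<one>}" using that by blast
    ultimately show False using pro_p_chain_factor[OF w that(1) _ _ iso] nc by simp
  qed
  have u1: "u \<noteq> \<one>" if "u [^] (q ^ (f - 1)) \<noteq> \<one>" for u and q f :: nat using that by auto
  show "p \<le> w"
  proof (cases "p = 0")
    case False
    then obtain x where "padic_generator G p x" using code by (auto simp: profinite_code_def padic_split_def)
    then show ?thesis using prime_bound padic_generator_pro_p padicD(1) by blast
  qed simp
  obtain S y where S: "has_code G y S M s" "subgroup S G" "finite S"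
    and exp: "\<And>u (q::nat) f. \<lbrakk>u \<in> S; u [^] (q ^ f) = \<one>; u [^] (q ^ (f - 1)) \<noteq> \<one>\<rbrakk> \<Longrightarrow> f \<le> max w (card (carrier L))"
  proof (cases "p = 0")
    case True
    then have "finite (carrier G)" "has_code G \<one> (carrier G) M s" using code by (auto simp: profinite_code_def)
    then show ?thesis using that[of \<one> "carrier G"] subgroup_self finite_exponent_bound[OF _ _ _ _ iso] max.coboundedI2 by metis
  next
    case False
    then obtain x S v where sp: "padic_split G p x S v" "has_code G x S M s" using code by (auto simp: profinite_code_def)
    moreover from sp have "subgroup S G" "finite S" using normal_imp_subgroup by (auto simp: padic_split_def)
    ultimately show ?thesis using that[of x S] padic_split_exponent_bound[OF w sp(1)] max.coboundedI1 by metis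
  qed
  have "card S \<le> group_bound w (card (carrier L))"
    unfolding group_bound_def
  proof (rule finite_subgroup_card_bound[OF w S(2,3)])
    fix t assume t: "t \<in> S"
    have "q \<le> w \<and> f \<le> max w (card (carrier L))"
      if u: "u \<in> S" "prime q" "f > 0" "u [^] (q ^ f) = \<one>" "u [^] (q ^ (f - 1)) \<noteq> \<one>" for u q f
      using exp[OF u(1,4,5)] prime_bound[OF u(2) p_element_pro_p[OF subgroup.mem_carrier[OF S(2) u(1)] u(4)] u1[OF u(5)]] by simp
    from ord_bound[OF S(2,3) t this, folded order_bound_def]
    show "0 < ord t \<and> ord t \<le> order_bound w (card (carrier L))" by (rule conjI)
  qed
  then show "length s \<le> group_bound w (card (carrier L))" using has_code_bounded(1)[OF S(1)] by simp
qed

end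

text \<open>\<open>F\<close> sends a code to the class of a chosen group having it. On codes that no
  group in \<open>K\<close> has, the choice is arbitrary, so only an inclusion is claimed.\<close>

lemma profinite_classes_of_codes:
  assumes K: "K \<subseteq> Collect profinite_group" and Y: "\<And>G. G \<in> K \<Longrightarrow> \<exists>c\<in>Y. profinite_code G c"
  obtains F where "K // profinite_iso \<subseteq> F ` Y"
proof
  define F where "F c = profinite_iso `` {SOME G. G \<in> K \<and> profinite_code G c}" for c
  show "K // profinite_iso \<subseteq> F ` Y"
  proof
    fix Q assume "Q \<in> K // profinite_iso"
    then obtain G where G: "G \<in> K" "Q = profinite_iso `` {G}" by (auto simp: quotient_def)
    obtain c where c: "c \<in> Y" "profinite_code G c" using Y[OF G(1)] by blast
    define H where "H = (SOME H. H \<in> K \<and> profinite_code H c)"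
    have "H \<in> K \<and> profinite_code H c" unfolding H_def by (rule someI[of _ G]) (use G c in blast)
    then have "(G, H) \<in> profinite_iso" using profinite_code_iso[of G H c] G(1) c(2) K by blast
    then have "profinite_iso `` {G} = profinite_iso `` {H}" using equiv_class_eq[OF equiv_profinite_iso] by blast
    then show "Q \<in> F ` Y" using G(2) c(1) unfolding F_def H_def by blast
  qed
qed

text \<open>The disjunction in the hypothesis lets one statement serve both lattices. Codes form a
  countable type, and without chain factors they all lie in the finite set \<open>Y\<close>.\<close>

lemma profinite_classes_countable_finite:
  fixes K :: "'g topgroup set" and L :: "'l gorder"
  assumes hw: "has_width L w"
    and K: "\<And>G. G \<in> K \<Longrightarrow> profinite_group G \<and>
      (lattice_isomorphic (closed_subgroup_lattice G) L \<or> lattice_isomorphic (open_subgroup_lattice G) L)"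
  shows "countable (K // profinite_iso)"
    and "\<not> has_nontrivial_chain_factor L \<Longrightarrow> finite (K // profinite_iso)"
proof -
  have KP: "K \<subseteq> Collect profinite_group" using K by blast
  have code: "\<exists>c. profinite_code G c" if "G \<in> K" for G
    using K[OF that] profinite_group.profinite_code_exists profinite_group.lattice_iso_width[OF _ hw] by metis
  obtain F :: "nat \<times> nat list list \<times> nat list \<Rightarrow> 'g topgroup set" where "K // profinite_iso \<subseteq> F ` UNIV"
  proof (rule profinite_classes_of_codes[OF KP, of UNIV])
    show "\<exists>c\<in>UNIV. profinite_code G c" if "G \<in> K" for G using code[OF that] by simp
  qed
  then show "countable (K // profinite_iso)" by (rule countable_subset) (intro countable_image countableI_type)
  assume nc: "\<not> has_nontrivial_chain_factor L"
  define B where "B = group_bound w (card (carrier L))"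
  define R where "R = {r :: nat list. set r \<subseteq> {..<B} \<and> length r \<le> B}"
  define Y where "Y = {..w} \<times> {M. set M \<subseteq> R \<and> length M \<le> B} \<times> R"
  have "finite R" unfolding R_def by (rule finite_lists_length_le) simp
  then have "finite Y" unfolding Y_def using finite_lists_length_le[of R B] by simp
  moreover obtain F' :: "nat \<times> nat list list \<times> nat list \<Rightarrow> 'g topgroup set" where "K // profinite_iso \<subseteq> F' ` Y"
  proof (rule profinite_classes_of_codes[OF KP, of Y])
    fix G assume G: "G \<in> K"
    interpret profinite_group G using K[OF G] by blast
    obtain p M s where c: "profinite_code G (p, M, s)" using code[OF G] by (metis prod_cases3)
    have b: "p \<le> w" "length s \<le> B" using profinite_code_bounded[OF hw _ nc c] K[OF G] by (auto simp: B_def)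
    obtain y S where "has_code G y S M s" using c by (auto simp: profinite_code_def split: if_splits)
    note hc = has_code_bounded[OF this]
    have sub: "{..<card S} \<subseteq> {..<B}" using b(2) hc(1) by auto
    have "s \<in> R" using hc(1,2) b(2) sub unfolding R_def by auto
    moreover have "set M \<subseteq> R" using hc(1,4) b(2) sub unfolding R_def by fastforce
    moreover have "length M \<le> B" using hc(1,3) b(2) by simp
    ultimately have "(p, M, s) \<in> Y" using b(1) by (simp add: Y_def)
    then show "\<exists>c\<in>Y. profinite_code G c" using c by blast
  qed
  ultimately show "finite (K // profinite_iso)" using finite_surj by blast
qed

theorem corollary5p2:
  fixes L :: "'l gorder" and w :: nat
  assumes "lattice L" and "has_width L w"
  shows "countable ({G :: 'g topgroup. profinite_group G \<and>
            lattice_isomorphic (closed_subgroup_lattice G) L} // profinite_iso) \<and>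
         countable ({G :: 'g topgroup. profinite_group G \<and>
            lattice_isomorphic (open_subgroup_lattice G) L} // profinite_iso) \<and>
         (\<not> has_nontrivial_chain_factor L \<longrightarrow>
            finite ({G :: 'g topgroup. profinite_group G \<and>
              lattice_isomorphic (closed_subgroup_lattice G) L} // profinite_iso) \<and>
            finite ({G :: 'g topgroup. profinite_group G \<and>
              lattice_isomorphic (open_subgroup_lattice G) L} // profinite_iso))"
  by (intro conjI impI profinite_classes_countable_finite[OF assms(2)]) auto

end
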